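(* Assume the following setting. $\mathcal X,\mathcal Y$ are complex Hilbert spaces, $A:\mathcal X\supset\operatorname{dom}A\to\mathcal Y$ is closed, densely defined with $\|Ax\|_{\mathcal Y}\ge c\|x\|_{\mathcal X}$ ($c>0$), $\mathcal X_h$ is $\operatorname{dom}A$ with inner product $\langle Ax,Ay\rangle_{\mathcal Y}$, $\mathcal Y_1=\operatorname{ran}A$, $B:\mathcal Y\supset\operatorname{dom}B\to\mathcal X$ is closed, densely defined with $A^*\subset-B$, $B_{\mathcal Y_1}$ is the restriction of $B$ to $\operatorname{dom}B\cap\mathcal Y_1$, and $\mathcal A$ on $\mathcal X_h\times\mathcal X$ is given by $\operatorname{dom}\mathcal A=\{(z_1,z_2)\in\mathcal X_h\times\mathcal X_h: Az_1\in\operatorname{dom}B\}$, $\mathcal A(z_1,z_2)=(z_2,BAz_1)$. Let $\mathcal G_1,\mathcal G_2$ be Hilbert spaces, $\Lambda=(\Lambda_1,\Lambda_2):\operatorname{dom}A\to\mathcal G_1\times\mathcal G_2^*$ and $\Pi=(\Pi_1,\Pi_2):\operatorname{dom}B\to\mathcal G_1^*\times\mathcal G_2$ surjective linear maps with $-\langle By,x\rangle_{\mathcal X}-\langle y,Ax\rangle_{\mathcal Y}=\langle\Pi_1y,\Lambda_1x\rangle_{\mathcal G_1^*,\mathcal G_1}-\langle\Pi_2y,\Lambda_2x\rangle_{\mathcal G_2,\mathcal G_2^*}$ for all $y\in\operatorname{dom}B$, $x\in\operatorname{dom}A$. Let $\mathcal G=\mathcal G_1\times\mathcal G_2$, $\mathcal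 G^*=\mathcal G_1^*\times\mathcal G_2^*$, and on $\operatorname{dom}\mathcal A$ let $\Gamma_0(z_1,z_2)=(\Lambda_1z_2,\Pi_2Az_1)$, $\Gamma_1(z_1,z_2)=(-\Pi_1Az_1,\Lambda_2z_2)$. Let $M\in L(\mathcal X)$ be self-adjoint and uniformly positive, $D\in L(\mathcal X)$ with $-D$ dissipative, and let $\mathcal X_M$ be $\mathcal X$ with inner product $\langle M^{-1}\cdot,\cdot\rangle_{\mathcal X}$. Define $\mathcal A_M$ on $\mathcal X_h\times\mathcal X_M$ by $\operatorname{dom}\mathcal A_M=\{(z_1,z_2)\in\mathcal X_h\times M\mathcal X_h: Az_1\in\operatorname{dom}B_{\mathcal Y_1}\}$, $\mathcal A_M(z_1,z_2)=(M^{-1}z_2,\ B_{\mathcal Y_1}Az_1-DM^{-1}z_2)$. Let $P\in L(\mathcal G^* )$ with $\|P\|\le1$ and let $N$ be the colligation with input and output space $\mathcal G^*$, state space $\mathcal X_h\times\mathcal X_M$, domain $\operatorname{dom}\mathcal A_M$, input boundary operator $\tfrac12\big((1-P)\mathcal R_{\mathcal G}\Gamma_0+(1+P)\Gamma_1\big)\operatorname{diag}(I,M^{-1})$, interior operator $\mathcal A_M$, and output boundary operator $\tfrac12\big((1+P)\mathcal R_{\mathcal G}\Gamma_0+(1-P)\Gamma_1\big)\operatorname{diag}(I,M^{-1})$. Then $N$ is an impedance passive internally well-posed boundary node.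
   Context: All Hilbert spaces are complex; $\mathcal H^*$ is the anti-dual of $\mathcal H$ with duality pairing $\langle\cdot,\cdot\rangle_{\mathcal H^*,\mathcal H}$, $\langle h,\phi\rangle_{\mathcal H,\mathcal H^*}:=\overline{\langle\phi,h\rangle_{\mathcal H^*,\mathcal H}}$, and $\mathcal R_{\mathcal H}:\mathcal H\to\mathcal H^*$ is the Riesz isomorphism; $\mathcal H^*$ carries the Hilbert structure making $\mathcal R_{\mathcal H}$ unitary. $-D$ dissipative means $\operatorname{Re}\langle Dx,x\rangle_{\mathcal X}\ge0$ for all $x$. $\operatorname{diag}(I,M^{-1})(z_1,z_2)=(z_1,M^{-1}z_2)$. A colligation with input space $\mathcal U$, state space $\mathcal V$, output space $\mathcal W$ consists of linear maps $G,L,K$ with common domain $\mathcal Z\subset\mathcal V$ and values in $\mathcal U,\mathcal V,\mathcal W$. It is a boundary node if (a) $z\mapsto(Gz,Lz,Kz)$ is a closed operator from $\mathcal V$ to $\mathcal U\times\mathcal V\times\mathcal W$; (b) $G$ is surjective with $\ker G$ dense in $\mathcal V$; (c) $L|_{\ker G}$ has nonempty resolvent set; it is internally well-posed if moreover $L|_{\ker G}$ generates a $C_0$-semigroup. Smooth solutions: $u\in C^2(\mathbb R_{\ge0};\mathcal U)$, $z\in C^1(\mathbb R_{\ge0};\mathcal V)\cap C(\mathbb R_{\ge0};\mathcal Z)$ (graph norm), $y\in C(\mathbb R_{\ge0};\mathcal W)$ with $u=Gz$, $\dot z=Lz$, $y=Kz$. An internally well-posed boundary node is scattering passive if all smooth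 solutions satisfy $\frac{d}{dt}\|z(t)\|^2+\|y(t)\|^2\le\|u(t)\|^2$. For a colligation $(G,L,K)$ with $\mathcal U=\mathcal W$ and $\operatorname{Re}\beta>0$, its external Cayley transform with parameter $\beta$ has the same domain and interior operator and boundary operators $G^{(\beta)}=\frac1{\sqrt{2\operatorname{Re}\beta}}(\beta G+K)$, $K^{(\beta)}=\frac1{\sqrt{2\operatorname{Re}\beta}}(\bar\beta G-K)$; the colligation is impedance passive if its external Cayley transform is a scattering passive boundary node for some $\beta$ with $\operatorname{Re}\beta>0$. *)

theory Defs
  imports "HOL-Analysis.Analysis" "HOL-Library.Function_Algebras"
begin

class cvec = ab_group_add +
  fixes scaleC :: "complex \<Rightarrow> 'a \<Rightarrow> 'a" (infixr \<open>*\<^sub>C\<close> 75)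
  assumes scaleC_add_right: "a *\<^sub>C (x + y) = a *\<^sub>C x + a *\<^sub>C y"
    and scaleC_add_left: "(a + b) *\<^sub>C x = a *\<^sub>C x + b *\<^sub>C x"
    and scaleC_scaleC: "a *\<^sub>C (b *\<^sub>C x) = (a * b) *\<^sub>C x"
    and scaleC_one: "1 *\<^sub>C x = x"

instantiation complex :: cvec
begin
definition scaleC_complex :: "complex \<Rightarrow> complex \<Rightarrow> complex" where "scaleC_complex a x = a * x"
instance by standard (auto simp: scaleC_complex_def algebra_simps)
end

instantiation prod :: (cvec, cvec) cvec
begin
definition scaleC_prod :: "complex \<Rightarrow> 'a \<times> 'b \<Rightarrow> 'a \<times> 'b" where
  "scaleC_prod a x = (a *\<^sub>C fst x, a *\<^sub>C snd x)"
instance by standard (auto simp: scaleC_prod_def scaleC_add_right scaleC_add_left scaleC_scaleC scaleC_one)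
end

instantiation "fun" :: (type, cvec) cvec
begin
definition scaleC_fun :: "complex \<Rightarrow> ('a \<Rightarrow> 'b) \<Rightarrow> 'a \<Rightarrow> 'b" where
  "scaleC_fun a f = (\<lambda>x. a *\<^sub>C f x)"
instance by standard (auto simp: scaleC_fun_def scaleC_add_right scaleC_add_left scaleC_scaleC scaleC_one fun_eq_iff)
end

text \<open>A (complex) Hilbert space is represented by a carrier set inside an ambient complex vector
  space together with an inner product, linear in the first and conjugate linear in the second argument.\<close>

record 'a hspace =
  hcarrier :: "'a set"
  hinner :: "'a \<Rightarrow> 'a \<Rightarrow> complex"

definition hnorm :: "'a hspace \<Rightarrow> 'a \<Rightarrow> real" where
  "hnorm H x = sqrt (Re (hinner H x x))"

definition csubspace :: "'a::cvec set \<Rightarrow> bool" where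
  "csubspace S \<longleftrightarrow> 0 \<in> S \<and> (\<forall>x\<in>S. \<forall>y\<in>S. x + y \<in> S) \<and> (\<forall>c. \<forall>x\<in>S. c *\<^sub>C x \<in> S)"

definition clinear_on :: "'a::cvec set \<Rightarrow> ('a \<Rightarrow> 'b::cvec) \<Rightarrow> bool" where
  "clinear_on S f \<longleftrightarrow> (\<forall>x\<in>S. \<forall>y\<in>S. f (x + y) = f x + f y) \<and> (\<forall>c. \<forall>x\<in>S. f (c *\<^sub>C x) = c *\<^sub>C f x)"

definition is_hilbert :: "'a::cvec hspace \<Rightarrow> bool" where
  "is_hilbert H \<longleftrightarrow> csubspace (hcarrier H) \<and>
     (\<forall>x\<in>hcarrier H. \<forall>y\<in>hcarrier H. \<forall>z\<in>hcarrier H. hinner H (x + y) z = hinner H x z + hinner H y z) \<and>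
     (\<forall>c. \<forall>x\<in>hcarrier H. \<forall>y\<in>hcarrier H. hinner H (c *\<^sub>C x) y = c * hinner H x y) \<and>
     (\<forall>x\<in>hcarrier H. \<forall>y\<in>hcarrier H. hinner H y x = cnj (hinner H x y)) \<and>
     (\<forall>x\<in>hcarrier H. Re (hinner H x x) \<ge> 0) \<and>
     (\<forall>x\<in>hcarrier H. hinner H x x = 0 \<longrightarrow> x = 0) \<and>
     (\<forall>f. (\<forall>n. f n \<in> hcarrier H) \<and> (\<forall>e>0. \<exists>N. \<forall>m\<ge>N. \<forall>n\<ge>N. hnorm H (f m - f n) < e)
          \<longrightarrow> (\<exists>l\<in>hcarrier H. (\<lambda>n. hnorm H (f n - l)) \<longlonglongrightarrow> 0))"

definition hlim :: "'a::cvec hspace \<Rightarrow> ('b \<Rightarrow> 'a) \<Rightarrow> 'b filter \<Rightarrow> 'a \<Rightarrow> bool" where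
  "hlim H f F l \<longleftrightarrow> l \<in> hcarrier H \<and> ((\<lambda>t. hnorm H (f t - l)) \<longlongrightarrow> 0) F"

definition dense_in :: "'a::cvec hspace \<Rightarrow> 'a set \<Rightarrow> bool" where
  "dense_in H S \<longleftrightarrow> S \<subseteq> hcarrier H \<and>
     (\<forall>x\<in>hcarrier H. \<exists>xs. (\<forall>n. xs n \<in> S) \<and> hlim H xs sequentially x)"

definition prod_hs :: "'a::cvec hspace \<Rightarrow> 'b::cvec hspace \<Rightarrow> ('a \<times> 'b) hspace" where
  "prod_hs H1 H2 = \<lparr>hcarrier = hcarrier H1 \<times> hcarrier H2,
      hinner = (\<lambda>p q. hinner H1 (fst p) (fst q) + hinner H2 (snd p) (snd q))\<rparr>"

definition bounded_op :: "'a::cvec hspace \<Rightarrow> 'b::cvec hspace \<Rightarrow> ('a \<Rightarrow> 'b) \<Rightarrow> bool" where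
  "bounded_op H1 H2 T \<longleftrightarrow> clinear_on (hcarrier H1) T \<and> T ` hcarrier H1 \<subseteq> hcarrier H2 \<and>
     (\<exists>K. \<forall>x\<in>hcarrier H1. hnorm H2 (T x) \<le> K * hnorm H1 x)"

definition closed_op :: "'a::cvec hspace \<Rightarrow> 'b::cvec hspace \<Rightarrow> 'a set \<Rightarrow> ('a \<Rightarrow> 'b) \<Rightarrow> bool" where
  "closed_op H1 H2 Dm T \<longleftrightarrow> csubspace Dm \<and> Dm \<subseteq> hcarrier H1 \<and> clinear_on Dm T \<and> T ` Dm \<subseteq> hcarrier H2 \<and>
     (\<forall>xs x y. (\<forall>n. xs n \<in> Dm) \<and> hlim H1 xs sequentially x \<and> hlim H2 (\<lambda>n. T (xs n)) sequentially y
        \<longrightarrow> x \<in> Dm \<and> T x = y)"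

definition riesz :: "'a::cvec hspace \<Rightarrow> 'a \<Rightarrow> ('a \<Rightarrow> complex)" where
  "riesz H g = (\<lambda>h. if h \<in> hcarrier H then hinner H g h else 0)"

definition riesz_inv :: "'a::cvec hspace \<Rightarrow> ('a \<Rightarrow> complex) \<Rightarrow> 'a" where
  "riesz_inv H \<phi> = the_inv_into (hcarrier H) (riesz H) \<phi>"

text \<open>The anti-dual: bounded conjugate-linear functionals (extended by 0 outside the carrier), with
  duality pairing \<open>\<langle>\<phi>,h\<rangle> = \<phi> h\<close> and the Hilbert structure making the Riesz map unitary.\<close>
definition antidual :: "'a::cvec hspace \<Rightarrow> ('a \<Rightarrow> complex) hspace" where
  "antidual H = \<lparr>hcarrier = {\<phi>. (\<forall>x\<in>hcarrier H. \<forall>y\<in>hcarrier H. \<phi> (x + y) = \<phi> x + \<phi> y) \<and>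
                               (\<forall>c. \<forall>x\<in>hcarrier H. \<phi> (c *\<^sub>C x) = cnj c * \<phi> x) \<and>
                               (\<exists>K. \<forall>x\<in>hcarrier H. cmod (\<phi> x) \<le> K * hnorm H x) \<and>
                               (\<forall>x. x \<notin> hcarrier H \<longrightarrow> \<phi> x = 0)},
                 hinner = (\<lambda>\<phi> \<psi>. hinner H (riesz_inv H \<phi>) (riesz_inv H \<psi>))\<rparr>"

definition c0_semigroup :: "'a::cvec hspace \<Rightarrow> (real \<Rightarrow> 'a \<Rightarrow> 'a) \<Rightarrow> bool" where
  "c0_semigroup H T \<longleftrightarrow> (\<forall>t\<ge>0. bounded_op H H (T t)) \<and> (\<forall>x\<in>hcarrier H. T 0 x = x) \<and>
     (\<forall>t s x. t \<ge> 0 \<longrightarrow> s \<ge> 0 \<longrightarrow> x \<in> hcarrier H \<longrightarrow> T (t + s) x = T t (T s x)) \<and>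
     (\<forall>x\<in>hcarrier H. hlim H (\<lambda>t. T t x) (at_right 0) x)"

definition generates_c0 :: "'a::cvec hspace \<Rightarrow> 'a set \<Rightarrow> ('a \<Rightarrow> 'a) \<Rightarrow> bool" where
  "generates_c0 H Dm L \<longleftrightarrow> (\<exists>T. c0_semigroup H T \<and>
     Dm = {x\<in>hcarrier H. \<exists>y. hlim H (\<lambda>h. complex_of_real (1 / h) *\<^sub>C (T h x - x)) (at_right 0) y} \<and>
     (\<forall>x\<in>Dm. hlim H (\<lambda>h. complex_of_real (1 / h) *\<^sub>C (T h x - x)) (at_right 0) (L x)))"

definition in_resolvent :: "'a::cvec hspace \<Rightarrow> 'a set \<Rightarrow> ('a \<Rightarrow> 'a) \<Rightarrow> complex \<Rightarrow> bool" where
  "in_resolvent H Dm L \<mu> \<longleftrightarrow> bij_betw (\<lambda>x. \<mu> *\<^sub>C x - L x) Dm (hcarrier H) \<and>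
     bounded_op H H (the_inv_into Dm (\<lambda>x. \<mu> *\<^sub>C x - L x))"

definition hs_has_deriv :: "'a::cvec hspace \<Rightarrow> (real \<Rightarrow> 'a) \<Rightarrow> 'a \<Rightarrow> real \<Rightarrow> bool" where
  "hs_has_deriv H f d t \<longleftrightarrow>
     hlim H (\<lambda>s. complex_of_real (1 / (s - t)) *\<^sub>C (f s - f t)) (at t within {0..}) d"

definition hs_C0 :: "'a::cvec hspace \<Rightarrow> (real \<Rightarrow> 'a) \<Rightarrow> bool" where
  "hs_C0 H f \<longleftrightarrow> (\<forall>t\<ge>0. f t \<in> hcarrier H \<and> hlim H f (at t within {0..}) (f t))"

definition hs_C1 :: "'a::cvec hspace \<Rightarrow> (real \<Rightarrow> 'a) \<Rightarrow> bool" where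
  "hs_C1 H f \<longleftrightarrow> hs_C0 H f \<and> (\<exists>f'. hs_C0 H f' \<and> (\<forall>t\<ge>0. hs_has_deriv H f (f' t) t))"

definition hs_C2 :: "'a::cvec hspace \<Rightarrow> (real \<Rightarrow> 'a) \<Rightarrow> bool" where
  "hs_C2 H f \<longleftrightarrow> hs_C0 H f \<and> (\<exists>f'. hs_C1 H f' \<and> (\<forall>t\<ge>0. hs_has_deriv H f (f' t) t))"

text \<open>A colligation (G, L, K) with input space U, state space V, output space W and domain Z.\<close>

definition kerG :: "'v set \<Rightarrow> ('v \<Rightarrow> 'u::zero) \<Rightarrow> 'v set" where
  "kerG Z G = {z\<in>Z. G z = 0}"

definition boundary_node ::
  "'u::cvec hspace \<Rightarrow> 'v::cvec hspace \<Rightarrow> 'w::cvec hspace \<Rightarrow> 'v set \<Rightarrow> ('v \<Rightarrow> 'u) \<Rightarrow> ('v \<Rightarrow> 'v) \<Rightarrow> ('v \<Rightarrow> 'w) \<Rightarrow> bool" where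
  "boundary_node U V W Z G L K \<longleftrightarrow>
     closed_op V (prod_hs U (prod_hs V W)) Z (\<lambda>z. (G z, L z, K z)) \<and>
     G ` Z = hcarrier U \<and> dense_in V (kerG Z G) \<and>
     (\<exists>\<mu>. in_resolvent V (kerG Z G) L \<mu>)"

definition internally_well_posed ::
  "'u::cvec hspace \<Rightarrow> 'v::cvec hspace \<Rightarrow> 'w::cvec hspace \<Rightarrow> 'v set \<Rightarrow> ('v \<Rightarrow> 'u) \<Rightarrow> ('v \<Rightarrow> 'v) \<Rightarrow> ('v \<Rightarrow> 'w) \<Rightarrow> bool" where
  "internally_well_posed U V W Z G L K \<longleftrightarrow>
     boundary_node U V W Z G L K \<and> generates_c0 V (kerG Z G) L"

definition graph_hs ::
  "'u::cvec hspace \<Rightarrow> 'v::cvec hspace \<Rightarrow> 'w::cvec hspace \<Rightarrow> 'v set \<Rightarrow> ('v \<Rightarrow> 'u) \<Rightarrow> ('v \<Rightarrow> 'v) \<Rightarrow> ('v \<Rightarrow> 'w) \<Rightarrow> 'v hspace" where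
  "graph_hs U V W Z G L K = \<lparr>hcarrier = Z,
     hinner = (\<lambda>a b. hinner V a b + hinner U (G a) (G b) + hinner V (L a) (L b) + hinner W (K a) (K b))\<rparr>"

definition smooth_solution ::
  "'u::cvec hspace \<Rightarrow> 'v::cvec hspace \<Rightarrow> 'w::cvec hspace \<Rightarrow> 'v set \<Rightarrow> ('v \<Rightarrow> 'u) \<Rightarrow> ('v \<Rightarrow> 'v) \<Rightarrow> ('v \<Rightarrow> 'w)
    \<Rightarrow> (real \<Rightarrow> 'u) \<Rightarrow> (real \<Rightarrow> 'v) \<Rightarrow> (real \<Rightarrow> 'w) \<Rightarrow> bool" where
  "smooth_solution U V W Z G L K u z y \<longleftrightarrow>
     hs_C2 U u \<and> hs_C1 V z \<and> hs_C0 (graph_hs U V W Z G L K) z \<and> hs_C0 W y \<and>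
     (\<forall>t\<ge>0. u t = G (z t) \<and> hs_has_deriv V z (L (z t)) t \<and> y t = K (z t))"

definition scattering_passive ::
  "'u::cvec hspace \<Rightarrow> 'v::cvec hspace \<Rightarrow> 'w::cvec hspace \<Rightarrow> 'v set \<Rightarrow> ('v \<Rightarrow> 'u) \<Rightarrow> ('v \<Rightarrow> 'v) \<Rightarrow> ('v \<Rightarrow> 'w) \<Rightarrow> bool" where
  "scattering_passive U V W Z G L K \<longleftrightarrow> internally_well_posed U V W Z G L K \<and>
     (\<forall>u z y. smooth_solution U V W Z G L K u z y \<longrightarrow>
        (\<forall>t\<ge>0. \<exists>d. ((\<lambda>s. (hnorm V (z s))\<^sup>2) has_real_derivative d) (at t within {0..}) \<and>
                  d + (hnorm W (y t))\<^sup>2 \<le> (hnorm U (u t))\<^sup>2))"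

definition cayley_in :: "complex \<Rightarrow> ('v \<Rightarrow> 'u::cvec) \<Rightarrow> ('v \<Rightarrow> 'u) \<Rightarrow> 'v \<Rightarrow> 'u" where
  "cayley_in \<beta> G K = (\<lambda>z. complex_of_real (1 / sqrt (2 * Re \<beta>)) *\<^sub>C (\<beta> *\<^sub>C G z + K z))"

definition cayley_out :: "complex \<Rightarrow> ('v \<Rightarrow> 'u::cvec) \<Rightarrow> ('v \<Rightarrow> 'u) \<Rightarrow> 'v \<Rightarrow> 'u" where
  "cayley_out \<beta> G K = (\<lambda>z. complex_of_real (1 / sqrt (2 * Re \<beta>)) *\<^sub>C (cnj \<beta> *\<^sub>C G z - K z))"

definition impedance_passive ::
  "'u::cvec hspace \<Rightarrow> 'v::cvec hspace \<Rightarrow> 'v set \<Rightarrow> ('v \<Rightarrow> 'u) \<Rightarrow> ('v \<Rightarrow> 'v) \<Rightarrow> ('v \<Rightarrow> 'u) \<Rightarrow> bool" where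
  "impedance_passive U V Z G L K \<longleftrightarrow>
     (\<exists>\<beta>. Re \<beta> > 0 \<and> scattering_passive U V U Z (cayley_in \<beta> G K) L (cayley_out \<beta> G K))"

definition Minv :: "'x::cvec hspace \<Rightarrow> ('x \<Rightarrow> 'x) \<Rightarrow> 'x \<Rightarrow> 'x" where
  "Minv X M = the_inv_into (hcarrier X) M"

definition Xh :: "'y::cvec hspace \<Rightarrow> 'x set \<Rightarrow> ('x \<Rightarrow> 'y) \<Rightarrow> 'x hspace" where
  "Xh Y domA A = \<lparr>hcarrier = domA, hinner = (\<lambda>x y. hinner Y (A x) (A y))\<rparr>"

definition XM :: "'x::cvec hspace \<Rightarrow> ('x \<Rightarrow> 'x) \<Rightarrow> 'x hspace" where
  "XM X M = \<lparr>hcarrier = hcarrier X, hinner = (\<lambda>x y. hinner X (Minv X M x) y)\<rparr>"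

definition dom_AM :: "'x::cvec hspace \<Rightarrow> 'x set \<Rightarrow> ('x \<Rightarrow> 'y::cvec) \<Rightarrow> 'y set \<Rightarrow> ('x \<Rightarrow> 'x) \<Rightarrow> ('x \<times> 'x) set" where
  "dom_AM X domA A domB M =
     {(z1, z2). z1 \<in> domA \<and> z2 \<in> M ` domA \<and> A z1 \<in> domB \<inter> A ` domA}"

definition op_AM :: "'x::cvec hspace \<Rightarrow> ('x \<Rightarrow> 'y) \<Rightarrow> ('y \<Rightarrow> 'x) \<Rightarrow> ('x \<Rightarrow> 'x) \<Rightarrow> ('x \<Rightarrow> 'x) \<Rightarrow> 'x \<times> 'x \<Rightarrow> 'x \<times> 'x" where
  "op_AM X A B M D = (\<lambda>(z1, z2). (Minv X M z2, B (A z1) - D (Minv X M z2)))"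

definition Gamma0 :: "('x \<Rightarrow> 'y) \<Rightarrow> ('x \<Rightarrow> 'g1) \<Rightarrow> ('y \<Rightarrow> 'g2) \<Rightarrow> 'x \<times> 'x \<Rightarrow> 'g1 \<times> 'g2" where
  "Gamma0 A Lam1 Pi2 = (\<lambda>(z1, z2). (Lam1 z2, Pi2 (A z1)))"

definition Gamma1 :: "('x \<Rightarrow> 'y) \<Rightarrow> ('y \<Rightarrow> 'g1 \<Rightarrow> complex) \<Rightarrow> ('x \<Rightarrow> 'g2 \<Rightarrow> complex)
    \<Rightarrow> 'x \<times> 'x \<Rightarrow> ('g1 \<Rightarrow> complex) \<times> ('g2 \<Rightarrow> complex)" where
  "Gamma1 A Pi1 Lam2 = (\<lambda>(z1, z2). (- Pi1 (A z1), Lam2 z2))"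

definition riesz_G :: "'g1::cvec hspace \<Rightarrow> 'g2::cvec hspace \<Rightarrow> 'g1 \<times> 'g2 \<Rightarrow> ('g1 \<Rightarrow> complex) \<times> ('g2 \<Rightarrow> complex)" where
  "riesz_G G1 G2 = (\<lambda>(g1, g2). (riesz G1 g1, riesz G2 g2))"

definition diagM :: "'x::cvec hspace \<Rightarrow> ('x \<Rightarrow> 'x) \<Rightarrow> 'x \<times> 'x \<Rightarrow> 'x \<times> 'x" where
  "diagM X M = (\<lambda>(z1, z2). (z1, Minv X M z2))"

definition N_in :: "'g1::cvec hspace \<Rightarrow> 'g2::cvec hspace \<Rightarrow> 'x::cvec hspace \<Rightarrow> ('x \<Rightarrow> 'x)
    \<Rightarrow> ('x \<Rightarrow> 'y) \<Rightarrow> ('x \<Rightarrow> 'g1) \<Rightarrow> ('x \<Rightarrow> 'g2 \<Rightarrow> complex) \<Rightarrow> ('y \<Rightarrow> 'g1 \<Rightarrow> complex) \<Rightarrow> ('y \<Rightarrow> 'g2)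
    \<Rightarrow> (('g1 \<Rightarrow> complex) \<times> ('g2 \<Rightarrow> complex) \<Rightarrow> ('g1 \<Rightarrow> complex) \<times> ('g2 \<Rightarrow> complex))
    \<Rightarrow> 'x \<times> 'x \<Rightarrow> ('g1 \<Rightarrow> complex) \<times> ('g2 \<Rightarrow> complex)" where
  "N_in G1 G2 X M A Lam1 Lam2 Pi1 Pi2 P = (\<lambda>z.
     let w = diagM X M z; a = riesz_G G1 G2 (Gamma0 A Lam1 Pi2 w); b = Gamma1 A Pi1 Lam2 w
     in (1/2 :: complex) *\<^sub>C ((a - P a) + (b + P b)))"

definition N_out :: "'g1::cvec hspace \<Rightarrow> 'g2::cvec hspace \<Rightarrow> 'x::cvec hspace \<Rightarrow> ('x \<Rightarrow> 'x)
    \<Rightarrow> ('x \<Rightarrow> 'y) \<Rightarrow> ('x \<Rightarrow> 'g1) \<Rightarrow> ('x \<Rightarrow> 'g2 \<Rightarrow> complex) \<Rightarrow> ('y \<Rightarrow> 'g1 \<Rightarrow> complex) \<Rightarrow> ('y \<Rightarrow> 'g2)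
    \<Rightarrow> (('g1 \<Rightarrow> complex) \<times> ('g2 \<Rightarrow> complex) \<Rightarrow> ('g1 \<Rightarrow> complex) \<times> ('g2 \<Rightarrow> complex))
    \<Rightarrow> 'x \<times> 'x \<Rightarrow> ('g1 \<Rightarrow> complex) \<times> ('g2 \<Rightarrow> complex)" where
  "N_out G1 G2 X M A Lam1 Lam2 Pi1 Pi2 P = (\<lambda>z.
     let w = diagM X M z; a = riesz_G G1 G2 (Gamma0 A Lam1 Pi2 w); b = Gamma1 A Pi1 Lam2 w
     in (1/2 :: complex) *\<^sub>C ((a + P a) + (b - P b)))"

end

(* Write a = R_G Gamma_0 diag(I, M^-1) and b = Gamma_1 diag(I, M^-1). The Green identity gives
   Re <A_M z, z> <= Re <a z, b z>, and the input G and output K of N satisfy G + K = a + b and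
   G - K = P (b - a). Hence ker G is the boundary condition a + b = P (a - b), and the input of the
   Cayley transform with parameter 1 vanishes exactly when the same condition holds with P = 0. For
   any contraction P the restriction of A_M to this condition is dissipative by polarization. It has
   closed range, and a vector h orthogonal to ran (r - A_M) lies in dom A_M (because A** = A and -B is
   the adjoint of A restricted to ker Lambda), where its own traces satisfy the adjoint boundary
   condition, which forces r |h|^2 <= 0. Thus the restriction is m-dissipative and generates a
   contraction semigroup, built here from the implicit Euler scheme with dyadic steps. Closedness of
   the node needs only weak continuity of the traces in the graph norm, which the Green identity
   against an element with prescribed traces provides. *)

theory Submission
  imports Defs
begin

text \<open>The node and its Cayley transform are covered by one argument:
  \<open>boundary_triple\<close> handles every contraction at once and is used both for
  \<open>P\<close> and for \<open>0\<close>. Dissipativity yields injectivity and closed range; the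
  obstacle is density of the range, because a vector orthogonal to it is at first known only through
  that orthogonality. Testing it with elements whose traces vanish shows its regularity, and only
  after that do its own traces exist. A second obstacle is that test elements of dom A_M reach only
  the part of dom B inside ran A, while the Green identity speaks of all of dom B; a projection onto
  ran A that preserves \<open>B\<close> and the Pi traces bridges this. Weak continuity of the
  traces suffices because the limits in a closed graph are given in advance and only have to be
  identified, which inner products do. Dyadic steps are chosen because each grid refines the
  previous one, so that consecutive approximations differ by a multiple of the step and the
  differences form a geometric series.\<close>

global_interpretation cvec: vector_space "(*\<^sub>C) :: complex \<Rightarrow> 'a::cvec \<Rightarrow> 'a"
  by standard (auto simp: scaleC_add_right scaleC_add_left scaleC_scaleC scaleC_one)

section \<open>Subspaces and linear maps given on carrier sets\<close>

lemma csubspaceD: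
  assumes "csubspace S"
  shows csubspace_zero: "0 \<in> S"
    and csubspace_add: "x \<in> S \<Longrightarrow> y \<in> S \<Longrightarrow> x + y \<in> S"
    and csubspace_scale: "x \<in> S \<Longrightarrow> c *\<^sub>C x \<in> S"
    and csubspace_minus: "x \<in> S \<Longrightarrow> - x \<in> S"
    and csubspace_diff: "x \<in> S \<Longrightarrow> y \<in> S \<Longrightarrow> x - y \<in> S"
proof -
  show 0: "0 \<in> S" and 1: "\<And>x y. x \<in> S \<Longrightarrow> y \<in> S \<Longrightarrow> x + y \<in> S"
    and 2: "\<And>c x. x \<in> S \<Longrightarrow> c *\<^sub>C x \<in> S"
    using assms by (auto simp: csubspace_def)
  show 3: "- x \<in> S" if "x \<in> S" for x
    using 2[OF that, of "-1"] by simp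
  show "x - y \<in> S" if "x \<in> S" "y \<in> S" for x y
    using 1[OF that(1) 3[OF that(2)]] by simp
qed

lemma clinear_onD:
  assumes "csubspace S" "clinear_on S f"
  shows clinear_on_add: "x \<in> S \<Longrightarrow> y \<in> S \<Longrightarrow> f (x + y) = f x + f y"
    and clinear_on_scale: "x \<in> S \<Longrightarrow> f (c *\<^sub>C x) = c *\<^sub>C f x"
    and clinear_on_zero: "f 0 = 0"
    and clinear_on_minus: "x \<in> S \<Longrightarrow> f (- x) = - f x"
    and clinear_on_diff: "x \<in> S \<Longrightarrow> y \<in> S \<Longrightarrow> f (x - y) = f x - f y"
proof -
  show 1: "\<And>x y. x \<in> S \<Longrightarrow> y \<in> S \<Longrightarrow> f (x + y) = f x + f y"
    and 2: "\<And>c x. x \<in> S \<Longrightarrow> f (c *\<^sub>C x) = c *\<^sub>C f x"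
    using assms(2) by (auto simp: clinear_on_def)
  show "f 0 = 0"
    using 2[OF csubspace_zero[OF assms(1)], of 0] by simp
  show 3: "f (- x) = - f x" if "x \<in> S" for x
    using 2[OF that, of "-1"] by simp
  show "f (x - y) = f x - f y" if "x \<in> S" "y \<in> S" for x y
    using 1[OF that(1) csubspace_minus[OF assms(1) that(2)]] 3[OF that(2)] by simp
qed

lemma csubspace_kernel:
  assumes "csubspace S" "clinear_on S f"
  shows "csubspace {x \<in> S. f x = 0}"
  using csubspaceD[OF assms(1)] clinear_onD[OF assms] by (simp add: csubspace_def)

lemma csubspace_image:
  assumes "csubspace S" "clinear_on S f"
  shows "csubspace (f ` S)"
  unfolding csubspace_def
proof (intro conjI ballI allI)
  show "0 \<in> f ` S"
    using csubspace_zero[OF assms(1)] clinear_on_zero[OF assms] by (metis imageI)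
  show "x + y \<in> f ` S" if "x \<in> f ` S" "y \<in> f ` S" for x y
    using that csubspace_add[OF assms(1)] by (auto simp: clinear_on_add[OF assms, symmetric])
  show "c *\<^sub>C x \<in> f ` S" if "x \<in> f ` S" for c x
    using that csubspace_scale[OF assms(1)] by (auto simp: clinear_on_scale[OF assms, symmetric])
qed

section \<open>Hilbert spaces on carrier sets\<close>

locale hilbert =
  fixes H :: "'a::cvec hspace"
  assumes is_hilbert: "is_hilbert H"
begin

lemma csubspace_carrier: "csubspace (hcarrier H)"
  using is_hilbert by (simp add: is_hilbert_def)

lemma zero_mem [simp]: "0 \<in> hcarrier H"
  and add_mem [simp]: "x \<in> hcarrier H \<Longrightarrow> y \<in> hcarrier H \<Longrightarrow> x + y \<in> hcarrier H"
  and scale_mem [simp]: "x \<in> hcarrier H \<Longrightarrow> c *\<^sub>C x \<in> hcarrier H"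
  and minus_mem [simp]: "x \<in> hcarrier H \<Longrightarrow> - x \<in> hcarrier H"
  and diff_mem [simp]: "x \<in> hcarrier H \<Longrightarrow> y \<in> hcarrier H \<Longrightarrow> x - y \<in> hcarrier H"
  using csubspaceD[OF csubspace_carrier] by auto

lemma inner_add_left:
    "\<lbrakk>x \<in> hcarrier H; y \<in> hcarrier H; z \<in> hcarrier H\<rbrakk> \<Longrightarrow> hinner H (x + y) z = hinner H x z + hinner H y z"
  and inner_scale_left:
    "\<lbrakk>x \<in> hcarrier H; y \<in> hcarrier H\<rbrakk> \<Longrightarrow> hinner H (c *\<^sub>C x) y = c * hinner H x y"
  and inner_commute:
    "\<lbrakk>x \<in> hcarrier H; y \<in> hcarrier H\<rbrakk> \<Longrightarrow> hinner H y x = cnj (hinner H x y)"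
  and inner_self_ge_0: "x \<in> hcarrier H \<Longrightarrow> Re (hinner H x x) \<ge> 0"
  and inner_self_eq_0: "x \<in> hcarrier H \<Longrightarrow> hinner H x x = 0 \<Longrightarrow> x = 0"
proof -
  note h = is_hilbert[unfolded is_hilbert_def, THEN conjunct2]
  show "\<lbrakk>x \<in> hcarrier H; y \<in> hcarrier H; z \<in> hcarrier H\<rbrakk> \<Longrightarrow> hinner H (x + y) z = hinner H x z + hinner H y z"
    by (rule h[THEN conjunct1, rule_format])
  note h = h[THEN conjunct2]
  show "\<lbrakk>x \<in> hcarrier H; y \<in> hcarrier H\<rbrakk> \<Longrightarrow> hinner H (c *\<^sub>C x) y = c * hinner H x y"
    by (rule h[THEN conjunct1, rule_format])
  note h = h[THEN conjunct2]
  show "\<lbrakk>x \<in> hcarrier H; y \<in> hcarrier H\<rbrakk> \<Longrightarrow> hinner H y x = cnj (hinner H x y)"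
    by (rule h[THEN conjunct1, rule_format])
  note h = h[THEN conjunct2]
  show "x \<in> hcarrier H \<Longrightarrow> Re (hinner H x x) \<ge> 0"
    by (rule h[THEN conjunct1, rule_format])
  note h = h[THEN conjunct2]
  show "x \<in> hcarrier H \<Longrightarrow> hinner H x x = 0 \<Longrightarrow> x = 0"
    by (rule h[THEN conjunct1, rule_format])
qed

lemma complete:
  assumes "\<And>n. f n \<in> hcarrier H"
    and "\<And>e. e > 0 \<Longrightarrow> \<exists>N. \<forall>m\<ge>N. \<forall>n\<ge>N. hnorm H (f m - f n) < e"
  shows "\<exists>l. hlim H f sequentially l"
proof -
  have "\<exists>l\<in>hcarrier H. (\<lambda>n. hnorm H (f n - l)) \<longlonglongrightarrow> 0"
    using is_hilbert[unfolded is_hilbert_def] assms by simp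
  then show ?thesis by (auto simp: hlim_def)
qed

lemma inner_zero_left [simp]: "x \<in> hcarrier H \<Longrightarrow> hinner H 0 x = 0"
  using inner_scale_left[of 0 x 0] by simp

lemma inner_zero_right [simp]: "x \<in> hcarrier H \<Longrightarrow> hinner H x 0 = 0"
  using inner_commute[of 0 x] by simp

lemma inner_minus_left:
  "x \<in> hcarrier H \<Longrightarrow> y \<in> hcarrier H \<Longrightarrow> hinner H (- x) y = - hinner H x y"
  using inner_scale_left[of x y "-1"] by simp

lemma inner_diff_left:
  "\<lbrakk>x \<in> hcarrier H; y \<in> hcarrier H; z \<in> hcarrier H\<rbrakk> \<Longrightarrow> hinner H (x - y) z = hinner H x z - hinner H y z"
  using inner_add_left[of x "- y" z] by (simp add: inner_minus_left)

lemma inner_add_right: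
  "\<lbrakk>x \<in> hcarrier H; y \<in> hcarrier H; z \<in> hcarrier H\<rbrakk> \<Longrightarrow> hinner H x (y + z) = hinner H x y + hinner H x z"
  using inner_commute[of x "y + z"] inner_commute[of x y] inner_commute[of x z]
  by (metis add_mem complex_cnj_add complex_cnj_cnj inner_add_left)

lemma inner_scale_right:
  "\<lbrakk>x \<in> hcarrier H; y \<in> hcarrier H\<rbrakk> \<Longrightarrow> hinner H x (c *\<^sub>C y) = cnj c * hinner H x y"
  by (metis complex_cnj_mult inner_commute inner_scale_left scale_mem)

lemma inner_minus_right:
  "x \<in> hcarrier H \<Longrightarrow> y \<in> hcarrier H \<Longrightarrow> hinner H x (- y) = - hinner H x y"
  using inner_scale_right[of x y "-1"] by simp

lemma inner_diff_right:
  "\<lbrakk>x \<in> hcarrier H; y \<in> hcarrier H; z \<in> hcarrier H\<rbrakk> \<Longrightarrow> hinner H x (y - z) = hinner H x y - hinner H x z"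
  using inner_add_right[of x y "- z"] by (simp add: inner_minus_right)

lemmas inner_simps = inner_add_left inner_add_right inner_diff_left inner_diff_right
  inner_minus_left inner_minus_right inner_scale_left inner_scale_right

lemma norm_ge_0 [simp]: "x \<in> hcarrier H \<Longrightarrow> hnorm H x \<ge> 0"
  by (simp add: hnorm_def inner_self_ge_0)

lemma norm_sq: "x \<in> hcarrier H \<Longrightarrow> (hnorm H x)\<^sup>2 = Re (hinner H x x)"
  by (simp add: hnorm_def inner_self_ge_0)

lemma inner_self: "x \<in> hcarrier H \<Longrightarrow> hinner H x x = complex_of_real ((hnorm H x)\<^sup>2)"
  using inner_commute[of x x] by (auto simp: norm_sq complex_eq_iff)

lemma norm_eq_0: "x \<in> hcarrier H \<Longrightarrow> hnorm H x = 0 \<longleftrightarrow> x = 0"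
proof
  show "x = 0" if "x \<in> hcarrier H" "hnorm H x = 0"
    using inner_self_eq_0[OF that(1)] inner_self[OF that(1)] that(2) by simp
  show "hnorm H x = 0" if "x = 0"
    using that by (simp add: hnorm_def)
qed

lemma norm_zero [simp]: "hnorm H 0 = 0"
  by (simp add: norm_eq_0)

lemma norm_scale: "x \<in> hcarrier H \<Longrightarrow> hnorm H (c *\<^sub>C x) = cmod c * hnorm H x"
proof -
  assume x: "x \<in> hcarrier H"
  have "(hnorm H (c *\<^sub>C x))\<^sup>2 = Re (c * cnj c * hinner H x x)"
    using x by (simp add: norm_sq inner_simps mult.assoc mult.left_commute)
  also have "\<dots> = (cmod c * hnorm H x)\<^sup>2"
    using x by (simp add: complex_norm_square[symmetric] inner_self power_mult_distrib)
  finally show ?thesis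
    by (rule power2_eq_imp_eq) (use x in auto)
qed

lemma norm_minus [simp]: "x \<in> hcarrier H \<Longrightarrow> hnorm H (- x) = hnorm H x"
  using norm_scale[of x "-1"] by simp

lemma norm_minus_commute: "x \<in> hcarrier H \<Longrightarrow> y \<in> hcarrier H \<Longrightarrow> hnorm H (x - y) = hnorm H (y - x)"
  using norm_minus[of "x - y"] by simp

lemma norm_add_sq:
  "x \<in> hcarrier H \<Longrightarrow> y \<in> hcarrier H \<Longrightarrow>
    (hnorm H (x + y))\<^sup>2 = (hnorm H x)\<^sup>2 + (hnorm H y)\<^sup>2 + 2 * Re (hinner H x y)"
  using inner_commute[of x y] by (simp add: norm_sq inner_simps)

lemma norm_diff_sq:
  "x \<in> hcarrier H \<Longrightarrow> y \<in> hcarrier H \<Longrightarrow>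
    (hnorm H (x - y))\<^sup>2 = (hnorm H x)\<^sup>2 + (hnorm H y)\<^sup>2 - 2 * Re (hinner H x y)"
  using inner_commute[of x y] by (simp add: norm_sq inner_simps)

lemma Re_inner_commute: "x \<in> hcarrier H \<Longrightarrow> y \<in> hcarrier H \<Longrightarrow> Re (hinner H y x) = Re (hinner H x y)"
  using inner_commute[of x y] by simp

lemma Cauchy_Schwarz:
  assumes x: "x \<in> hcarrier H" and y: "y \<in> hcarrier H"
  shows "cmod (hinner H x y) \<le> hnorm H x * hnorm H y"
proof (cases "hnorm H y = 0")
  case True
  then show ?thesis using x y by (simp add: norm_eq_0)
next
  case False
  then have pos: "hnorm H y > 0" using y by (simp add: less_le)
  \<comment> \<open>\<open>c *\<^sub>C y\<close> is the orthogonal projection of \<open>x\<close>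
    onto the line through \<open>y\<close>, so expanding the squared distance gives the sharp
    inequality.\<close>
  define c where "c = hinner H x y / complex_of_real ((hnorm H y)\<^sup>2)"
  have "0 \<le> (hnorm H (x - c *\<^sub>C y))\<^sup>2" by simp
  also have "\<dots> = (hnorm H x)\<^sup>2 + (cmod c)\<^sup>2 * (hnorm H y)\<^sup>2 - 2 * Re (cnj c * hinner H x y)"
    using x y by (simp add: norm_diff_sq norm_scale power_mult_distrib inner_simps)
  also have "cnj c * hinner H x y = complex_of_real ((cmod (hinner H x y))\<^sup>2 / (hnorm H y)\<^sup>2)"
    by (simp add: c_def complex_norm_square[unfolded of_real_power] mult.commute)
  also have "(cmod c)\<^sup>2 * (hnorm H y)\<^sup>2 = (cmod (hinner H x y))\<^sup>2 / (hnorm H y)\<^sup>2"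
  proof -
    have "cmod c = cmod (hinner H x y) / (hnorm H y)\<^sup>2"
      by (simp add: c_def norm_divide norm_power)
    then show ?thesis using pos by (simp add: power2_eq_square)
  qed
  finally have "(cmod (hinner H x y))\<^sup>2 / (hnorm H y)\<^sup>2 \<le> (hnorm H x)\<^sup>2"
    by simp
  then have "(cmod (hinner H x y))\<^sup>2 \<le> (hnorm H x * hnorm H y)\<^sup>2"
    using pos by (simp add: pos_divide_le_eq power_mult_distrib)
  then show ?thesis
    by (rule power2_le_imp_le) (use x y in auto)
qed

lemma Re_inner_le: "x \<in> hcarrier H \<Longrightarrow> y \<in> hcarrier H \<Longrightarrow> Re (hinner H x y) \<le> hnorm H x * hnorm H y"
  using Cauchy_Schwarz[of x y] complex_Re_le_cmod[of "hinner H x y"] by linarith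

lemma norm_triangle:
  assumes "x \<in> hcarrier H" "y \<in> hcarrier H"
  shows "hnorm H (x + y) \<le> hnorm H x + hnorm H y"
proof (rule power2_le_imp_le)
  show "(hnorm H (x + y))\<^sup>2 \<le> (hnorm H x + hnorm H y)\<^sup>2"
    using assms Re_inner_le[OF assms] by (simp add: norm_add_sq power2_sum)
qed (use assms in auto)

lemma norm_triangle_diff:
  "x \<in> hcarrier H \<Longrightarrow> y \<in> hcarrier H \<Longrightarrow> hnorm H (x - y) \<le> hnorm H x + hnorm H y"
  using norm_triangle[of x "- y"] by simp

lemma norm_triangle_via:
  "x \<in> hcarrier H \<Longrightarrow> y \<in> hcarrier H \<Longrightarrow> z \<in> hcarrier H \<Longrightarrow>
    hnorm H (x - z) \<le> hnorm H (x - y) + hnorm H (y - z)"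
  using norm_triangle[of "x - y" "y - z"] by simp

lemma norm_diff_norm_le:
  "x \<in> hcarrier H \<Longrightarrow> y \<in> hcarrier H \<Longrightarrow> \<bar>hnorm H x - hnorm H y\<bar> \<le> hnorm H (x - y)"
  using norm_triangle[of "x - y" y] norm_triangle[of "y - x" x] norm_minus_commute[of x y] by simp

lemma eq_if_inner_eq:
  assumes "x \<in> hcarrier H" "y \<in> hcarrier H" "\<And>u. u \<in> hcarrier H \<Longrightarrow> hinner H x u = hinner H y u"
  shows "x = y"
  using assms(3)[of "x - y"] inner_self_eq_0[of "x - y"] assms(1,2) by (simp add: inner_diff_left)

lemma hlim_mem: "hlim H f F l \<Longrightarrow> l \<in> hcarrier H"
  by (simp add: hlim_def)

lemma hlim_const: "l \<in> hcarrier H \<Longrightarrow> hlim H (\<lambda>_. l) F l"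
  by (simp add: hlim_def)

text \<open>Membership in the carrier is asked only eventually, because difference quotients and
  semigroup orbits are known to stay in it only for nonnegative times.\<close>

lemma hlimI:
  assumes "l \<in> hcarrier H" "(g \<longlongrightarrow> 0) F" "\<forall>\<^sub>F t in F. f t \<in> hcarrier H \<and> hnorm H (f t - l) \<le> g t"
  shows "hlim H f F l"
  unfolding hlim_def
proof
  show "((\<lambda>t. hnorm H (f t - l)) \<longlongrightarrow> 0) F"
    using _ _ tendsto_const assms(2)
    by (rule tendsto_sandwich) (use assms(1,3) in \<open>auto elim: eventually_mono\<close>)
qed (use assms in simp)

lemma hlim_add:
  assumes "hlim H f F l" "hlim H g F m"
    and "\<forall>\<^sub>F t in F. f t \<in> hcarrier H" "\<forall>\<^sub>F t in F. g t \<in> hcarrier H"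
  shows "hlim H (\<lambda>t. f t + g t) F (l + m)"
proof (rule hlimI)
  show "((\<lambda>t. hnorm H (f t - l) + hnorm H (g t - m)) \<longlongrightarrow> 0) F"
    using tendsto_add[of "\<lambda>t. hnorm H (f t - l)" 0 F] assms(1,2) by (fastforce simp: hlim_def)
  show "\<forall>\<^sub>F t in F. f t + g t \<in> hcarrier H \<and> hnorm H (f t + g t - (l + m)) \<le> hnorm H (f t - l) + hnorm H (g t - m)"
    using assms(3,4)
  proof eventually_elim
    case (elim t)
    then show ?case
      using norm_triangle[of "f t - l" "g t - m"] hlim_mem[OF assms(1)] hlim_mem[OF assms(2)]
      by (simp add: algebra_simps)
  qed
qed (use hlim_mem[OF assms(1)] hlim_mem[OF assms(2)] in auto)

lemma hlim_scale:
  assumes "hlim H f F l" "\<forall>\<^sub>F t in F. f t \<in> hcarrier H"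
  shows "hlim H (\<lambda>t. c *\<^sub>C f t) F (c *\<^sub>C l)"
proof (rule hlimI)
  show "((\<lambda>t. cmod c * hnorm H (f t - l)) \<longlongrightarrow> 0) F"
    using tendsto_mult_left[of "\<lambda>t. hnorm H (f t - l)" 0 F "cmod c"] assms(1) by (simp add: hlim_def)
  show "\<forall>\<^sub>F t in F. c *\<^sub>C f t \<in> hcarrier H \<and> hnorm H (c *\<^sub>C f t - c *\<^sub>C l) \<le> cmod c * hnorm H (f t - l)"
    using assms(2)
  proof eventually_elim
    case (elim t)
    then show ?case
      using norm_scale[of "f t - l" c] hlim_mem[OF assms(1)] by (simp add: cvec.scale_right_diff_distrib)
  qed
qed (use hlim_mem[OF assms(1)] in auto)

lemma hlim_diff:
  assumes "hlim H f F l" "hlim H g F m"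
    and "\<forall>\<^sub>F t in F. f t \<in> hcarrier H" "\<forall>\<^sub>F t in F. g t \<in> hcarrier H"
  shows "hlim H (\<lambda>t. f t - g t) F (l - m)"
proof -
  have "\<forall>\<^sub>F t in F. (-1) *\<^sub>C g t \<in> hcarrier H"
    using assms(4) by eventually_elim (rule scale_mem)
  then show ?thesis
    using hlim_add[OF assms(1) hlim_scale[OF assms(2,4), of "-1"] assms(3)] by simp
qed

lemma hlim_norm:
  assumes "hlim H f F l" "\<forall>\<^sub>F t in F. f t \<in> hcarrier H"
  shows "((\<lambda>t. hnorm H (f t)) \<longlongrightarrow> hnorm H l) F"
proof -
  have "((\<lambda>t. hnorm H (f t) - hnorm H l) \<longlongrightarrow> 0) F"
  proof (rule Lim_null_comparison)
    show "\<forall>\<^sub>F t in F. norm (hnorm H (f t) - hnorm H l) \<le> hnorm H (f t - l)"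
      using assms(2) by eventually_elim (use norm_diff_norm_le hlim_mem[OF assms(1)] in simp)
  qed (use assms(1) in \<open>simp add: hlim_def\<close>)
  then show ?thesis by (simp add: LIM_zero_iff)
qed

lemma hlim_inner:
  assumes f: "hlim H f F l" "\<forall>\<^sub>F t in F. f t \<in> hcarrier H"
    and g: "hlim H g F m" "\<forall>\<^sub>F t in F. g t \<in> hcarrier H"
  shows "((\<lambda>t. hinner H (f t) (g t)) \<longlongrightarrow> hinner H l m) F"
proof -
  note lm = hlim_mem[OF f(1)] hlim_mem[OF g(1)]
  have "((\<lambda>t. hinner H (f t) (g t) - hinner H l m) \<longlongrightarrow> 0) F"
  proof (rule Lim_null_comparison)
    show "\<forall>\<^sub>F t in F. norm (hinner H (f t) (g t) - hinner H l m)
        \<le> hnorm H (f t - l) * hnorm H (g t) + hnorm H l * hnorm H (g t - m)"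
      using f(2) g(2)
    proof eventually_elim
      case (elim t)
      have "hinner H (f t) (g t) - hinner H l m = hinner H (f t - l) (g t) + hinner H l (g t - m)"
        using elim lm by (simp add: inner_simps)
      also have "cmod \<dots> \<le> hnorm H (f t - l) * hnorm H (g t) + hnorm H l * hnorm H (g t - m)"
        using elim lm by (intro order_trans[OF norm_triangle_ineq] add_mono Cauchy_Schwarz) auto
      finally show ?case .
    qed
    have "((\<lambda>t. hnorm H (f t - l) * hnorm H (g t) + hnorm H l * hnorm H (g t - m))
        \<longlongrightarrow> 0 * hnorm H m + hnorm H l * 0) F"
      using f g hlim_norm[OF g] by (intro tendsto_intros) (auto simp: hlim_def)
    then show "((\<lambda>t. hnorm H (f t - l) * hnorm H (g t) + hnorm H l * hnorm H (g t - m)) \<longlongrightarrow> 0) F"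
      by simp
  qed
  then show ?thesis by (simp add: LIM_zero_iff)
qed

lemma hlim_inner_const:
  "hlim H f F l \<Longrightarrow> \<forall>\<^sub>F t in F. f t \<in> hcarrier H \<Longrightarrow> u \<in> hcarrier H \<Longrightarrow>
    ((\<lambda>t. hinner H (f t) u) \<longlongrightarrow> hinner H l u) F"
  by (rule hlim_inner) (auto simp: hlim_const)

lemma hlim_unique:
  assumes "hlim H f F l" "hlim H f F m" "\<forall>\<^sub>F t in F. f t \<in> hcarrier H" "F \<noteq> bot"
  shows "l = m"
  using assms hlim_mem
  by (intro eq_if_inner_eq) (auto intro: tendsto_unique[OF assms(4) hlim_inner_const hlim_inner_const])

lemma hlim_norm_diff_le:
  assumes "hlim H f F l" "\<forall>\<^sub>F t in F. f t \<in> hcarrier H \<and> hnorm H (f t - y) \<le> c" "y \<in> hcarrier H" "F \<noteq> bot"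
  shows "hnorm H (l - y) \<le> c"
proof (rule tendsto_upperbound[OF _ _ assms(4)])
  have "\<forall>\<^sub>F t in F. f t \<in> hcarrier H" using assms(2) by (auto elim: eventually_mono)
  then show "((\<lambda>t. hnorm H (f t - y)) \<longlongrightarrow> hnorm H (l - y)) F"
    using assms(1,3) by (intro hlim_norm hlim_diff hlim_const) (auto elim: eventually_mono)
qed (use assms in \<open>auto elim: eventually_mono\<close>)

lemma hlim_cong: "\<forall>\<^sub>F t in F. f t = g t \<Longrightarrow> hlim H f F l \<longleftrightarrow> hlim H g F l"
  unfolding hlim_def by (intro conj_cong refl tendsto_cong) (auto elim: eventually_mono)

text \<open>The Lipschitz bound on differences is the common form in which \<open>M\<close>, its
  inverse and \<open>D\<close> pass to the limit.\<close>

lemma hlim_bounded_image: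
  assumes "\<And>x. x \<in> hcarrier H \<Longrightarrow> T x \<in> hcarrier H'"
    and "\<And>x y. x \<in> hcarrier H \<Longrightarrow> y \<in> hcarrier H \<Longrightarrow> hnorm H' (T x - T y) \<le> K * hnorm H (x - y)"
    and "hilbert H'" "hlim H f F l" "\<forall>\<^sub>F t in F. f t \<in> hcarrier H"
  shows "hlim H' (\<lambda>t. T (f t)) F (T l)"
proof (rule hilbert.hlimI[OF assms(3)])
  show "((\<lambda>t. K * hnorm H (f t - l)) \<longlongrightarrow> 0) F"
    using tendsto_mult_left[of "\<lambda>t. hnorm H (f t - l)" 0 F K] assms(4) by (simp add: hlim_def)
  show "\<forall>\<^sub>F t in F. T (f t) \<in> hcarrier H' \<and> hnorm H' (T (f t) - T l) \<le> K * hnorm H (f t - l)"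
    using assms(5) by eventually_elim (use assms(1,2) hlim_mem[OF assms(4)] in auto)
qed (use assms(1) hlim_mem[OF assms(4)] in auto)

lemma Cauchy_of_hlim:
  assumes "hlim H f sequentially l" "\<And>n. f n \<in> hcarrier H" "e > 0"
  shows "\<exists>N. \<forall>m\<ge>N. \<forall>n\<ge>N. hnorm H (f m - f n) < e"
proof -
  have "\<forall>\<^sub>F n in sequentially. hnorm H (f n - l) < e / 2"
    using assms(1,3) order_tendstoD(2)[of "\<lambda>n. hnorm H (f n - l)" 0 sequentially "e / 2"]
    by (simp add: hlim_def)
  then obtain N where N: "\<And>n. n \<ge> N \<Longrightarrow> hnorm H (f n - l) < e / 2"
    by (auto simp: eventually_sequentially)
  have "hnorm H (f m - f n) < e" if "m \<ge> N" "n \<ge> N" for m n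
    using norm_triangle_via[of "f m" l "f n"] norm_minus_commute[of l "f n"] N[OF that(1)] N[OF that(2)]
      assms(2) hlim_mem[OF assms(1)] by simp
  then show ?thesis by blast
qed

end

section \<open>Orthogonal projection, the Riesz representation and the anti-dual\<close>

context hilbert
begin

text \<open>Minimising sequences for the distance to \<open>S\<close> are Cauchy by the parallelogram law.\<close>
theorem orthogonal_projection:
  assumes S: "csubspace S" "S \<subseteq> hcarrier H"
    and closed: "\<And>xs l. (\<And>n. xs n \<in> S) \<Longrightarrow> hlim H xs sequentially l \<Longrightarrow> l \<in> S"
    and x: "x \<in> hcarrier H"
  obtains p where "p \<in> S" "\<And>s. s \<in> S \<Longrightarrow> hinner H (x - p) s = 0"
proof -
  let ?D = "(\<lambda>s. (hnorm H (x - s))\<^sup>2) ` S"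
  define d where "d = Inf ?D"
  have ne: "?D \<noteq> {}" using csubspace_zero[OF S(1)] by auto
  have bdd: "bdd_below ?D" by (rule bdd_belowI[of _ 0]) auto
  have d_le: "d \<le> (hnorm H (x - s))\<^sup>2" if "s \<in> S" for s
    unfolding d_def using bdd that by (intro cInf_lower) auto
  have "\<exists>s\<in>S. (hnorm H (x - s))\<^sup>2 < d + 1 / real (Suc n)" for n
  proof -
    have "\<exists>r\<in>?D. r < d + 1 / real (Suc n)"
      using cInf_less_iff[OF ne bdd, of "d + 1 / real (Suc n)"] by (simp add: d_def)
    then show ?thesis by auto
  qed
  then obtain s where s: "\<And>n. s n \<in> S" "\<And>n. (hnorm H (x - s n))\<^sup>2 < d + 1 / real (Suc n)"
    by metis
  have sH: "s n \<in> hcarrier H" for n using s(1) S(2) by blast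
  have par: "(hnorm H (s m - s n))\<^sup>2 \<le> 2 * (1 / real (Suc m) + 1 / real (Suc n))" for m n
  proof -
    \<comment> \<open>The midpoint lies in \<open>S\<close>, hence at squared distance at least
      \<open>d\<close>; in the parallelogram law this leaves little room for
      \<open>s m - s n\<close>.\<close>
    let ?h = "(1/2::complex) *\<^sub>C (s m + s n)"
    have h: "?h \<in> S" using s(1) S(1) by (intro csubspace_scale csubspace_add) auto
    have "4 * (hnorm H (x - ?h))\<^sup>2 = (hnorm H ((x - s m) + (x - s n)))\<^sup>2"
    proof -
      have "(x - s m) + (x - s n) = 2 *\<^sub>C (x - ?h)"
        using scaleC_add_left[of 1 1 x] by (simp add: cvec.scale_right_diff_distrib scaleC_scaleC algebra_simps)
      then show ?thesis using h S(2) x by (auto simp: norm_scale power_mult_distrib)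
    qed
    also have "\<dots> = 2 * (hnorm H (x - s m))\<^sup>2 + 2 * (hnorm H (x - s n))\<^sup>2 - (hnorm H ((x - s m) - (x - s n)))\<^sup>2"
      using x sH by (simp only: norm_add_sq norm_diff_sq diff_mem) simp
    also have "(x - s m) - (x - s n) = s n - s m" by simp
    finally have "(hnorm H (s n - s m))\<^sup>2 \<le> 2 * (hnorm H (x - s m))\<^sup>2 + 2 * (hnorm H (x - s n))\<^sup>2 - 4 * d"
      using d_le[OF h] by simp
    then show ?thesis using s(2)[of m] s(2)[of n] norm_minus_commute[OF sH sH, of m n] by simp
  qed
  have "\<exists>l. hlim H s sequentially l"
  proof (rule complete[OF sH])
    fix e :: real assume e: "e > 0"
    obtain N where N: "4 / e\<^sup>2 < real N" using reals_Archimedean2 by blast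
    have "hnorm H (s m - s n) < e" if "m \<ge> N" "n \<ge> N" for m n
    proof (rule power2_less_imp_less)
      have *: "1 / real (Suc k) < e\<^sup>2 / 4" if "k \<ge> N" for k
      proof -
        have "4 / e\<^sup>2 < real (Suc k)" using N \<open>k \<ge> N\<close> by (simp add: less_le_trans)
        then have "4 < real (Suc k) * e\<^sup>2" using e by (simp add: pos_divide_less_eq del: of_nat_Suc)
        then show ?thesis by (simp add: field_simps del: of_nat_Suc)
      qed
      show "(hnorm H (s m - s n))\<^sup>2 < e\<^sup>2"
        using par[of m n] *[OF that(1)] *[OF that(2)] by simp
    qed (use e in simp)
    then show "\<exists>N. \<forall>m\<ge>N. \<forall>n\<ge>N. hnorm H (s m - s n) < e" by blast
  qed
  then obtain p where p: "hlim H s sequentially p" by blast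
  have pS: "p \<in> S" using closed[OF s(1) p] .
  have pH: "p \<in> hcarrier H" using hlim_mem[OF p] .
  have "(\<lambda>n. (hnorm H (x - s n))\<^sup>2) \<longlonglongrightarrow> (hnorm H (x - p))\<^sup>2"
    using x sH p by (intro tendsto_power hlim_norm hlim_diff hlim_const) auto
  moreover have "(\<lambda>n. d + 1 / real (Suc n)) \<longlonglongrightarrow> d + 0"
    by (intro tendsto_add tendsto_const LIMSEQ_Suc lim_1_over_n)
  ultimately have "(hnorm H (x - p))\<^sup>2 \<le> d + 0"
    by (rule LIMSEQ_le) (use s(2) in \<open>auto intro: less_imp_le\<close>)
  then have min: "(hnorm H (x - p))\<^sup>2 \<le> (hnorm H (x - q))\<^sup>2" if "q \<in> S" for q
    using d_le[OF that] by simp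
  have "hinner H (x - p) q = 0" if q: "q \<in> S" for q
  proof (rule ccontr)
    let ?z = "hinner H (x - p) q"
    assume nz: "?z \<noteq> 0"
    \<comment> \<open>Moving \<open>p\<close> by \<open>t * ?z\<close> in the direction of
      \<open>q\<close> changes the squared distance by t |z|^2 (t |q|^2 - 2). This \<open>t\<close>
      makes the last factor negative, and the summand 1 keeps the denominator positive.\<close>
    define t where "t = 1 / (1 + (hnorm H q)\<^sup>2)"
    have *: "1 / (1 + n) > 0 \<and> 1 / (1 + n) * n < 2" if "n \<ge> 0" for n :: real
      using that by (auto simp: field_simps)
    have t: "t > 0" and t2: "t * (hnorm H q)\<^sup>2 < 2"
      using *[of "(hnorm H q)\<^sup>2"] unfolding t_def by (metis zero_le_power2)+
    let ?c = "complex_of_real t * ?z"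
    have qH: "q \<in> hcarrier H" using q S(2) by blast
    have "p + ?c *\<^sub>C q \<in> S" using q pS S(1) by (intro csubspace_scale csubspace_add) auto
    from min[OF this] have "(hnorm H (x - p))\<^sup>2 \<le> (hnorm H ((x - p) - ?c *\<^sub>C q))\<^sup>2"
      by (simp add: diff_diff_add)
    also have "\<dots> = (hnorm H (x - p))\<^sup>2 + (cmod ?c)\<^sup>2 * (hnorm H q)\<^sup>2 - 2 * Re (cnj ?c * ?z)"
      using x pH qH by (simp add: norm_diff_sq norm_scale inner_scale_right power_mult_distrib)
    also have "cnj ?c * ?z = complex_of_real (t * (cmod ?z)\<^sup>2)"
      by (simp add: complex_norm_square[unfolded of_real_power] mult.commute mult.left_commute)
    also have "(cmod ?c)\<^sup>2 = t * (t * (cmod ?z)\<^sup>2)"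
      using t by (simp add: norm_mult power2_eq_square)
    finally have "0 \<le> (t * (cmod ?z)\<^sup>2) * (t * (hnorm H q)\<^sup>2 - 2)"
      by (simp add: algebra_simps)
    moreover have "t * (cmod ?z)\<^sup>2 > 0" using t nz by simp
    ultimately show False using t2 by (simp add: zero_le_mult_iff)
  qed
  then show ?thesis using that pS by blast
qed

lemma riesz_apply: "x \<in> hcarrier H \<Longrightarrow> riesz H g x = hinner H g x"
  by (simp add: riesz_def)

lemma riesz_mem: "g \<in> hcarrier H \<Longrightarrow> riesz H g \<in> hcarrier (antidual H)"
  unfolding antidual_def
  by (auto simp: riesz_def inner_simps intro!: exI[of _ "hnorm H g"] Cauchy_Schwarz)

lemma antidualD:
  assumes "\<phi> \<in> hcarrier (antidual H)"
  shows antidual_add: "x \<in> hcarrier H \<Longrightarrow> y \<in> hcarrier H \<Longrightarrow> \<phi> (x + y) = \<phi> x + \<phi> y"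
    and antidual_scale: "x \<in> hcarrier H \<Longrightarrow> \<phi> (c *\<^sub>C x) = cnj c * \<phi> x"
    and antidual_bounded: "\<exists>K. \<forall>x\<in>hcarrier H. cmod (\<phi> x) \<le> K * hnorm H x"
    and antidual_outside: "x \<notin> hcarrier H \<Longrightarrow> \<phi> x = 0"
  using assms by (auto simp: antidual_def)

theorem riesz_representation:
  assumes \<phi>: "\<phi> \<in> hcarrier (antidual H)"
  obtains g where "g \<in> hcarrier H" "riesz H g = \<phi>"
proof -
  note add = antidual_add[OF \<phi>] and scale = antidual_scale[OF \<phi>]
  have diff: "\<phi> (x - y) = \<phi> x - \<phi> y" if "x \<in> hcarrier H" "y \<in> hcarrier H" for x y
    using add[of x "-y"] scale[of y "-1"] that by simp
  obtain K where K: "\<And>x. x \<in> hcarrier H \<Longrightarrow> cmod (\<phi> x) \<le> K * hnorm H x"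
    using antidual_bounded[OF \<phi>] by blast
  let ?S = "{h \<in> hcarrier H. \<phi> h = 0}"
  have eqI: "riesz H g = \<phi>" if "\<And>h. h \<in> hcarrier H \<Longrightarrow> hinner H g h = \<phi> h" for g
    using that antidual_outside[OF \<phi>] by (auto simp: riesz_def fun_eq_iff)
  show ?thesis
  proof (cases "\<forall>h\<in>hcarrier H. \<phi> h = 0")
    case True
    then show ?thesis using that[of 0] eqI[of 0] by simp
  next
    case False
    then obtain x where x: "x \<in> hcarrier H" "\<phi> x \<noteq> 0" by blast
    obtain p where p: "p \<in> ?S" "\<And>s. s \<in> ?S \<Longrightarrow> hinner H (x - p) s = 0"
    proof (rule orthogonal_projection[of ?S x])
      show "csubspace ?S"
        using scale[of 0 0] by (auto simp: csubspace_def add scale)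
      fix xs l assume xs: "\<And>n. xs n \<in> ?S" "hlim H xs sequentially l"
      have "(\<lambda>n. K * hnorm H (xs n - l)) \<longlonglongrightarrow> K * 0"
        using xs(2) by (intro tendsto_mult tendsto_const) (simp add: hlim_def)
      moreover have "cmod (\<phi> l) \<le> K * hnorm H (xs n - l)" for n
        using K[of "xs n - l"] diff[of "xs n" l] xs(1)[of n] hlim_mem[OF xs(2)] by simp
      ultimately have "cmod (\<phi> l) \<le> K * 0"
        by (intro tendsto_lowerbound[where F=sequentially and f="\<lambda>n. K * hnorm H (xs n - l)"]) auto
      then show "l \<in> ?S"
        using hlim_mem[OF xs(2)] by simp
    qed (use x in auto)
    define r where "r = x - p"
    have r: "r \<in> hcarrier H" "\<phi> r \<noteq> 0" using x p(1) by (auto simp: r_def diff)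
    have rr: "hinner H r r \<noteq> 0" using inner_self_eq_0[OF r(1)] r scale[of 0 0] by auto
    \<comment> \<open>The residual \<open>r\<close> is orthogonal to the kernel of the functional;
      the factor is fixed by requiring the value \<open>\<phi> r\<close> at
      \<open>r\<close>.\<close>
    define g where "g = (\<phi> r / hinner H r r) *\<^sub>C r"
    have "hinner H g h = \<phi> h" if h: "h \<in> hcarrier H" for h
    proof -
      \<comment> \<open>The conjugate compensates the conjugate linearity of the functional, so that
        \<open>h\<close> minus this multiple of \<open>r\<close> falls into its kernel.\<close>
      define \<mu> where "\<mu> = cnj (\<phi> h / \<phi> r)"
      have "h - \<mu> *\<^sub>C r \<in> ?S" using h r by (simp add: diff scale \<mu>_def)
      then have "hinner H r (h - \<mu> *\<^sub>C r) = 0" using p(2) by (simp add: r_def)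
      then have "hinner H r h = (\<phi> h / \<phi> r) * hinner H r r"
        using h r by (simp add: inner_simps \<mu>_def)
      then show ?thesis using h r rr by (simp add: g_def inner_simps)
    qed
    then show ?thesis using that[of g] eqI[of g] r(1) by (simp add: g_def)
  qed
qed

lemma riesz_inject: "g \<in> hcarrier H \<Longrightarrow> h \<in> hcarrier H \<Longrightarrow> riesz H g = riesz H h \<longleftrightarrow> g = h"
  using eq_if_inner_eq[of g h] by (metis riesz_apply)

lemma riesz_inv_riesz [simp]: "g \<in> hcarrier H \<Longrightarrow> riesz_inv H (riesz H g) = g"
  unfolding riesz_inv_def by (rule the_inv_into_f_f) (auto simp: inj_on_def riesz_inject)

lemma riesz_inv:
  assumes "\<phi> \<in> hcarrier (antidual H)"
  shows riesz_inv_mem: "riesz_inv H \<phi> \<in> hcarrier H"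
    and riesz_riesz_inv: "riesz H (riesz_inv H \<phi>) = \<phi>"
proof -
  obtain g where "g \<in> hcarrier H" "riesz H g = \<phi>"
    using riesz_representation[OF assms] by blast
  then show "riesz_inv H \<phi> \<in> hcarrier H" "riesz H (riesz_inv H \<phi>) = \<phi>"
    by (metis riesz_inv_riesz)+
qed

lemma riesz_add: "g \<in> hcarrier H \<Longrightarrow> h \<in> hcarrier H \<Longrightarrow> riesz H (g + h) = riesz H g + riesz H h"
  by (auto simp: riesz_def fun_eq_iff inner_simps)

lemma riesz_diff: "g \<in> hcarrier H \<Longrightarrow> h \<in> hcarrier H \<Longrightarrow> riesz H (g - h) = riesz H g - riesz H h"
  by (auto simp: riesz_def fun_eq_iff inner_simps)

lemma riesz_scale: "g \<in> hcarrier H \<Longrightarrow> riesz H (c *\<^sub>C g) = c *\<^sub>C riesz H g"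
  by (auto simp: riesz_def fun_eq_iff inner_simps scaleC_fun_def scaleC_complex_def)

lemma inner_antidual_riesz [simp]:
  "g \<in> hcarrier H \<Longrightarrow> h \<in> hcarrier H \<Longrightarrow> hinner (antidual H) (riesz H g) (riesz H h) = hinner H g h"
  by (simp add: antidual_def)

text \<open>This turns inner products of the boundary space into evaluations, the form in which the
  Green identity states its pairings.\<close>

lemma inner_antidual_pairing:
  assumes "\<phi> \<in> hcarrier (antidual H)" "g \<in> hcarrier H"
  shows "hinner (antidual H) \<phi> (riesz H g) = \<phi> g"
  by (metis assms inner_antidual_riesz riesz_apply riesz_inv_mem riesz_riesz_inv)

lemma antidual_eq_image: "hcarrier (antidual H) = riesz H ` hcarrier H"
  using riesz_mem riesz_representation by (metis image_eqI image_subsetI subset_antisym subsetI)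

lemma hnorm_antidual_riesz: "g \<in> hcarrier H \<Longrightarrow> hnorm (antidual H) (riesz H g) = hnorm H g"
  by (simp add: hnorm_def)

text \<open>The whole structure, completeness included, is transported along the unitary Riesz
  map.\<close>

lemma hilbert_antidual: "hilbert (antidual H)"
proof
  let ?R = "riesz H" and ?C = "hcarrier H"
  have "csubspace (?R ` ?C)"
    unfolding csubspace_def
  proof (intro conjI ballI allI)
    have "?R 0 = 0" by (auto simp: riesz_def fun_eq_iff)
    then show "0 \<in> ?R ` ?C" by (metis image_eqI zero_mem)
    show "\<And>x y. x \<in> ?R ` ?C \<Longrightarrow> y \<in> ?R ` ?C \<Longrightarrow> x + y \<in> ?R ` ?C"
      by (auto simp: riesz_add[symmetric] intro!: imageI)
    show "\<And>c x. x \<in> ?R ` ?C \<Longrightarrow> c *\<^sub>C x \<in> ?R ` ?C"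
      by (auto simp: riesz_scale[symmetric] intro!: imageI)
  qed
  moreover have "\<exists>l\<in>?R ` ?C. (\<lambda>n. hnorm (antidual H) (f n - l)) \<longlonglongrightarrow> 0"
    if f: "\<And>n. f n \<in> ?R ` ?C" and C: "\<And>e. e > 0 \<Longrightarrow> \<exists>N. \<forall>m\<ge>N. \<forall>n\<ge>N. hnorm (antidual H) (f m - f n) < e" for f
  proof -
    define g where "g = (\<lambda>n. riesz_inv H (f n))"
    have g: "g n \<in> ?C" "f n = ?R (g n)" for n
      using riesz_inv_mem[of "f n"] riesz_riesz_inv[of "f n"] f[of n] by (simp_all add: g_def antidual_eq_image)
    have "\<exists>l. hlim H g sequentially l"
      using C g by (intro complete) (auto simp: riesz_diff[symmetric] hnorm_antidual_riesz)
    then obtain l where l: "l \<in> ?C" "(\<lambda>n. hnorm H (g n - l)) \<longlonglongrightarrow> 0" by (auto simp: hlim_def)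
    then show ?thesis
      using g by (intro bexI[of _ "?R l"]) (auto simp: riesz_diff[symmetric] hnorm_antidual_riesz)
  qed
  ultimately show "is_hilbert (antidual H)"
    unfolding is_hilbert_def antidual_eq_image
    apply (intro conjI)
    subgoal by simp
    subgoal by (auto simp: riesz_add[symmetric] inner_simps)
    subgoal by (auto simp: riesz_scale[symmetric] inner_simps)
    subgoal by (auto intro: inner_commute)
    subgoal by (auto simp: inner_self_ge_0)
    subgoal by (auto simp: riesz_inject dest!: inner_self_eq_0) (auto simp: riesz_def fun_eq_iff)
    subgoal by blast
    done
qed

end

text \<open>Only the adjoint at a single vector is ever used, so Riesz representation is applied to
  the functional sending \<open>x\<close> to the product of \<open>y\<close> with
  \<open>T x\<close>, and no adjoint operator is formed.\<close>

lemma adjoint_exists: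
  assumes "hilbert H" "hilbert H'" and T: "bounded_op H H' T" and y: "y \<in> hcarrier H'"
  obtains g where "g \<in> hcarrier H" "\<And>x. x \<in> hcarrier H \<Longrightarrow> hinner H' (T x) y = hinner H x g"
proof -
  interpret H: hilbert H by fact
  interpret H': hilbert H' by fact
  obtain K where lin: "clinear_on (hcarrier H) T" and mem: "\<And>x. x \<in> hcarrier H \<Longrightarrow> T x \<in> hcarrier H'"
    and K: "\<And>x. x \<in> hcarrier H \<Longrightarrow> hnorm H' (T x) \<le> K * hnorm H x"
    using T by (auto simp: bounded_op_def)
  \<comment> \<open>The value 0 off the carrier is the convention for elements of
    \<open>antidual\<close>.\<close>
  define \<phi> where "\<phi> = (\<lambda>x. if x \<in> hcarrier H then hinner H' y (T x) else 0)"
  have "\<phi> \<in> hcarrier (antidual H)"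
  proof -
    have "cmod (hinner H' y (T x)) \<le> hnorm H' y * K * hnorm H x" if "x \<in> hcarrier H" for x
      using H'.Cauchy_Schwarz[OF y mem[OF that]] mult_left_mono[OF K[OF that] H'.norm_ge_0[OF y]]
      by (simp add: mult.assoc)
    then show ?thesis
      using lin mem y by (auto simp: \<phi>_def antidual_def clinear_on_def H'.inner_simps
          intro!: exI[of _ "hnorm H' y * K"])
  qed
  then obtain g where g: "g \<in> hcarrier H" "riesz H g = \<phi>" by (rule H.riesz_representation)
  have "hinner H' (T x) y = hinner H x g" if "x \<in> hcarrier H" for x
  proof -
    have "hinner H g x = hinner H' y (T x)"
      using g(2) that H.riesz_apply[OF that, of g] by (simp add: \<phi>_def)
    then show ?thesis
      using H.inner_commute[OF g(1) that] H'.inner_commute[OF y mem[OF that]] by simp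
  qed
  then show ?thesis using that g(1) by blast
qed

section \<open>Products of Hilbert spaces\<close>

lemma prod_hs_sel [simp]:
  "hcarrier (prod_hs H1 H2) = hcarrier H1 \<times> hcarrier H2"
  "hinner (prod_hs H1 H2) p q = hinner H1 (fst p) (fst q) + hinner H2 (snd p) (snd q)"
  by (simp_all add: prod_hs_def)

locale hilbert_pair = H1: hilbert H1 + H2: hilbert H2
  for H1 :: "'a::cvec hspace" and H2 :: "'b::cvec hspace"
begin

lemma hnorm_prod:
  assumes "p \<in> hcarrier H1 \<times> hcarrier H2"
  shows "hnorm (prod_hs H1 H2) p = sqrt ((hnorm H1 (fst p))\<^sup>2 + (hnorm H2 (snd p))\<^sup>2)"
  using assms by (auto simp: hnorm_def H1.inner_self_ge_0 H2.inner_self_ge_0)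

lemma hnorm_prod_ge:
  assumes "p \<in> hcarrier H1 \<times> hcarrier H2"
  shows "hnorm H1 (fst p) \<le> hnorm (prod_hs H1 H2) p" "hnorm H2 (snd p) \<le> hnorm (prod_hs H1 H2) p"
  using assms by (auto simp: hnorm_prod intro!: real_le_rsqrt)

lemma hnorm_prod_le:
  assumes "p \<in> hcarrier H1 \<times> hcarrier H2"
  shows "hnorm (prod_hs H1 H2) p \<le> hnorm H1 (fst p) + hnorm H2 (snd p)"
  using assms by (auto simp: hnorm_prod intro!: sqrt_sum_squares_le_sum)

lemma hlim_prod_iff:
  assumes f: "\<forall>\<^sub>F t in F. f t \<in> hcarrier H1 \<times> hcarrier H2"
  shows "hlim (prod_hs H1 H2) f F l \<longleftrightarrow>
    hlim H1 (\<lambda>t. fst (f t)) F (fst l) \<and> hlim H2 (\<lambda>t. snd (f t)) F (snd l)"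
proof (cases "l \<in> hcarrier H1 \<times> hcarrier H2")
  case False
  then show ?thesis by (auto simp: hlim_def mem_Times_iff)
next
  case True
  then have l: "fst l \<in> hcarrier H1" "snd l \<in> hcarrier H2" by auto
  have m: "\<forall>\<^sub>F t in F. f t - l \<in> hcarrier H1 \<times> hcarrier H2"
    using f by eventually_elim (use True in auto)
  show ?thesis
  proof (intro iffI conjI)
    assume L: "hlim (prod_hs H1 H2) f F l"
    then have g: "((\<lambda>t. hnorm (prod_hs H1 H2) (f t - l)) \<longlongrightarrow> 0) F" by (simp add: hlim_def)
    show "hlim H1 (\<lambda>t. fst (f t)) F (fst l)"
    proof (rule H1.hlimI[OF l(1) g]; use f m in eventually_elim)
      case (elim t)
      then show ?case using hnorm_prod_ge(1)[OF elim(2)] by (simp add: mem_Times_iff)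
    qed
    show "hlim H2 (\<lambda>t. snd (f t)) F (snd l)"
    proof (rule H2.hlimI[OF l(2) g]; use f m in eventually_elim)
      case (elim t)
      then show ?case using hnorm_prod_ge(2)[OF elim(2)] by (simp add: mem_Times_iff)
    qed
  next
    assume L: "hlim H1 (\<lambda>t. fst (f t)) F (fst l) \<and> hlim H2 (\<lambda>t. snd (f t)) F (snd l)"
    have "((\<lambda>t. hnorm (prod_hs H1 H2) (f t - l)) \<longlongrightarrow> 0) F"
    proof (rule Lim_null_comparison)
      show "((\<lambda>t. hnorm H1 (fst (f t) - fst l) + hnorm H2 (snd (f t) - snd l)) \<longlongrightarrow> 0) F"
        using L tendsto_add[of "\<lambda>t. hnorm H1 (fst (f t) - fst l)" 0 F] by (fastforce simp: hlim_def)
      show "\<forall>\<^sub>F t in F. norm (hnorm (prod_hs H1 H2) (f t - l))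
          \<le> hnorm H1 (fst (f t) - fst l) + hnorm H2 (snd (f t) - snd l)"
        using m
      proof eventually_elim
        case (elim t)
        then show ?case using hnorm_prod_le[OF elim] by (simp add: hnorm_prod)
      qed
    qed
    then show "hlim (prod_hs H1 H2) f F l" using True by (simp add: hlim_def)
  qed
qed

lemma hilbert_prod: "hilbert (prod_hs H1 H2)"
proof
  let ?P = "prod_hs H1 H2" and ?C = "hcarrier H1 \<times> hcarrier H2"
  have "\<exists>l\<in>?C. (\<lambda>n. hnorm ?P (f n - l)) \<longlonglongrightarrow> 0"
    if f: "\<And>n. f n \<in> ?C" and C: "\<And>e. e > 0 \<Longrightarrow> \<exists>N. \<forall>m\<ge>N. \<forall>n\<ge>N. hnorm ?P (f m - f n) < e" for f
  proof -
    have fm: "f m - f n \<in> ?C" "fst (f n) \<in> hcarrier H1" "snd (f n) \<in> hcarrier H2" for m n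
      using f[of m] f[of n] by auto
    have "\<exists>l. hlim H1 (\<lambda>n. fst (f n)) sequentially l"
    proof (rule H1.complete)
      fix e :: real assume "e > 0"
      then obtain N where N: "\<And>m n. m \<ge> N \<Longrightarrow> n \<ge> N \<Longrightarrow> hnorm ?P (f m - f n) < e" using C by meson
      show "\<exists>N. \<forall>m\<ge>N. \<forall>n\<ge>N. hnorm H1 (fst (f m) - fst (f n)) < e"
        using le_less_trans[OF hnorm_prod_ge(1)[OF fm(1)] N] by (intro exI[of _ N]) simp
    qed (use fm in auto)
    moreover have "\<exists>l. hlim H2 (\<lambda>n. snd (f n)) sequentially l"
    proof (rule H2.complete)
      fix e :: real assume "e > 0"
      then obtain N where N: "\<And>m n. m \<ge> N \<Longrightarrow> n \<ge> N \<Longrightarrow> hnorm ?P (f m - f n) < e" using C by meson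
      show "\<exists>N. \<forall>m\<ge>N. \<forall>n\<ge>N. hnorm H2 (snd (f m) - snd (f n)) < e"
        using le_less_trans[OF hnorm_prod_ge(2)[OF fm(1)] N] by (intro exI[of _ N]) simp
    qed (use fm in auto)
    ultimately obtain l1 l2 where "hlim H1 (\<lambda>n. fst (f n)) sequentially l1" "hlim H2 (\<lambda>n. snd (f n)) sequentially l2"
      by blast
    then have "hlim ?P f sequentially (l1, l2)"
      using f by (subst hlim_prod_iff) auto
    then show ?thesis by (auto simp: hlim_def)
  qed
  moreover have "csubspace ?C"
    by (auto simp: csubspace_def scaleC_prod_def zero_prod_def)
  moreover have "p = 0" if "p \<in> ?C" "hinner ?P p p = 0" for p
  proof -
    have "Re (hinner H1 (fst p) (fst p)) = 0" "Re (hinner H2 (snd p) (snd p)) = 0"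
      using that H1.inner_self_ge_0[of "fst p"] H2.inner_self_ge_0[of "snd p"]
      by (auto simp: complex_eq_iff)
    then have "fst p = 0" "snd p = 0"
      using that by (auto simp flip: H1.norm_sq H2.norm_sq H1.norm_eq_0 H2.norm_eq_0)
    then show ?thesis by (simp add: prod_eq_iff)
  qed
  ultimately show "is_hilbert ?P"
    unfolding is_hilbert_def
    apply (intro conjI)
    subgoal by simp
    subgoal by (auto simp: H1.inner_simps H2.inner_simps)
    subgoal by (auto simp: H1.inner_simps H2.inner_simps scaleC_prod_def distrib_left)
    subgoal by (auto intro!: arg_cong2[where f="(+)"] H1.inner_commute H2.inner_commute)
    subgoal by (auto simp: H1.inner_self_ge_0 H2.inner_self_ge_0)
    subgoal by (simp only: prod_hs_sel(1)) blast
    subgoal by (simp only: prod_hs_sel(1)) blast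
    done
qed

end

section \<open>Closed operators: closed range and projections\<close>

lemma closed_opD:
  assumes "closed_op H1 H2 S f"
  shows closed_op_csubspace: "csubspace S"
    and closed_op_dom: "S \<subseteq> hcarrier H1" "x \<in> S \<Longrightarrow> x \<in> hcarrier H1"
    and closed_op_clinear: "clinear_on S f"
    and closed_op_mem: "x \<in> S \<Longrightarrow> f x \<in> hcarrier H2"
    and closed_op_lim: "\<lbrakk>\<And>n. xs n \<in> S; hlim H1 xs sequentially z; hlim H2 (\<lambda>n. f (xs n)) sequentially y\<rbrakk>
      \<Longrightarrow> z \<in> S \<and> f z = y"
proof -
  note c = assms[unfolded closed_op_def]
  note c' = c[THEN conjunct2]
  show "csubspace S" using c by (rule conjunct1)
  show S: "S \<subseteq> hcarrier H1" using c' by (rule conjunct1)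
  then show "x \<in> S \<Longrightarrow> x \<in> hcarrier H1" by (rule subsetD)
  note c = c'[THEN conjunct2]
  show "clinear_on S f" using c by (rule conjunct1)
  note c' = c[THEN conjunct2]
  show "x \<in> S \<Longrightarrow> f x \<in> hcarrier H2" using c'[THEN conjunct1] by (rule subsetD) (rule imageI)
  show "\<lbrakk>\<And>n. xs n \<in> S; hlim H1 xs sequentially z; hlim H2 (\<lambda>n. f (xs n)) sequentially y\<rbrakk> \<Longrightarrow> z \<in> S \<and> f z = y"
    by (rule c'[THEN conjunct2, rule_format, of xs]) simp
qed

text \<open>The lower bound makes the preimages of a convergent sequence Cauchy, and closedness
  identifies the image of their limit.\<close>

lemma closed_range:
  assumes H1: "hilbert H1" and H2: "hilbert H2" and f: "closed_op H1 H2 S f"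
    and r: "r > 0" "\<And>x. x \<in> S \<Longrightarrow> r * hnorm H1 x \<le> hnorm H2 (f x)"
    and xs: "\<And>n. xs n \<in> f ` S" and l: "hlim H2 xs sequentially l"
  shows "l \<in> f ` S"
proof -
  interpret H1: hilbert H1 by (rule H1)
  interpret H2: hilbert H2 by (rule H2)
  note S = closed_op_csubspace[OF f] and mem = closed_op_dom(2)[OF f] closed_op_mem[OF f]
  have "\<forall>n. \<exists>z. z \<in> S \<and> xs n = f z" using xs by blast
  then obtain zs where zs: "\<And>n. zs n \<in> S" "\<And>n. xs n = f (zs n)" by metis
  have "\<exists>z. hlim H1 zs sequentially z"
  proof (rule H1.complete)
    fix e :: real assume "e > 0"
    then have re: "r * e > 0" using r(1) by simp
    have "xs n \<in> hcarrier H2" for n using zs mem(2) by simp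
    from H2.Cauchy_of_hlim[OF l this re] obtain N where
      N: "\<And>m n. m \<ge> N \<Longrightarrow> n \<ge> N \<Longrightarrow> hnorm H2 (xs m - xs n) < r * e" by blast
    have "hnorm H1 (zs m - zs n) < e" if "m \<ge> N" "n \<ge> N" for m n
    proof -
      have "r * hnorm H1 (zs m - zs n) \<le> hnorm H2 (xs m - xs n)"
        using r(2)[OF csubspace_diff[OF S zs(1) zs(1)]] clinear_on_diff[OF S closed_op_clinear[OF f] zs(1) zs(1)]
        by (simp add: zs(2))
      then have "r * hnorm H1 (zs m - zs n) < r * e" using N[OF that] by simp
      then show ?thesis using r(1) by simp
    qed
    then show "\<exists>N. \<forall>m\<ge>N. \<forall>n\<ge>N. hnorm H1 (zs m - zs n) < e" by blast
  qed (use zs mem in simp)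
  then obtain z where z: "hlim H1 zs sequentially z" by blast
  have "z \<in> S \<and> f z = l"
    using l by (intro closed_op_lim[OF f zs(1) z]) (simp flip: zs(2))
  then show ?thesis by blast
qed

lemma range_projection:
  assumes H1: "hilbert H1" and H2: "hilbert H2" and f: "closed_op H1 H2 S f"
    and r: "r > 0" "\<And>x. x \<in> S \<Longrightarrow> r * hnorm H1 x \<le> hnorm H2 (f x)" and y: "y \<in> hcarrier H2"
  obtains x where "x \<in> S" "\<And>s. s \<in> S \<Longrightarrow> hinner H2 (y - f x) (f s) = 0"
proof -
  interpret H2: hilbert H2 by (rule H2)
  obtain p where "p \<in> f ` S" "\<And>s. s \<in> f ` S \<Longrightarrow> hinner H2 (y - p) s = 0"
  proof (rule H2.orthogonal_projection[of "f ` S" y])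
    show "csubspace (f ` S)" by (rule csubspace_image[OF closed_op_csubspace[OF f] closed_op_clinear[OF f]])
    show "f ` S \<subseteq> hcarrier H2" using closed_op_mem[OF f] by blast
    show "l \<in> f ` S" if "\<And>n. xs n \<in> f ` S" "hlim H2 xs sequentially l" for xs l
      by (rule closed_range[OF H1 H2 f r that])
  qed (use y in auto)
  then show ?thesis using that by blast
qed

text \<open>The residual of the projection onto the closed range is orthogonal to the range. This
  gives the surjectivity of \<open>M\<close> and the range condition for the dissipative
  restrictions.\<close>

lemma range_eq_carrier:
  assumes H1: "hilbert H1" and H2: "hilbert H2" and f: "closed_op H1 H2 S f"
    and r: "r > 0" "\<And>x. x \<in> S \<Longrightarrow> r * hnorm H1 x \<le> hnorm H2 (f x)"
    and triv: "\<And>h. h \<in> hcarrier H2 \<Longrightarrow> (\<And>x. x \<in> S \<Longrightarrow> hinner H2 (f x) h = 0) \<Longrightarrow> h = 0"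
  shows "f ` S = hcarrier H2"
proof (intro equalityI subsetI)
  interpret H2: hilbert H2 by (rule H2)
  fix y assume y: "y \<in> hcarrier H2"
  obtain x where x: "x \<in> S" "\<And>s. s \<in> S \<Longrightarrow> hinner H2 (y - f x) (f s) = 0"
    using range_projection[OF H1 H2 f r y] by blast
  have d: "y - f x \<in> hcarrier H2" using y closed_op_mem[OF f x(1)] by simp
  have "y - f x = 0"
  proof (rule triv[OF d])
    show "hinner H2 (f s) (y - f x) = 0" if "s \<in> S" for s
      using H2.inner_commute[OF d closed_op_mem[OF f that]] x(2)[OF that] by simp
  qed
  then show "y \<in> f ` S" using x(1) by auto
qed (use closed_op_mem[OF f] in auto)

text \<open>Von Neumann's device: the graph of a closed operator is a closed subspace of the
  product, and the residual of a projection onto it encodes a pair in the graph of the adjoint (up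
  to a swap and a sign). It is applied to \<open>A\<close> and to \<open>B\<close>.\<close>

lemma graph_projection:
  assumes H1: "hilbert H1" and H2: "hilbert H2" and f: "closed_op H1 H2 S f"
    and p: "p \<in> hcarrier H1" and q: "q \<in> hcarrier H2"
  obtains x where "x \<in> S" "\<And>s. s \<in> S \<Longrightarrow> hinner H1 (p - x) s + hinner H2 (q - f x) (f s) = 0"
proof -
  interpret H12: hilbert_pair H1 H2 by (intro hilbert_pair.intro H1 H2)
  interpret P: hilbert "prod_hs H1 H2" by (rule H12.hilbert_prod)
  let ?g = "\<lambda>x. (x, f x)"
  note S = closed_op_csubspace[OF f] and mem = closed_op_dom(2)[OF f] closed_op_mem[OF f]
  obtain g where "g \<in> ?g ` S" "\<And>s. s \<in> ?g ` S \<Longrightarrow> hinner (prod_hs H1 H2) ((p, q) - g) s = 0"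
  proof (rule P.orthogonal_projection[of "?g ` S" "(p, q)"])
    show "csubspace (?g ` S)"
      using closed_op_clinear[OF f] by (intro csubspace_image[OF S]) (auto simp: clinear_on_def scaleC_prod_def)
    show "?g ` S \<subseteq> hcarrier (prod_hs H1 H2)" using mem by auto
    fix xs l assume xs: "\<And>n. xs n \<in> ?g ` S" and l: "hlim (prod_hs H1 H2) xs sequentially l"
    have xs': "fst (xs n) \<in> S" "snd (xs n) = f (fst (xs n))" for n using xs[of n] by auto
    have "\<forall>\<^sub>F n in sequentially. xs n \<in> hcarrier H1 \<times> hcarrier H2"
      using xs' mem by (intro always_eventually) (simp add: mem_Times_iff)
    with l have "hlim H1 (\<lambda>n. fst (xs n)) sequentially (fst l)" "hlim H2 (\<lambda>n. f (fst (xs n))) sequentially (snd l)"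
      by (simp_all add: H12.hlim_prod_iff xs'(2))
    then have "fst l \<in> S \<and> f (fst l) = snd l"
      using closed_op_lim[OF f, of "\<lambda>n. fst (xs n)"] xs'(1) by blast
    then show "l \<in> ?g ` S" by (intro image_eqI[of _ _ "fst l"]) auto
  qed (use p q in auto)
  then show ?thesis using that by auto
qed

section \<open>Generation of contraction semigroups\<close>

context hilbert
begin

lemma dense_in_iff:
  "dense_in H S \<longleftrightarrow> S \<subseteq> hcarrier H \<and> (\<forall>x\<in>hcarrier H. \<forall>e>0. \<exists>s\<in>S. hnorm H (x - s) < e)"
proof (intro iffI conjI ballI allI impI)
  fix x and e :: real assume d: "dense_in H S" and x: "x \<in> hcarrier H" and e: "e > 0"
  then obtain xs where xs: "\<And>n. xs n \<in> S" "hlim H xs sequentially x"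
    unfolding dense_in_def by blast
  have "\<forall>\<^sub>F n in sequentially. hnorm H (xs n - x) < e"
    using xs(2) e order_tendstoD(2)[of "\<lambda>n. hnorm H (xs n - x)" 0 sequentially e] by (simp add: hlim_def)
  then obtain n where "hnorm H (xs n - x) < e" by (auto simp: eventually_sequentially)
  then show "\<exists>s\<in>S. hnorm H (x - s) < e"
    using xs(1)[of n] d x norm_minus_commute[of x "xs n"] by (intro bexI[of _ "xs n"]) (auto simp: dense_in_def)
next
  assume S: "S \<subseteq> hcarrier H \<and> (\<forall>x\<in>hcarrier H. \<forall>e>0. \<exists>s\<in>S. hnorm H (x - s) < e)"
  have "\<exists>xs. (\<forall>n. xs n \<in> S) \<and> hlim H xs sequentially x" if x: "x \<in> hcarrier H" for x
  proof -
    have "\<forall>n. \<exists>s. s \<in> S \<and> hnorm H (x - s) < 1 / real (Suc n)"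
      using S x by (meson divide_pos_pos of_nat_0_less_iff zero_less_Suc zero_less_one)
    then obtain xs where xs: "\<And>n. xs n \<in> S" "\<And>n. hnorm H (x - xs n) < 1 / real (Suc n)"
      by metis
    have "hlim H xs sequentially x"
    proof (rule hlimI[OF x])
      show "(\<lambda>n. 1 / real (Suc n)) \<longlonglongrightarrow> 0" by (intro LIMSEQ_Suc lim_1_over_n)
      have "xs n \<in> hcarrier H \<and> hnorm H (xs n - x) \<le> 1 / real (Suc n)" for n
        using xs(1)[of n] xs(2)[of n] S x norm_minus_commute[of x "xs n"] by auto
      then show "\<forall>\<^sub>F n in sequentially. xs n \<in> hcarrier H \<and> hnorm H (xs n - x) \<le> 1 / real (Suc n)"
        by simp
    qed
    then show ?thesis using xs(1) by blast
  qed
  then show "dense_in H S" using S by (simp add: dense_in_def)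
qed (simp add: dense_in_def)

text \<open>Projecting onto the closure of \<open>S\<close>, described by distances, leaves a
  residual orthogonal to \<open>S\<close>.\<close>

lemma dense_in_if_orthogonal_trivial:
  assumes S: "csubspace S" "S \<subseteq> hcarrier H"
    and triv: "\<And>r. r \<in> hcarrier H \<Longrightarrow> (\<And>s. s \<in> S \<Longrightarrow> hinner H r s = 0) \<Longrightarrow> r = 0"
  shows "dense_in H S"
proof -
  let ?C = "{x \<in> hcarrier H. \<forall>e>0. \<exists>s\<in>S. hnorm H (x - s) < e}"
  have SC: "S \<subseteq> ?C"
    using S(2) by (auto intro!: bexI)
  have "x \<in> ?C" if x: "x \<in> hcarrier H" for x
  proof -
    obtain p where p: "p \<in> ?C" "\<And>s. s \<in> ?C \<Longrightarrow> hinner H (x - p) s = 0"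
    proof (rule orthogonal_projection[of ?C x])
      show "csubspace ?C"
        unfolding csubspace_def
      proof (intro conjI ballI allI)
        show "0 \<in> ?C" using SC csubspace_zero[OF S(1)] by blast
      next
        fix x y assume xy: "x \<in> ?C" "y \<in> ?C"
        have "\<exists>s\<in>S. hnorm H (x + y - s) < e" if "e > 0" for e
        proof -
          obtain s t where st: "s \<in> S" "hnorm H (x - s) < e / 2" "t \<in> S" "hnorm H (y - t) < e / 2"
            using xy \<open>e > 0\<close> half_gt_zero[of e] by blast
          have "hnorm H ((x - s) + (y - t)) < e"
            using norm_triangle[of "x - s" "y - t"] st xy S(2) by (simp add: subset_iff)
          then show ?thesis
            using st csubspace_add[OF S(1)] by (intro bexI[of _ "s + t"]) (auto simp: algebra_simps)
        qed
        then show "x + y \<in> ?C" using xy by simp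
      next
        fix c x assume x: "x \<in> ?C"
        have "\<exists>s\<in>S. hnorm H (c *\<^sub>C x - s) < e" if "e > 0" for e
        proof -
          \<comment> \<open>The added 1 keeps the denominator positive when \<open>c\<close> is
            0.\<close>
          have pos: "e / (cmod c + 1) > 0" using that by (simp add: add_nonneg_pos)
          then obtain s where s: "s \<in> S" "hnorm H (x - s) < e / (cmod c + 1)" using x by blast
          have m: "x - s \<in> hcarrier H" using s x S(2) by (auto simp: subset_iff)
          have "hnorm H (c *\<^sub>C x - c *\<^sub>C s) = cmod c * hnorm H (x - s)"
            using norm_scale[OF m] by (simp add: cvec.scale_right_diff_distrib)
          also have "\<dots> \<le> (cmod c + 1) * hnorm H (x - s)" using m by (intro mult_right_mono) auto
          also have "\<dots> < e"
            using s(2) pos_less_divide_eq[of "cmod c + 1" "hnorm H (x - s)" e]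
            by (simp add: mult.commute add_nonneg_pos)
          finally show ?thesis using s(1) csubspace_scale[OF S(1)] by blast
        qed
        then show "c *\<^sub>C x \<in> ?C" using x by simp
      qed
    next
      fix xs l assume xs: "\<And>n. xs n \<in> ?C" "hlim H xs sequentially l"
      note l = hlim_mem[OF xs(2)]
      have "\<exists>s\<in>S. hnorm H (l - s) < e" if "e > 0" for e
      proof -
        have "\<forall>\<^sub>F n in sequentially. hnorm H (xs n - l) < e / 2"
          using xs(2) that order_tendstoD(2)[of "\<lambda>n. hnorm H (xs n - l)" 0 sequentially "e / 2"]
          by (simp add: hlim_def)
        then obtain n where n: "hnorm H (xs n - l) < e / 2" by (auto simp: eventually_sequentially)
        obtain s where s: "s \<in> S" "hnorm H (xs n - s) < e / 2"
          using xs(1)[of n] half_gt_zero[OF \<open>e > 0\<close>] by blast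
        have "hnorm H (l - s) < e"
          using norm_triangle_via[of l "xs n" s] norm_minus_commute[of l "xs n"] n s xs(1)[of n] l S(2)
          by (simp add: subset_iff)
        then show ?thesis using s(1) by blast
      qed
      then show "l \<in> ?C" using l by simp
    qed (use x in auto)
    have "x - p = 0"
      using triv[of "x - p"] p SC x by (simp add: subset_iff)
    then show ?thesis using p(1) by simp
  qed
  then show ?thesis using S(2) by (auto simp: dense_in_iff)
qed

lemma Cauchy_of_geometric:
  assumes f: "\<And>n. f n \<in> hcarrier H" and step: "\<And>n. hnorm H (f (Suc n) - f n) \<le> C / 2 ^ n" and e: "e > 0"
  shows "\<exists>N. \<forall>m\<ge>N. \<forall>n\<ge>N. hnorm H (f m - f n) < e"
proof -
  have C: "C \<ge> 0" using order_trans[OF norm_ge_0 step[of 0]] f by simp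
  \<comment> \<open>The right-hand side is the exact sum of \<open>C / 2 ^ i\<close> for
    \<open>i\<close> from \<open>n\<close> to \<open>n + k - 1\<close>, which lets the induction
    close.\<close>
  have *: "hnorm H (f (n + k) - f n) \<le> 2 * C / 2 ^ n - 2 * C / 2 ^ (n + k)" for n k
  proof (induction k)
    case (Suc k)
    have "hnorm H (f (n + Suc k) - f n) \<le> C / 2 ^ (n + k) + (2 * C / 2 ^ n - 2 * C / 2 ^ (n + k))"
      using norm_triangle_via[of "f (n + Suc k)" "f (n + k)" "f n"] f step[of "n + k"] Suc by simp
    then show ?case by (simp add: field_simps)
  qed (use f in simp)
  \<comment> \<open>Both indices are compared with \<open>N\<close> at cost
    \<open>2 * C / 2 ^ N\<close> each, hence the 4.\<close>
  have "(\<lambda>n. 4 * C * (1 / 2) ^ n) \<longlonglongrightarrow> 4 * C * 0"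
    by (intro tendsto_mult tendsto_const LIMSEQ_power_zero) simp
  then have "\<forall>\<^sub>F n in sequentially. 4 * C * (1 / 2) ^ n < e"
    using e by (intro order_tendstoD(2)) auto
  then obtain N where N: "4 * C * (1 / 2) ^ N < e" by (auto simp: eventually_sequentially)
  have near: "hnorm H (f m - f N) \<le> 2 * C / 2 ^ N" if "m \<ge> N" for m
  proof -
    have "0 \<le> 2 * C / 2 ^ (N + (m - N))" using C by simp
    then show ?thesis using *[of N "m - N"] that by simp
  qed
  have "hnorm H (f m - f n) < e" if "m \<ge> N" "n \<ge> N" for m n
  proof -
    have "hnorm H (f m - f n) \<le> 2 * C / 2 ^ N + 2 * C / 2 ^ N"
      using norm_triangle_via[of "f m" "f N" "f n"] near[OF that(1)] near[OF that(2)]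
        norm_minus_commute[of "f N" "f n"] f by simp
    also have "\<dots> < e" using N by (simp add: power_one_over)
    finally show ?thesis .
  qed
  then show ?thesis by blast
qed

end

text \<open>The range condition is required for every \<open>r > 0\<close> because that is what the
  application provides directly.\<close>

locale mdissipative = hilbert H for H :: "'a::cvec hspace" +
  fixes Dm :: "'a set" and L :: "'a \<Rightarrow> 'a"
  assumes sub: "csubspace Dm" "Dm \<subseteq> hcarrier H" and lin: "clinear_on Dm L"
    and maps: "L ` Dm \<subseteq> hcarrier H"
    and diss: "x \<in> Dm \<Longrightarrow> Re (hinner H (L x) x) \<le> 0"
    and range: "r > 0 \<Longrightarrow> y \<in> hcarrier H \<Longrightarrow> \<exists>x\<in>Dm. complex_of_real r *\<^sub>C x - L x = y"
begin

section \<open>The implicit Euler step and its powers\<close>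

lemma Dm_mem [simp]: "x \<in> Dm \<Longrightarrow> x \<in> hcarrier H"
  and L_mem [simp]: "x \<in> Dm \<Longrightarrow> L x \<in> hcarrier H"
  using sub maps by auto

lemmas Dm_closed [simp] = csubspace_zero[OF sub(1)] csubspace_add[OF sub(1)] csubspace_diff[OF sub(1)]
  csubspace_scale[OF sub(1)]

lemmas L_linear = clinear_on_add[OF sub(1) lin] clinear_on_diff[OF sub(1) lin]
  clinear_on_scale[OF sub(1) lin]

text \<open>Pairing with \<open>x\<close>, dissipativity bounds |x|^2 by the real part of the
  product of \<open>x - h L x\<close> with \<open>x\<close>; Cauchy-Schwarz and cancellation of one
  factor follow. This is what makes every Euler step a contraction.\<close>

lemma norm_le_resolvent:
  assumes "x \<in> Dm" "h \<ge> 0"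
  shows "hnorm H x \<le> hnorm H (x - complex_of_real h *\<^sub>C L x)"
proof (cases "hnorm H x = 0")
  case False
  let ?y = "x - complex_of_real h *\<^sub>C L x"
  have "(hnorm H x)\<^sup>2 \<le> Re (hinner H ?y x)"
    using assms diss[OF assms(1)] by (simp add: inner_simps norm_sq mult_nonneg_nonpos)
  also have "\<dots> \<le> hnorm H ?y * hnorm H x"
    using assms by (intro Re_inner_le) auto
  finally show ?thesis using False assms norm_ge_0[of x]
    by (simp add: power2_eq_square less_le)
qed (use assms in simp)

lemma resolvent_range:
  assumes "h > 0" "y \<in> hcarrier H"
  shows "\<exists>x\<in>Dm. x - complex_of_real h *\<^sub>C L x = y"
proof -
  obtain x where x: "x \<in> Dm" "complex_of_real (1 / h) *\<^sub>C x - L x = complex_of_real (1 / h) *\<^sub>C y"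
    using range[of "1 / h" "complex_of_real (1 / h) *\<^sub>C y"] assms by auto
  have "complex_of_real h *\<^sub>C (complex_of_real (1 / h) *\<^sub>C x - L x) = x - complex_of_real h *\<^sub>C L x"
    using assms by (simp add: cvec.scale_right_diff_distrib)
  then have "x - complex_of_real h *\<^sub>C L x = y"
    using x(2) assms by simp
  then show ?thesis using x(1) by blast
qed

text \<open>The inverse of 1 - h L, that is, one implicit Euler step of length \<open>h\<close> for
  the equation z' = L z.\<close>

definition J :: "real \<Rightarrow> 'a \<Rightarrow> 'a" where
  "J h y = (THE x. x \<in> Dm \<and> x - complex_of_real h *\<^sub>C L x = y)"

lemma resolvent_inject:
  assumes "x \<in> Dm" "x' \<in> Dm" "h \<ge> 0"
    "x - complex_of_real h *\<^sub>C L x = x' - complex_of_real h *\<^sub>C L x'"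
  shows "x = x'"
proof -
  have "(x - x') - complex_of_real h *\<^sub>C L (x - x') =
      (x - complex_of_real h *\<^sub>C L x) - (x' - complex_of_real h *\<^sub>C L x')"
    using assms(1,2) by (simp add: L_linear cvec.scale_right_diff_distrib)
  then have "hnorm H (x - x') \<le> 0"
    using norm_le_resolvent[of "x - x'" h] assms by simp
  then have "hnorm H (x - x') = 0" using assms by (intro antisym) auto
  then show ?thesis using assms norm_eq_0[of "x - x'"] by simp
qed

lemma J_eqI:
  assumes "x \<in> Dm" "h \<ge> 0" "x - complex_of_real h *\<^sub>C L x = y"
  shows "J h y = x"
  unfolding J_def using assms by (intro the_equality) (auto intro: resolvent_inject)

context
  fixes h :: real assumes h: "h > 0"
begin

lemma J_mem [simp]: "y \<in> hcarrier H \<Longrightarrow> J h y \<in> Dm"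
  and J_eq: "y \<in> hcarrier H \<Longrightarrow> J h y - complex_of_real h *\<^sub>C L (J h y) = y"
  using resolvent_range[OF h] J_eqI h by (metis less_imp_le)+

lemma J_norm_le: "y \<in> hcarrier H \<Longrightarrow> hnorm H (J h y) \<le> hnorm H y"
  using norm_le_resolvent[of "J h y" h] h J_eq by simp

lemma J_add: "x \<in> hcarrier H \<Longrightarrow> y \<in> hcarrier H \<Longrightarrow> J h (x + y) = J h x + J h y"
proof (rule J_eqI)
  assume x: "x \<in> hcarrier H" and y: "y \<in> hcarrier H"
  have "J h x + J h y - complex_of_real h *\<^sub>C L (J h x + J h y) =
      (J h x - complex_of_real h *\<^sub>C L (J h x)) + (J h y - complex_of_real h *\<^sub>C L (J h y))"
    using x y by (simp add: L_linear cvec.scale_right_distrib)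
  then show "J h x + J h y - complex_of_real h *\<^sub>C L (J h x + J h y) = x + y"
    using J_eq[OF x] J_eq[OF y] by simp
qed (use h in auto)

lemma J_scale: "x \<in> hcarrier H \<Longrightarrow> J h (c *\<^sub>C x) = c *\<^sub>C J h x"
proof (rule J_eqI)
  assume x: "x \<in> hcarrier H"
  have "c *\<^sub>C (J h x - complex_of_real h *\<^sub>C L (J h x)) = c *\<^sub>C x" using J_eq[OF x] by simp
  then show "c *\<^sub>C J h x - complex_of_real h *\<^sub>C L (c *\<^sub>C J h x) = c *\<^sub>C x"
    using x by (simp add: L_linear cvec.scale_right_diff_distrib mult.commute)
qed (use h in auto)

lemma J_linear: "clinear_on (hcarrier H) (J h)"
  by (simp add: clinear_on_def J_add J_scale)

text \<open>Applying 1 - h L to the right-hand side of the second identity returns \<open>x\<close>,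
  so uniqueness gives that identity; dividing by \<open>h\<close> then yields the
  commutation.\<close>

lemma J_L_commute:
  assumes "x \<in> Dm"
  shows "L (J h x) = J h (L x)" "J h x = x + complex_of_real h *\<^sub>C J h (L x)"
proof -
  let ?u = "J h (L x)"
  show *: "J h x = x + complex_of_real h *\<^sub>C ?u"
  proof (rule J_eqI)
    have "x + complex_of_real h *\<^sub>C ?u - complex_of_real h *\<^sub>C L (x + complex_of_real h *\<^sub>C ?u)
      = x - complex_of_real h *\<^sub>C L x + complex_of_real h *\<^sub>C (?u - complex_of_real h *\<^sub>C L ?u)"
      using assms by (simp add: L_linear cvec.scale_right_diff_distrib cvec.scale_right_distrib)
    then show "x + complex_of_real h *\<^sub>C ?u - complex_of_real h *\<^sub>C L (x + complex_of_real h *\<^sub>C ?u) = x"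
      using J_eq[of "L x"] assms by simp
  qed (use assms h in auto)
  have "complex_of_real h *\<^sub>C L (J h x) = J h x - x"
    using J_eq[of x] assms by (simp add: algebra_simps)
  also have "\<dots> = complex_of_real h *\<^sub>C ?u" using * by simp
  finally show "L (J h x) = ?u" using h by simp
qed

lemma pow_J_mem [simp]: "x \<in> hcarrier H \<Longrightarrow> (J h ^^ n) x \<in> hcarrier H"
  by (induction n) auto

lemma pow_J_norm_le: "x \<in> hcarrier H \<Longrightarrow> hnorm H ((J h ^^ n) x) \<le> hnorm H x"
  by (induction n) (auto intro: order_trans[OF J_norm_le])

lemma pow_J_add: "x \<in> hcarrier H \<Longrightarrow> y \<in> hcarrier H \<Longrightarrow> (J h ^^ n) (x + y) = (J h ^^ n) x + (J h ^^ n) y"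
  by (induction n) (auto simp: J_add)

lemma pow_J_scale: "x \<in> hcarrier H \<Longrightarrow> (J h ^^ n) (c *\<^sub>C x) = c *\<^sub>C (J h ^^ n) x"
  by (induction n) (auto simp: J_scale)

lemma pow_J_diff: "x \<in> hcarrier H \<Longrightarrow> y \<in> hcarrier H \<Longrightarrow> (J h ^^ n) (x - y) = (J h ^^ n) x - (J h ^^ n) y"
  using pow_J_add[of x "(-1) *\<^sub>C y" n] pow_J_scale[of y n "-1"] by simp

lemma pow_J_L:
  assumes "x \<in> Dm"
  shows "(J h ^^ n) x \<in> Dm" "L ((J h ^^ n) x) = (J h ^^ n) (L x)"
  using assms by (induction n) (auto simp: J_L_commute(1))

lemma J_diff_le:
  assumes "x \<in> Dm"
  shows "hnorm H (J h x - x) \<le> h * hnorm H (L x)"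
proof -
  have "J h x - x = complex_of_real h *\<^sub>C J h (L x)" using J_L_commute(2)[OF assms] by simp
  then show ?thesis using h assms J_norm_le[of "L x"] by (simp add: norm_scale)
qed

text \<open>Each step displaces \<open>x\<close> by at most h |L x|, and later steps, being
  contractions, do not enlarge the displacement.\<close>

lemma pow_J_diff_le:
  assumes "x \<in> Dm"
  shows "hnorm H ((J h ^^ n) x - x) \<le> real n * h * hnorm H (L x)"
proof (induction n)
  case (Suc n)
  have "(J h ^^ Suc n) x - x = J h ((J h ^^ n) x - x) + (J h x - x)"
    using assms clinear_on_diff[OF csubspace_carrier J_linear, of "(J h ^^ n) x" x] by simp
  also have "hnorm H \<dots> \<le> hnorm H ((J h ^^ n) x - x) + h * hnorm H (L x)"
    using assms J_norm_le[of "(J h ^^ n) x - x"] J_diff_le[OF assms]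
    by (intro order_trans[OF norm_triangle] add_mono) auto
  finally show ?case using Suc by (simp add: algebra_simps)
qed (use assms in simp)

lemma pow_J_diff_le':
  assumes "x \<in> Dm" "m \<le> n"
  shows "hnorm H ((J h ^^ n) x - (J h ^^ m) x) \<le> real (n - m) * h * hnorm H (L x)"
proof -
  have "(J h ^^ n) x - (J h ^^ m) x = (J h ^^ m) ((J h ^^ (n - m)) x - x)"
    using assms funpow_add[of m "n - m" "J h"] by (simp add: pow_J_diff)
  then show ?thesis
    using pow_J_norm_le[of "(J h ^^ (n - m)) x - x" m] pow_J_diff_le[OF assms(1), of "n - m"] assms by simp
qed

text \<open>Comparison with the Taylor polynomial x + n h L x. One more step adds (n + 1) h times
  \<open>?v\<close>, where |v| is at most h |L L x|, and n^2 + (n + 1) \<le> (n + 1)^2 closes the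
  induction.\<close>

lemma pow_J_second_order:
  assumes x: "x \<in> Dm" "L x \<in> Dm"
  shows "hnorm H ((J h ^^ n) x - x - complex_of_real (n * h) *\<^sub>C L x) \<le> (n * h)\<^sup>2 * hnorm H (L (L x))"
proof (induction n)
  case (Suc n)
  define c where "c = complex_of_real h"
  define d where "d = complex_of_real (n * h)"
  have cd: "complex_of_real (Suc n * h) = d + c" by (simp add: c_def d_def algebra_simps)
  let ?y = "(J h ^^ n) x - x - d *\<^sub>C L x" and ?v = "J h (L x) - L x"
  note J_diff = clinear_on_diff[OF csubspace_carrier J_linear]
  have Jx: "J h x = x + c *\<^sub>C J h (L x)" using J_L_commute(2)[OF x(1)] by (simp add: c_def)
  have "J h ?y = J h ((J h ^^ n) x) - J h x - d *\<^sub>C J h (L x)"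
    using x by (simp add: J_diff J_scale)
  then have "(J h ^^ Suc n) x - x - complex_of_real (Suc n * h) *\<^sub>C L x = J h ?y + (d + c) *\<^sub>C ?v"
    unfolding cd by (simp add: Jx cvec.scale_right_diff_distrib scaleC_add_left)
  also have "hnorm H \<dots> \<le> (n * h)\<^sup>2 * hnorm H (L (L x)) + Suc n * h * (h * hnorm H (L (L x)))"
  proof (intro order_trans[OF norm_triangle] add_mono)
    show "hnorm H (J h ?y) \<le> (n * h)\<^sup>2 * hnorm H (L (L x))"
      using Suc J_norm_le[of ?y] x by (simp add: d_def)
    have "cmod (d + c) = Suc n * h" using h unfolding cd[symmetric] norm_of_real by simp
    then show "hnorm H ((d + c) *\<^sub>C ?v) \<le> Suc n * h * (h * hnorm H (L (L x)))"
      using J_diff_le[OF x(2)] h x by (simp add: norm_scale)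
  qed (use x in auto)
  also have "\<dots> \<le> (Suc n * h)\<^sup>2 * hnorm H (L (L x))"
  proof -
    have "(real n * h)\<^sup>2 + Suc n * h * h \<le> (Suc n * h)\<^sup>2"
      using h by (simp add: power2_eq_square algebra_simps)
    from mult_right_mono[OF this, of "hnorm H (L (L x))"] show ?thesis
      using x by (simp add: distrib_right mult.assoc del: of_nat_Suc)
  qed
  finally show ?case .
qed (use x in simp)

end

end

section \<open>Convergence of the Euler scheme and the semigroup it defines\<close>

context mdissipative
begin

text \<open>Density is a consequence of the range condition: an orthogonal vector has the form z - L
  z with \<open>z\<close> in \<open>Dm\<close>, and testing against \<open>z\<close> gives |z|^2
  \<le> 0 by dissipativity.\<close>

lemma dense_Dm: "dense_in H Dm"
proof (rule dense_in_if_orthogonal_trivial[OF sub])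
  fix r assume r: "r \<in> hcarrier H" "\<And>s. s \<in> Dm \<Longrightarrow> hinner H r s = 0"
  let ?z = "J 1 r"
  have z: "?z \<in> Dm" "?z - L ?z = r" using J_eq[of 1 r] r by auto
  have "0 = Re (hinner H (?z - L ?z) ?z)" using r(2)[OF z(1)] z(2) by simp
  also have "\<dots> = (hnorm H ?z)\<^sup>2 - Re (hinner H (L ?z) ?z)" using z(1) by (simp add: inner_simps norm_sq)
  finally have "(hnorm H ?z)\<^sup>2 \<le> 0" using diss[OF z(1)] by simp
  then have "?z = 0" using z(1) norm_eq_0[of ?z] by simp
  then show "r = 0" using z(2) L_linear(2)[of 0 0] by simp
qed

text \<open>The second-order estimates need \<open>L y\<close> in \<open>Dm\<close>. If
  \<open>v\<close> in \<open>Dm\<close> is close to d - L d, then \<open>J 1 v\<close> is close to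
  \<open>d\<close>, and \<open>L (J 1 v) = J 1 v - v\<close> lies in \<open>Dm\<close>
  again.\<close>

lemma dense_square_domain:
  assumes "x \<in> hcarrier H" "e > 0"
  obtains y where "y \<in> Dm" "L y \<in> Dm" "hnorm H (x - y) < e"
proof -
  obtain d where d: "d \<in> Dm" "hnorm H (x - d) < e / 2"
    using dense_Dm assms half_gt_zero[OF assms(2)] unfolding dense_in_iff by blast
  let ?w = "d - L d"
  obtain v where v: "v \<in> Dm" "hnorm H (?w - v) < e / 2"
  proof -
    have "?w \<in> hcarrier H" using d(1) by simp
    then show ?thesis using that dense_Dm half_gt_zero[OF assms(2)] unfolding dense_in_iff by blast
  qed
  have w: "J 1 ?w = d" using d(1) by (intro J_eqI) auto
  have Lv: "L (J 1 v) = J 1 v - v" using J_eq[of 1 v] v(1) by (simp add: algebra_simps)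
  have "hnorm H (d - J 1 v) \<le> hnorm H (?w - v)"
    using J_norm_le[of 1 "?w - v"] v(1) d(1) clinear_on_diff[OF csubspace_carrier J_linear, of 1 ?w v]
    by (simp add: w)
  then have "hnorm H (x - J 1 v) < e"
    using norm_triangle_via[of x d "J 1 v"] d v assms(1) by simp
  then show ?thesis using that[of "J 1 v"] v(1) Lv by simp
qed

text \<open>One step of length \<open>h\<close> and two of length \<open>h / 2\<close> both agree
  with the Taylor polynomial up to second order. These local errors accumulate additively because
  \<open>J h\<close> contracts, and they stay uniform because |L L y| does not grow along the
  iteration.\<close>

lemma pow_J_halving:
  assumes h: "h > 0" and x: "x \<in> Dm" "L x \<in> Dm"
  shows "hnorm H ((J h ^^ n) x - (J (h / 2) ^^ (2 * n)) x) \<le> real n * (2 * h\<^sup>2 * hnorm H (L (L x)))"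
proof (induction n)
  case (Suc n)
  let ?y = "(J (h / 2) ^^ (2 * n)) x"
  have h2: "h / 2 > 0" using h by simp
  have y: "?y \<in> Dm" "L ?y \<in> Dm" using pow_J_L[OF h2] x by auto
  have LLy: "hnorm H (L (L ?y)) \<le> hnorm H (L (L x))"
    using pow_J_L[OF h2] pow_J_norm_le[OF h2] x by simp
  have a: "hnorm H (J h ?y - ?y - complex_of_real h *\<^sub>C L ?y) \<le> h\<^sup>2 * hnorm H (L (L ?y))"
    using pow_J_second_order[OF h y, of 1] by simp
  \<comment> \<open>Two half steps cover the same time \<open>h\<close>, so the bound is again a
    multiple of h^2.\<close>
  have b: "hnorm H ((J (h / 2) ^^ 2) ?y - ?y - complex_of_real h *\<^sub>C L ?y) \<le> h\<^sup>2 * hnorm H (L (L ?y))"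
    using pow_J_second_order[OF h2 y, of 2] by (simp del: of_real_divide)
  have mem: "?y \<in> hcarrier H" "(J (h / 2) ^^ 2) ?y \<in> hcarrier H" "J h ?y \<in> hcarrier H" "(J h ^^ n) x \<in> hcarrier H"
    using y h h2 x by (auto simp del: funpow.simps)
  have "hnorm H (J h ?y - (J (h / 2) ^^ 2) ?y) =
      hnorm H ((J h ?y - ?y - complex_of_real h *\<^sub>C L ?y) - ((J (h / 2) ^^ 2) ?y - ?y - complex_of_real h *\<^sub>C L ?y))"
    by simp
  also have "\<dots> \<le> h\<^sup>2 * hnorm H (L (L ?y)) + h\<^sup>2 * hnorm H (L (L ?y))"
    by (rule order_trans[OF norm_triangle_diff add_mono[OF a b]]) (use mem y in auto)
  also have "\<dots> \<le> 2 * h\<^sup>2 * hnorm H (L (L x))"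
    using mult_left_mono[OF LLy, of "h\<^sup>2"] by simp
  finally have *: "hnorm H (J h ?y - (J (h / 2) ^^ 2) ?y) \<le> 2 * h\<^sup>2 * hnorm H (L (L x))" .
  have "(J (h / 2) ^^ (2 * Suc n)) x = (J (h / 2) ^^ 2) ?y"
    using funpow_add[of 2 "2 * n" "J (h / 2)"] by simp
  then have "(J h ^^ Suc n) x - (J (h / 2) ^^ (2 * Suc n)) x
      = J h ((J h ^^ n) x - ?y) + (J h ?y - (J (h / 2) ^^ 2) ?y)"
    using mem clinear_on_diff[OF csubspace_carrier J_linear[OF h], of "(J h ^^ n) x" ?y] by simp
  then have "hnorm H ((J h ^^ Suc n) x - (J (h / 2) ^^ (2 * Suc n)) x)
      \<le> hnorm H ((J h ^^ n) x - ?y) + 2 * h\<^sup>2 * hnorm H (L (L x))"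
    using norm_triangle[of "J h ((J h ^^ n) x - ?y)" "J h ?y - (J (h / 2) ^^ 2) ?y"] *
      J_norm_le[OF h, of "(J h ^^ n) x - ?y"] mem h by simp
  then show ?case using Suc by (simp add: algebra_simps)
qed (use x in simp)

text \<open>The Euler scheme with step \<open>1 / 2 ^ j\<close>, run up to the last grid point not
  beyond \<open>t\<close>. For negative \<open>t\<close> the \<open>nat\<close> gives zero
  steps.\<close>

definition E :: "nat \<Rightarrow> real \<Rightarrow> 'a \<Rightarrow> 'a" where
  "E j t = (J (1 / 2 ^ j) ^^ nat \<lfloor>t * 2 ^ j\<rfloor>)"

lemma dyadic_pos: "1 / 2 ^ j > (0::real)" by simp

lemma E_mem [simp]: "x \<in> hcarrier H \<Longrightarrow> E j t x \<in> hcarrier H"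
  and E_norm_le: "x \<in> hcarrier H \<Longrightarrow> hnorm H (E j t x) \<le> hnorm H x"
  and E_add: "x \<in> hcarrier H \<Longrightarrow> y \<in> hcarrier H \<Longrightarrow> E j t (x + y) = E j t x + E j t y"
  and E_diff: "x \<in> hcarrier H \<Longrightarrow> y \<in> hcarrier H \<Longrightarrow> E j t (x - y) = E j t x - E j t y"
  and E_scale: "x \<in> hcarrier H \<Longrightarrow> E j t (c *\<^sub>C x) = c *\<^sub>C E j t x"
  unfolding E_def
  by (simp_all only: pow_J_mem[OF dyadic_pos] pow_J_norm_le[OF dyadic_pos] pow_J_add[OF dyadic_pos]
      pow_J_diff[OF dyadic_pos] pow_J_scale[OF dyadic_pos])

lemma floor_dyadic_le: "t \<ge> 0 \<Longrightarrow> real (nat \<lfloor>t * 2 ^ j\<rfloor>) * (1 / 2 ^ j) \<le> t"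
  by (simp add: divide_le_eq)

text \<open>The first term is the accumulated halving error over at most \<open>t / h\<close> steps.
  The second pays for the one half step by which the finer grid may come closer to
  \<open>t\<close>.\<close>

lemma E_step:
  assumes x: "x \<in> Dm" "L x \<in> Dm" and t: "t \<ge> 0"
  shows "hnorm H (E (Suc j) t x - E j t x) \<le> (2 * t * hnorm H (L (L x)) + hnorm H (L x)) / 2 ^ j"
proof -
  define h :: real where "h = 1 / 2 ^ j"
  have h: "h > 0" "h / 2 > 0" "1 / 2 ^ Suc j = h / 2" by (simp_all add: h_def)
  define m where "m = nat \<lfloor>t * 2 ^ j\<rfloor>"
  define m' where "m' = nat \<lfloor>t * 2 ^ Suc j\<rfloor>"
  have mh: "real m * h \<le> t" using floor_dyadic_le[OF t] by (simp add: m_def h_def)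
  \<comment> \<open>Doubling a real number doubles its floor up to an additional 1.\<close>
  have "2 * \<lfloor>t * 2 ^ j\<rfloor> \<le> \<lfloor>t * 2 ^ Suc j\<rfloor>" "\<lfloor>t * 2 ^ Suc j\<rfloor> \<le> 2 * \<lfloor>t * 2 ^ j\<rfloor> + 1"
    by (simp_all add: le_floor_iff floor_le_iff) linarith+
  moreover have "\<lfloor>t * 2 ^ j\<rfloor> \<ge> 0" using t by simp
  ultimately have m': "2 * m \<le> m'" "m' - 2 * m \<le> 1" by (auto simp: m_def m'_def)
  have mem: "(J (h/2) ^^ k) x \<in> hcarrier H" "(J h ^^ k) x \<in> hcarrier H" for k
    using h x by simp_all
  have "hnorm H ((J (h/2) ^^ m') x - (J h ^^ m) x) \<le>
      hnorm H ((J (h/2) ^^ m') x - (J (h/2) ^^ (2 * m)) x) + hnorm H ((J (h/2) ^^ (2 * m)) x - (J h ^^ m) x)"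
    by (intro norm_triangle_via mem)
  also have "\<dots> \<le> h * hnorm H (L x) + 2 * t * h * hnorm H (L (L x))"
  proof (rule add_mono)
    have "real (m' - 2 * m) * (h / 2) * hnorm H (L x) \<le> h * hnorm H (L x)"
      using m'(2) h(1) x by (intro mult_right_mono) (auto simp: mult_le_cancel_right field_simps)
    then show "hnorm H ((J (h/2) ^^ m') x - (J (h/2) ^^ (2 * m)) x) \<le> h * hnorm H (L x)"
      using pow_J_diff_le'[OF h(2) x(1) m'(1)] by linarith
    have "real m * (2 * h\<^sup>2 * hnorm H (L (L x))) = (real m * h) * (2 * h * hnorm H (L (L x)))"
      by (simp add: power2_eq_square)
    also have "\<dots> \<le> t * (2 * h * hnorm H (L (L x)))"
      using mh h(1) x by (intro mult_right_mono) auto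
    finally show "hnorm H ((J (h/2) ^^ (2 * m)) x - (J h ^^ m) x) \<le> 2 * t * h * hnorm H (L (L x))"
      using pow_J_halving[OF h(1) x, of m] norm_minus_commute[OF mem(2) mem(1), of m "2 * m"]
      by (simp add: mult.assoc mult.left_commute)
  qed
  finally show ?thesis
    using h(3) by (simp add: E_def m_def m'_def h_def add_divide_distrib mult.commute add.commute)
qed

text \<open>On the domain of the square the geometric bound gives a Cauchy sequence; since all
  \<open>E j t\<close> are contractions, density carries this to every vector.\<close>

lemma E_convergent:
  assumes x: "x \<in> hcarrier H" and t: "t \<ge> 0"
  shows "\<exists>l. hlim H (\<lambda>j. E j t x) sequentially l"
proof (rule complete)
  fix e :: real assume e: "e > 0"
  then have e3: "e / 3 > 0" by simp
  obtain y where y: "y \<in> Dm" "L y \<in> Dm" "hnorm H (x - y) < e / 3"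
    using dense_square_domain[OF x e3] .
  obtain N where N: "\<And>m n. m \<ge> N \<Longrightarrow> n \<ge> N \<Longrightarrow> hnorm H (E m t y - E n t y) < e / 3"
    using Cauchy_of_geometric[OF _ E_step[OF y(1,2) t] e3] y(1) by auto
  have "hnorm H (E m t x - E n t x) < e" if "m \<ge> N" "n \<ge> N" for m n
  proof -
    have "E m t x - E n t x = E m t (x - y) + ((E m t y - E n t y) + E n t (y - x))"
      using x y(1) by (simp add: E_diff)
    also have "hnorm H \<dots> \<le> hnorm H (x - y) + (hnorm H (E m t y - E n t y) + hnorm H (y - x))"
      using x y(1) by (intro order_trans[OF norm_triangle] add_mono E_norm_le order_refl) auto
    also have "\<dots> < e"
      using N[OF that] y(3) norm_minus_commute[of x y] x y(1) by simp
    finally show ?thesis .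
  qed
  then show "\<exists>N. \<forall>m\<ge>N. \<forall>n\<ge>N. hnorm H (E m t x - E n t x) < e" by blast
qed (use x in simp)

definition T :: "real \<Rightarrow> 'a \<Rightarrow> 'a" where
  "T t x = (SOME l. hlim H (\<lambda>j. E j t x) sequentially l)"

lemma T_lim: "x \<in> hcarrier H \<Longrightarrow> t \<ge> 0 \<Longrightarrow> hlim H (\<lambda>j. E j t x) sequentially (T t x)"
  unfolding T_def by (rule someI_ex) (rule E_convergent)

lemma T_eqI: "x \<in> hcarrier H \<Longrightarrow> t \<ge> 0 \<Longrightarrow> hlim H (\<lambda>j. E j t x) sequentially l \<Longrightarrow> T t x = l"
  by (rule hlim_unique[OF T_lim]) auto

lemma T_mem [simp]: "x \<in> hcarrier H \<Longrightarrow> t \<ge> 0 \<Longrightarrow> T t x \<in> hcarrier H"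
  by (rule hlim_mem[OF T_lim])

lemma T_add: "x \<in> hcarrier H \<Longrightarrow> y \<in> hcarrier H \<Longrightarrow> t \<ge> 0 \<Longrightarrow> T t (x + y) = T t x + T t y"
  using hlim_add[OF T_lim T_lim, of x t y t] by (intro T_eqI) (auto simp: E_add)

lemma T_scale: "x \<in> hcarrier H \<Longrightarrow> t \<ge> 0 \<Longrightarrow> T t (c *\<^sub>C x) = c *\<^sub>C T t x"
  using hlim_scale[OF T_lim, of x t c] by (intro T_eqI) (auto simp: E_scale)

lemma T_linear: "t \<ge> 0 \<Longrightarrow> clinear_on (hcarrier H) (T t)"
  by (simp add: clinear_on_def T_add T_scale)

lemma T_diff: "x \<in> hcarrier H \<Longrightarrow> y \<in> hcarrier H \<Longrightarrow> t \<ge> 0 \<Longrightarrow> T t (x - y) = T t x - T t y"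
  by (rule clinear_on_diff[OF csubspace_carrier T_linear])

lemma T_norm_le: "x \<in> hcarrier H \<Longrightarrow> t \<ge> 0 \<Longrightarrow> hnorm H (T t x) \<le> hnorm H x"
  using hlim_norm_diff_le[OF T_lim, of x t 0 "hnorm H x"] by (simp add: E_norm_le)

lemma E_diff_le:
  assumes "x \<in> Dm" "t \<ge> 0"
  shows "hnorm H (E j t x - x) \<le> t * hnorm H (L x)"
proof -
  have "hnorm H (E j t x - x) \<le> (real (nat \<lfloor>t * 2 ^ j\<rfloor>) * (1 / 2 ^ j)) * hnorm H (L x)"
    unfolding E_def by (rule pow_J_diff_le[OF dyadic_pos assms(1)])
  also have "\<dots> \<le> t * hnorm H (L x)"
    using floor_dyadic_le[OF assms(2)] assms(1) by (intro mult_right_mono) auto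
  finally show ?thesis .
qed

lemma T_diff_le: "x \<in> Dm \<Longrightarrow> t \<ge> 0 \<Longrightarrow> hnorm H (T t x - x) \<le> t * hnorm H (L x)"
  using hlim_norm_diff_le[OF T_lim, of x t x "t * hnorm H (L x)"] E_diff_le by simp

lemma T_second_order:
  assumes x: "x \<in> Dm" "L x \<in> Dm" and t: "t \<ge> 0"
  shows "hnorm H (T t x - x - complex_of_real t *\<^sub>C L x) \<le> t\<^sup>2 * hnorm H (L (L x))"
proof -
  \<comment> \<open>The time actually covered by the dyadic steps; it falls short of
    \<open>t\<close> by at most 2^-j.\<close>
  let ?s = "\<lambda>j. real (nat \<lfloor>t * 2 ^ j\<rfloor>) * (1 / 2 ^ j)"
  have s: "0 \<le> ?s j" "?s j \<le> t" "t - ?s j \<le> (1 / 2) ^ j" for j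
  proof -
    show "0 \<le> ?s j" by simp
    show "?s j \<le> t" by (rule floor_dyadic_le[OF t])
    have "t * 2 ^ j \<le> real (nat \<lfloor>t * 2 ^ j\<rfloor>) + 1" using t by linarith
    then have "t * 2 ^ j / 2 ^ j \<le> (real (nat \<lfloor>t * 2 ^ j\<rfloor>) + 1) / 2 ^ j" by (rule divide_right_mono) simp
    then show "t - ?s j \<le> (1 / 2) ^ j" by (simp add: add_divide_distrib power_one_over)
  qed
  have lim: "?s \<longlonglongrightarrow> t"
  proof (rule LIM_zero_cancel, rule Lim_null_comparison)
    have "norm (?s j - t) \<le> (1 / 2) ^ j" for j
      using s(2,3)[of j] by (simp add: abs_minus_commute)
    then show "\<forall>\<^sub>F j in sequentially. norm (?s j - t) \<le> (1 / 2) ^ j" by simp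
  qed (simp add: LIMSEQ_power_zero)
  have sL: "hlim H (\<lambda>j. complex_of_real (?s j) *\<^sub>C L x) sequentially (complex_of_real t *\<^sub>C L x)"
  proof (rule hlimI)
    show "(\<lambda>j. \<bar>?s j - t\<bar> * hnorm H (L x)) \<longlonglongrightarrow> 0"
      using tendsto_mult_left_zero[OF tendsto_rabs_zero[OF LIM_zero[OF lim]]] .
    have norm_eq: "hnorm H (complex_of_real p *\<^sub>C L x - complex_of_real q *\<^sub>C L x) = \<bar>p - q\<bar> * hnorm H (L x)" for p q
    proof -
      have "complex_of_real p *\<^sub>C L x - complex_of_real q *\<^sub>C L x = complex_of_real (p - q) *\<^sub>C L x"
        by (simp add: cvec.scale_left_diff_distrib)
      then show ?thesis using norm_scale[of "L x" "complex_of_real (p - q)"] x by (simp del: of_real_diff)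
    qed
    show "\<forall>\<^sub>F j in sequentially. complex_of_real (?s j) *\<^sub>C L x \<in> hcarrier H \<and>
        hnorm H (complex_of_real (?s j) *\<^sub>C L x - complex_of_real t *\<^sub>C L x) \<le> \<bar>?s j - t\<bar> * hnorm H (L x)"
      by (intro always_eventually allI conjI eq_refl[OF norm_eq] scale_mem L_mem x)
  qed (use x in simp)
  have "(\<lambda>j. hnorm H (E j t x - x - complex_of_real (?s j) *\<^sub>C L x)) \<longlonglongrightarrow>
      hnorm H (T t x - x - complex_of_real t *\<^sub>C L x)"
    using x t by (intro hlim_norm hlim_diff hlim_const T_lim sL) auto
  moreover have "hnorm H (E j t x - x - complex_of_real (?s j) *\<^sub>C L x) \<le> t\<^sup>2 * hnorm H (L (L x))" for j
  proof -
    have "hnorm H (E j t x - x - complex_of_real (?s j) *\<^sub>C L x) \<le> (?s j)\<^sup>2 * hnorm H (L (L x))"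
      unfolding E_def by (rule pow_J_second_order[OF dyadic_pos x])
    also have "\<dots> \<le> t\<^sup>2 * hnorm H (L (L x))"
      using s(1,2)[of j] x by (intro mult_right_mono power_mono) auto
    finally show ?thesis .
  qed
  ultimately show ?thesis by (intro LIMSEQ_le_const2) auto
qed

lemma T_zero: "x \<in> hcarrier H \<Longrightarrow> T 0 x = x"
  by (rule T_eqI) (auto simp: E_def hlim_const)

text \<open>On \<open>Dm\<close> the discrete schemes satisfy the semigroup law up to one step of
  the grid, an error that vanishes in the limit.\<close>

lemma T_semigroup:
  assumes t: "t \<ge> 0" and s: "s \<ge> 0" and x: "x \<in> hcarrier H"
  shows "T (t + s) x = T t (T s x)"
proof -
  have *: "T (t + s) x = T t (T s x)" if x: "x \<in> Dm" for x
  proof (rule T_eqI)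
    show "hlim H (\<lambda>j. E j (t + s) x) sequentially (T t (T s x))"
    proof (rule hlimI)
      let ?g = "\<lambda>j. (1 / 2) ^ j * hnorm H (L x) + (hnorm H (E j s x - T s x) + hnorm H (E j t (T s x) - T t (T s x)))"
      have "?g \<longlonglongrightarrow> 0 * hnorm H (L x) + (0 + 0)"
        using T_lim[of x s] T_lim[of "T s x" t] x s t
        by (intro tendsto_intros LIMSEQ_power_zero) (auto simp: hlim_def)
      then show "?g \<longlonglongrightarrow> 0" by simp
      have "hnorm H (E j (t + s) x - T t (T s x)) \<le> ?g j" for j
      proof -
        define m where "m = nat \<lfloor>t * 2 ^ j\<rfloor>"
        define n where "n = nat \<lfloor>s * 2 ^ j\<rfloor>"
        define k where "k = nat \<lfloor>(t + s) * 2 ^ j\<rfloor>"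
        \<comment> \<open>Rounding \<open>t\<close> and \<open>s\<close> down separately loses at
          most one step compared with rounding their sum.\<close>
        have "\<lfloor>t * 2 ^ j\<rfloor> + \<lfloor>s * 2 ^ j\<rfloor> \<le> \<lfloor>(t + s) * 2 ^ j\<rfloor>" "\<lfloor>(t + s) * 2 ^ j\<rfloor> \<le> \<lfloor>t * 2 ^ j\<rfloor> + \<lfloor>s * 2 ^ j\<rfloor> + 1"
          by (simp_all add: le_floor_iff floor_le_iff distrib_right) linarith+
        moreover have "\<lfloor>t * 2 ^ j\<rfloor> \<ge> 0" "\<lfloor>s * 2 ^ j\<rfloor> \<ge> 0" using t s by auto
        ultimately have k: "m + n \<le> k" "k - (m + n) \<le> 1" unfolding m_def n_def k_def by linarith+
        have EE: "E j t (E j s x) = (J (1 / 2 ^ j) ^^ (m + n)) x"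
          by (simp add: E_def m_def n_def funpow_add)
        have "hnorm H (E j (t + s) x - E j t (E j s x)) \<le> real (k - (m + n)) * (1 / 2 ^ j) * hnorm H (L x)"
          using pow_J_diff_le'[OF dyadic_pos x k(1), of j] unfolding EE by (simp add: E_def k_def)
        also have "\<dots> \<le> (1 / 2) ^ j * hnorm H (L x)"
          using k(2) x by (intro mult_right_mono) (auto simp: power_one_over mult_le_cancel_right field_simps)
        finally have 1: "hnorm H (E j (t + s) x - E j t (E j s x)) \<le> (1 / 2) ^ j * hnorm H (L x)" .
        have 2: "hnorm H (E j t (E j s x) - E j t (T s x)) \<le> hnorm H (E j s x - T s x)"
          using E_norm_le[of "E j s x - T s x" j t] x s by (simp add: E_diff)
        have "hnorm H (E j (t + s) x - T t (T s x)) \<le> hnorm H (E j (t + s) x - E j t (E j s x)) +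
            (hnorm H (E j t (E j s x) - E j t (T s x)) + hnorm H (E j t (T s x) - T t (T s x)))"
          using norm_triangle_via[of "E j (t + s) x" "E j t (E j s x)" "T t (T s x)"]
            norm_triangle_via[of "E j t (E j s x)" "E j t (T s x)" "T t (T s x)"] x s t by simp
        then show ?thesis using 1 2 by linarith
      qed
      then show "\<forall>\<^sub>F j in sequentially. E j (t + s) x \<in> hcarrier H \<and> hnorm H (E j (t + s) x - T t (T s x)) \<le> ?g j"
        using x by simp
    qed (use x t s in simp)
  qed (use x t s in auto)
  \<comment> \<open>The law extends from \<open>Dm\<close> to the whole space because both sides are
    contractive in \<open>x\<close>.\<close>
  have "hnorm H (T (t + s) x - T t (T s x)) = 0"
  proof (rule antisym)
    show "hnorm H (T (t + s) x - T t (T s x)) \<le> 0"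
    proof (rule field_le_epsilon)
      fix e :: real assume "e > 0"
      then obtain y where y: "y \<in> Dm" "hnorm H (x - y) < e / 2"
        using dense_Dm x half_gt_zero[of e] unfolding dense_in_iff by blast
      have "T (t + s) x - T t (T s x) = T (t + s) (x - y) - T t (T s (x - y))"
        using x y t s *[OF y(1)] by (simp add: T_diff)
      also have "hnorm H \<dots> \<le> hnorm H (x - y) + hnorm H (x - y)"
        using x y t s by (intro order_trans[OF norm_triangle_diff] add_mono T_norm_le
            order_trans[OF T_norm_le T_norm_le]) auto
      finally show "hnorm H (T (t + s) x - T t (T s x)) \<le> 0 + e" using y(2) by simp
    qed
  qed (use x t s in simp)
  then show ?thesis using norm_eq_0[of "T (t + s) x - T t (T s x)"] x t s by simp
qed

lemma T_continuous:
  assumes x: "x \<in> hcarrier H"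
  shows "hlim H (\<lambda>t. T t x) (at_right 0) x"
  unfolding hlim_def
proof (intro conjI tendstoI)
  fix e :: real assume "e > 0"
  then have e3: "e / 3 > 0" by simp
  then obtain y where y: "y \<in> Dm" "hnorm H (x - y) < e / 3"
    using dense_Dm x unfolding dense_in_iff by blast
  have "((\<lambda>t. t * hnorm H (L y)) \<longlongrightarrow> 0 * hnorm H (L y)) (at_right 0)" by (intro tendsto_intros)
  then have "\<forall>\<^sub>F t in at_right 0. t * hnorm H (L y) < e / 3"
    using e3 by (intro order_tendstoD) auto
  then show "\<forall>\<^sub>F t in at_right 0. dist (hnorm H (T t x - x)) 0 < e"
    using eventually_at_right_less[of 0]
  proof eventually_elim
    case (elim t)
    have "T t x - x = T t (x - y) + ((T t y - y) + (y - x))"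
      using x y elim by (simp add: T_diff)
    also have "hnorm H \<dots> \<le> hnorm H (x - y) + (t * hnorm H (L y) + hnorm H (y - x))"
      using x y elim by (intro order_trans[OF norm_triangle] add_mono T_norm_le T_diff_le) auto
    also have "\<dots> < e"
      using elim y norm_minus_commute[of x y] x by simp
    finally show ?case using x elim by simp
  qed
qed (use x in simp)

lemma c0_semigroup_T: "c0_semigroup H T"
  unfolding c0_semigroup_def bounded_op_def
  using T_linear T_zero T_semigroup T_continuous T_norm_le
  by (auto intro!: exI[of _ 1])

text \<open>\<open>T_second_order\<close> differentiates the orbit only for vectors in the domain of
  the square. Those vectors approximate \<open>x\<close> in graph norm: if \<open>v\<close> is close
  to x - L x, then \<open>y = J 1 v\<close> is close to \<open>x\<close> and \<open>L y\<close> to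
  \<open>L x\<close>.\<close>

lemma T_has_generator:
  assumes x: "x \<in> Dm"
  shows "hlim H (\<lambda>h. complex_of_real (1 / h) *\<^sub>C (T h x - x)) (at_right 0) (L x)"
  unfolding hlim_def
proof (intro conjI tendstoI)
  fix e :: real assume "e > 0"
  then have e3: "e / 3 > 0" by simp
  let ?w = "x - L x"
  \<comment> \<open>\<open>L (x - y)\<close> will be a difference of two vectors of norm below
    \<open>e / 6\<close>, hence the bound \<open>e / 3\<close> for it.\<close>
  obtain v where v: "v \<in> Dm" "hnorm H (?w - v) < e / 6"
    using dense_Dm x \<open>e > 0\<close> diff_mem[of x "L x"] unfolding dense_in_iff
    by (metis Dm_mem L_mem divide_pos_pos zero_less_numeral)
  define y where "y = J 1 v"
  have y: "y \<in> Dm" "L y = y - v" using J_eq[of 1 v] v(1) by (auto simp: y_def algebra_simps)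
  have w: "J 1 ?w = x" using x by (intro J_eqI) auto
  have "hnorm H (x - y) \<le> hnorm H (?w - v)"
    using J_norm_le[of 1 "?w - v"] v(1) x clinear_on_diff[OF csubspace_carrier J_linear, of 1 ?w v]
    by (simp add: w y_def)
  moreover have "L (x - y) = (x - y) - (?w - v)" using x y by (simp add: L_linear)
  ultimately have Lxy: "hnorm H (L (x - y)) < e / 3"
    using norm_triangle_diff[of "x - y" "?w - v"] x y v by simp
  have "((\<lambda>t. t * hnorm H (L (L y))) \<longlongrightarrow> 0 * hnorm H (L (L y))) (at_right 0)" by (intro tendsto_intros)
  then have "\<forall>\<^sub>F t in at_right 0. t * hnorm H (L (L y)) < e / 3"
    using e3 by (intro order_tendstoD) auto
  then show "\<forall>\<^sub>F t in at_right 0. dist (hnorm H (complex_of_real (1 / t) *\<^sub>C (T t x - x) - L x)) 0 < e"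
    using eventually_at_right_less[of 0]
  proof eventually_elim
    case (elim t)
    have Ly: "L y \<in> Dm" using y v by simp
    let ?c = "complex_of_real t"
    \<comment> \<open>The second-order remainder of \<open>y\<close> is below t e / 3, and the two
      terms in \<open>x - y\<close> are each bounded by t |L (x - y)|, together below 2 t e /
      3.\<close>
    have "T t x - x - ?c *\<^sub>C L x = (T t y - y - ?c *\<^sub>C L y) + ((T t (x - y) - (x - y)) - ?c *\<^sub>C L (x - y))"
      using x y elim by (simp add: T_diff L_linear cvec.scale_right_diff_distrib)
    also have "hnorm H \<dots> \<le> t\<^sup>2 * hnorm H (L (L y)) + (t * hnorm H (L (x - y)) + t * hnorm H (L (x - y)))"
    proof (rule order_trans[OF norm_triangle add_mono])
      show "hnorm H (T t y - y - ?c *\<^sub>C L y) \<le> t\<^sup>2 * hnorm H (L (L y))"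
        using T_second_order[OF y(1) Ly] elim by simp
      have "hnorm H (T t (x - y) - (x - y)) \<le> t * hnorm H (L (x - y))"
        using T_diff_le[of "x - y" t] x y elim by simp
      moreover have "hnorm H (?c *\<^sub>C L (x - y)) = t * hnorm H (L (x - y))"
        using x y elim by (simp add: norm_scale)
      ultimately show "hnorm H ((T t (x - y) - (x - y)) - ?c *\<^sub>C L (x - y)) \<le>
          t * hnorm H (L (x - y)) + t * hnorm H (L (x - y))"
        using norm_triangle_diff[of "T t (x - y) - (x - y)" "?c *\<^sub>C L (x - y)"] x y elim by simp
    qed (use x y(1) elim in auto)
    also have "\<dots> = t * (t * hnorm H (L (L y)) + 2 * hnorm H (L (x - y)))"
      by (simp add: power2_eq_square algebra_simps)
    also have "\<dots> < t * e"
      using elim Lxy by (intro mult_strict_left_mono) auto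
    finally have *: "hnorm H (T t x - x - ?c *\<^sub>C L x) < t * e" .
    have "complex_of_real (1 / t) *\<^sub>C (T t x - x) - L x = complex_of_real (1 / t) *\<^sub>C (T t x - x - ?c *\<^sub>C L x)"
      using elim by (simp add: cvec.scale_right_diff_distrib)
    then have "hnorm H (complex_of_real (1 / t) *\<^sub>C (T t x - x) - L x) = 1 / t * hnorm H (T t x - x - ?c *\<^sub>C L x)"
      using norm_scale[of "T t x - x - ?c *\<^sub>C L x" "complex_of_real (1 / t)"] x elim by (simp add: norm_divide)
    also have "\<dots> < e" using * elim by (simp add: pos_divide_less_eq mult.commute)
    finally show ?case using x elim by simp
  qed
qed (use x in simp)

text \<open>A generator extending \<open>L\<close> cannot be proper: \<open>1\<close> would be an eigenvalue of a dissipative operator.\<close>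

theorem generates_c0_T: "generates_c0 H Dm L"
  unfolding generates_c0_def
proof (intro exI[of _ T] conjI c0_semigroup_T ballI)
  let ?q = "\<lambda>x h. complex_of_real (1 / h) *\<^sub>C (T h x - x)"
  show "Dm = {x \<in> hcarrier H. \<exists>y. hlim H (?q x) (at_right 0) y}"
  proof (intro equalityI subsetI)
    fix x assume "x \<in> {x \<in> hcarrier H. \<exists>y. hlim H (?q x) (at_right 0) y}"
    then obtain g where x: "x \<in> hcarrier H" and g: "hlim H (?q x) (at_right 0) g" by blast
    have gH: "g \<in> hcarrier H" using hlim_mem[OF g] .
    \<comment> \<open>\<open>x'\<close> solves the resolvent equation with the right-hand side x - g
      that \<open>x\<close> satisfies for the generator; the difference \<open>v\<close> is
      therefore the eigenvector.\<close>
    define x' where "x' = J 1 (x - g)"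
    have x': "x' \<in> Dm" "x' - L x' = x - g" using J_eq[of 1 "x - g"] x gH by (auto simp: x'_def)
    define v where "v = x - x'"
    have v: "v \<in> hcarrier H" using x x' by (simp add: v_def)
    have ev: "\<forall>\<^sub>F h in at_right 0. z \<in> hcarrier H \<longrightarrow> ?q z h \<in> hcarrier H" for z
      using eventually_at_right_less[of 0] by eventually_elim simp
    have "hlim H (\<lambda>h. ?q x h - ?q x' h) (at_right 0) (g - L x')"
      using g T_has_generator[OF x'(1)] ev[of x] ev[of x'] x x' by (intro hlim_diff) auto
    moreover have "g - L x' = v" using x'(2) by (simp add: v_def algebra_simps)
    moreover have "\<forall>\<^sub>F h in at_right 0. ?q x h - ?q x' h = ?q v h"
      using eventually_at_right_less[of 0]
      by eventually_elim (use x x' in \<open>simp add: v_def T_diff cvec.scale_right_diff_distrib\<close>)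
    ultimately have lim: "hlim H (?q v) (at_right 0) v"
      using hlim_cong[of "\<lambda>h. ?q x h - ?q x' h" "?q v" "at_right 0" v] by simp
    have "((\<lambda>h. Re (hinner H (?q v h) v)) \<longlongrightarrow> Re (hinner H v v)) (at_right 0)"
      using lim ev[of v] v by (intro tendsto_Re hlim_inner_const) auto
    \<comment> \<open>Contractivity of \<open>T h\<close> makes its difference quotients
      dissipative, which contradicts the eigenvalue 1 unless \<open>v\<close> is 0.\<close>
    moreover have "\<forall>\<^sub>F h in at_right 0. Re (hinner H (?q v h) v) \<le> 0"
      using eventually_at_right_less[of 0]
    proof eventually_elim
      case (elim h)
      have "Re (hinner H (T h v) v) \<le> hnorm H v * hnorm H v"
        using v elim T_norm_le[of v h] by (intro order_trans[OF Re_inner_le] mult_right_mono) auto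
      then have "Re (hinner H (T h v - v) v) \<le> 0"
        using v elim by (simp add: inner_simps norm_sq[symmetric] power2_eq_square)
      then show ?case using v elim by (simp add: inner_scale_left divide_nonpos_pos)
    qed
    ultimately have "Re (hinner H v v) \<le> 0"
      by (intro tendsto_upperbound) auto
    then have "hnorm H v = 0" using v by (simp add: norm_sq[symmetric])
    then have "x = x'" using norm_eq_0[OF v] by (simp add: v_def)
    then show "x \<in> Dm" using x'(1) by simp
  qed (use T_has_generator in auto)
qed (rule T_has_generator)

lemma in_resolvent_1: "in_resolvent H Dm L 1"
proof -
  have inj: "inj_on (\<lambda>x. x - L x) Dm"
    using resolvent_inject[of _ _ 1] by (auto simp: inj_on_def)
  have inv: "the_inv_into Dm (\<lambda>x. x - L x) y = J 1 y" if "y \<in> hcarrier H" for y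
    using J_eq[of 1 y] that by (intro the_inv_into_f_eq[OF inj]) auto
  have "(\<lambda>x. x - L x) ` Dm = hcarrier H"
  proof (intro equalityI subsetI)
    fix y assume "y \<in> hcarrier H"
    then show "y \<in> (\<lambda>x. x - L x) ` Dm"
      using J_eq[of 1 y] by (intro image_eqI[of _ _ "J 1 y"]) auto
  qed auto
  then show ?thesis
    unfolding in_resolvent_def bij_betw_def bounded_op_def cvec.scale_one
    using inj J_norm_le[of 1] by (auto simp: inv clinear_on_def J_add J_scale intro!: exI[of _ 1])
qed

end

section \<open>Boundary nodes from boundary triples\<close>

lemma half_add: "(1/2::complex) *\<^sub>C x + (1/2) *\<^sub>C x = (x :: 'a::cvec)"
  by (simp flip: scaleC_add_left)

text \<open>The difference |f s|^2 - |f t|^2 is the real part of the products of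
  \<open>f s - f t\<close> with \<open>f s\<close> and with \<open>f t\<close>, so its quotient is a
  sum of convergent inner products.\<close>

lemma (in hilbert) has_derivative_norm_sq:
  assumes f: "hs_C0 H f" and d: "hs_has_deriv H f d t" and t: "t \<ge> 0"
  shows "((\<lambda>s. (hnorm H (f s))\<^sup>2) has_real_derivative 2 * Re (hinner H d (f t))) (at t within {0..})"
proof -
  let ?F = "at t within {0..}"
  let ?q = "\<lambda>s. complex_of_real (1 / (s - t)) *\<^sub>C (f s - f t)"
  have ft: "f t \<in> hcarrier H" and lim: "hlim H f ?F (f t)" using f t by (auto simp: hs_C0_def)
  have dq: "hlim H ?q ?F d" using d by (simp add: hs_has_deriv_def)
  have dH: "d \<in> hcarrier H" using hlim_mem[OF dq] .
  have ev: "\<forall>\<^sub>F s in ?F. s \<in> {0..} \<and> s \<noteq> t" by (auto simp: eventually_at_filter)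
  have mem: "\<forall>\<^sub>F s in ?F. f s \<in> hcarrier H" using ev by eventually_elim (use f in \<open>auto simp: hs_C0_def\<close>)
  then have memq: "\<forall>\<^sub>F s in ?F. ?q s \<in> hcarrier H" by eventually_elim (use ft in auto)
  have "((\<lambda>s. Re (hinner H (?q s) (f s)) + Re (hinner H (?q s) (f t))) \<longlongrightarrow>
      Re (hinner H d (f t)) + Re (hinner H d (f t))) ?F"
    using dq memq lim mem ft by (intro tendsto_add tendsto_Re hlim_inner hlim_const) auto
  moreover have "\<forall>\<^sub>F s in ?F. Re (hinner H (?q s) (f s)) + Re (hinner H (?q s) (f t)) =
      ((hnorm H (f s))\<^sup>2 - (hnorm H (f t))\<^sup>2) / (s - t)"
    using mem ev
  proof eventually_elim
    case (elim s)
    have "Re (hinner H (f s - f t) (f s)) + Re (hinner H (f s - f t) (f t)) = (hnorm H (f s))\<^sup>2 - (hnorm H (f t))\<^sup>2"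
      using elim ft Re_inner_commute[of "f s" "f t"] by (simp add: inner_simps norm_sq)
    moreover have "Re (hinner H (?q s) z) = Re (hinner H (f s - f t) z) / (s - t)" if "z \<in> hcarrier H" for z
      using elim ft that inner_scale_left[of "f s - f t" z "complex_of_real (1 / (s - t))"]
      by (simp flip: of_real_diff)
    ultimately show ?case using elim ft by (simp add: add_divide_distrib[symmetric])
  qed
  ultimately have "((\<lambda>s. ((hnorm H (f s))\<^sup>2 - (hnorm H (f t))\<^sup>2) / (s - t)) \<longlongrightarrow>
      Re (hinner H d (f t)) + Re (hinner H d (f t))) ?F"
    by (rule Lim_transform_eventually)
  then show ?thesis by (simp add: has_field_derivative_iff)
qed

locale boundary_triple = U: hilbert U + V: hilbert V
  for U :: "'u::cvec hspace" and V :: "'v::cvec hspace" +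
  fixes Z :: "'v set" and L :: "'v \<Rightarrow> 'v" and a b :: "'v \<Rightarrow> 'u"
  assumes Z: "csubspace Z" "Z \<subseteq> hcarrier V"
    and L_lin: "clinear_on Z L" and a_lin: "clinear_on Z a" and b_lin: "clinear_on Z b"
    and L_maps: "L ` Z \<subseteq> hcarrier V"
    and trace_range: "(\<lambda>z. (a z, b z)) ` Z = hcarrier U \<times> hcarrier U"
    and L_closed: "\<lbrakk>\<And>n. zs n \<in> Z; hlim V zs sequentially z; hlim V (\<lambda>n. L (zs n)) sequentially l\<rbrakk>
        \<Longrightarrow> z \<in> Z \<and> L z = l"
    and trace_weak: "\<lbrakk>\<And>n. zs n \<in> Z; z \<in> Z; hlim V zs sequentially z; hlim V (\<lambda>n. L (zs n)) sequentially (L z);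
          u \<in> hcarrier U\<rbrakk>
        \<Longrightarrow> (\<lambda>n. hinner U (a (zs n)) u) \<longlonglongrightarrow> hinner U (a z) u \<and>
            (\<lambda>n. hinner U (b (zs n)) u) \<longlonglongrightarrow> hinner U (b z) u"
    and green_le: "z \<in> Z \<Longrightarrow> Re (hinner V (L z) z) \<le> Re (hinner U (a z) (b z))"
    and adjoint: "\<lbrakk>r > 0; h \<in> hcarrier V;
          \<And>z. z \<in> Z \<Longrightarrow> a z = 0 \<Longrightarrow> b z = 0 \<Longrightarrow> hinner V (complex_of_real r *\<^sub>C z - L z) h = 0\<rbrakk>
        \<Longrightarrow> \<exists>a'\<in>hcarrier U. \<exists>b'\<in>hcarrier U.
              (\<forall>z\<in>Z. hinner V (complex_of_real r *\<^sub>C z - L z) h = - hinner U (a z) b' - hinner U (b z) a') \<and>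
              r * (hnorm V h)\<^sup>2 \<le> - Re (hinner U a' b')"
begin

lemma Z_mem [simp]: "z \<in> Z \<Longrightarrow> z \<in> hcarrier V"
  and L_mem [simp]: "z \<in> Z \<Longrightarrow> L z \<in> hcarrier V"
  and a_mem [simp]: "z \<in> Z \<Longrightarrow> a z \<in> hcarrier U"
  and b_mem [simp]: "z \<in> Z \<Longrightarrow> b z \<in> hcarrier U"
  using Z(2) L_maps trace_range by auto

lemma trace_surj:
  assumes "\<alpha> \<in> hcarrier U" "\<beta> \<in> hcarrier U"
  obtains z where "z \<in> Z" "a z = \<alpha>" "b z = \<beta>"
proof -
  have "(\<alpha>, \<beta>) \<in> (\<lambda>z. (a z, b z)) ` Z" using assms by (simp add: trace_range)
  then show ?thesis using that by auto
qed

lemmas L_linear = clinear_on_add[OF Z(1) L_lin] clinear_on_diff[OF Z(1) L_lin] clinear_on_scale[OF Z(1) L_lin]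

text \<open>Weak sequential continuity for the graph norm of \<open>L\<close>. The class is stable
  under sums, scalars and bounded operators, so it contains all input and output operators that
  occur.\<close>

definition weakly_cont :: "('v \<Rightarrow> 'u) \<Rightarrow> bool" where
  "weakly_cont f \<longleftrightarrow> clinear_on Z f \<and> f ` Z \<subseteq> hcarrier U \<and>
     (\<forall>zs z u. (\<forall>n. zs n \<in> Z) \<longrightarrow> z \<in> Z \<longrightarrow> hlim V zs sequentially z \<longrightarrow>
        hlim V (\<lambda>n. L (zs n)) sequentially (L z) \<longrightarrow> u \<in> hcarrier U \<longrightarrow>
        (\<lambda>n. hinner U (f (zs n)) u) \<longlonglongrightarrow> hinner U (f z) u)"

lemma weakly_cont_mem: "weakly_cont f \<Longrightarrow> z \<in> Z \<Longrightarrow> f z \<in> hcarrier U"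
  by (auto simp: weakly_cont_def)

lemma weakly_contD:
  assumes "weakly_cont f" "\<And>n. zs n \<in> Z" "z \<in> Z" "hlim V zs sequentially z"
    "hlim V (\<lambda>n. L (zs n)) sequentially (L z)" "u \<in> hcarrier U"
  shows "(\<lambda>n. hinner U (f (zs n)) u) \<longlonglongrightarrow> hinner U (f z) u"
  using assms unfolding weakly_cont_def by blast

lemma weakly_cont_trace: "weakly_cont a" "weakly_cont b"
  using trace_weak a_lin b_lin by (simp_all add: weakly_cont_def image_subset_iff)

lemma weakly_cont_add:
  assumes f: "weakly_cont f" and g: "weakly_cont g"
  shows "weakly_cont (\<lambda>z. f z + g z)"
  unfolding weakly_cont_def
proof (intro conjI allI impI)
  show "clinear_on Z (\<lambda>z. f z + g z)"
    using f g by (auto simp: weakly_cont_def clinear_on_def cvec.scale_right_distrib)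
  show "(\<lambda>z. f z + g z) ` Z \<subseteq> hcarrier U" using weakly_cont_mem f g by auto
next
  fix zs z u assume *: "\<forall>n. zs n \<in> Z" "z \<in> Z" "hlim V zs sequentially z"
    "hlim V (\<lambda>n. L (zs n)) sequentially (L z)" "u \<in> hcarrier U"
  then show "(\<lambda>n. hinner U (f (zs n) + g (zs n)) u) \<longlonglongrightarrow> hinner U (f z + g z) u"
    using tendsto_add[OF weakly_contD[OF f, of zs z u] weakly_contD[OF g, of zs z u]]
      weakly_cont_mem[OF f] weakly_cont_mem[OF g]
    by (simp add: U.inner_add_left)
qed

text \<open>A bounded operator is moved to the test vector by its adjoint.\<close>

lemma weakly_cont_compose:
  assumes f: "weakly_cont f" and P: "bounded_op U U P"
  shows "weakly_cont (\<lambda>z. P (f z))"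
  unfolding weakly_cont_def
proof (intro conjI allI impI)
  show "clinear_on Z (\<lambda>z. P (f z))"
    using f P by (auto simp: weakly_cont_def clinear_on_def bounded_op_def image_subset_iff)
  show "(\<lambda>z. P (f z)) ` Z \<subseteq> hcarrier U"
    using weakly_cont_mem[OF f] P by (auto simp: bounded_op_def)
next
  fix zs z u assume *: "\<forall>n. zs n \<in> Z" "z \<in> Z" "hlim V zs sequentially z"
    "hlim V (\<lambda>n. L (zs n)) sequentially (L z)" "u \<in> hcarrier U"
  obtain v where v: "v \<in> hcarrier U" "\<And>x. x \<in> hcarrier U \<Longrightarrow> hinner U (P x) u = hinner U x v"
    using adjoint_exists[OF U.hilbert_axioms U.hilbert_axioms P *(5)] by blast
  show "(\<lambda>n. hinner U (P (f (zs n))) u) \<longlonglongrightarrow> hinner U (P (f z)) u"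
    using weakly_contD[OF f, of zs z v] * v weakly_cont_mem[OF f] by simp
qed

lemma weakly_cont_scale: "weakly_cont f \<Longrightarrow> weakly_cont (\<lambda>z. c *\<^sub>C f z)"
  by (rule weakly_cont_compose)
    (auto simp: bounded_op_def clinear_on_def cvec.scale_right_distrib U.norm_scale mult.commute
      intro!: exI[of _ "cmod c"])

lemma weakly_cont_diff: "weakly_cont f \<Longrightarrow> weakly_cont g \<Longrightarrow> weakly_cont (\<lambda>z. f z - g z)"
  using weakly_cont_add[of f "\<lambda>z. (-1) *\<^sub>C g z"] weakly_cont_scale[of g "-1"] by simp

lemma closed_op_colligation:
  assumes G: "weakly_cont G" and K: "weakly_cont K"
  shows "closed_op V (prod_hs U (prod_hs V U)) Z (\<lambda>z. (G z, L z, K z))"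
proof -
  interpret VU: hilbert_pair V U ..
  interpret VU': hilbert "prod_hs V U" by (rule VU.hilbert_prod)
  interpret UVU: hilbert_pair U "prod_hs V U" ..
  \<comment> \<open>The strong limit is part of the hypothesis; weak continuity merely identifies it
    with the value at \<open>z\<close>.\<close>
  have strong: "f z = y" if f: "weakly_cont f" and zs: "\<And>n. zs n \<in> Z" "z \<in> Z" "hlim V zs sequentially z"
      "hlim V (\<lambda>n. L (zs n)) sequentially (L z)" and y: "hlim U (\<lambda>n. f (zs n)) sequentially y" for f zs z y
  proof (rule U.eq_if_inner_eq)
    fix u assume u: "u \<in> hcarrier U"
    show "hinner U (f z) u = hinner U y u"
      using weakly_contD[OF f zs u] U.hlim_inner_const[OF y _ u] weakly_cont_mem[OF f zs(1)]
      by (auto intro: LIMSEQ_unique)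
  qed (use U.hlim_mem[OF y] weakly_cont_mem[OF f zs(2)] in auto)
  have closed: "z \<in> Z \<and> (G z, L z, K z) = y"
    if zs: "\<And>n. zs n \<in> Z" "hlim V zs sequentially z"
      and y: "hlim (prod_hs U (prod_hs V U)) (\<lambda>n. (G (zs n), L (zs n), K (zs n))) sequentially y" for zs z y
  proof -
    have "hlim U (\<lambda>n. G (zs n)) sequentially (fst y)"
      "hlim V (\<lambda>n. L (zs n)) sequentially (fst (snd y))"
      "hlim U (\<lambda>n. K (zs n)) sequentially (snd (snd y))"
      using y zs(1) weakly_cont_mem[OF G] weakly_cont_mem[OF K]
      by (simp_all add: UVU.hlim_prod_iff VU.hlim_prod_iff)
    with L_closed[OF zs this(2)] strong[OF G zs(1) _ zs(2)] strong[OF K zs(1) _ zs(2)]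
    show ?thesis by (metis prod.collapse)
  qed
  have "clinear_on Z (\<lambda>z. (G z, L z, K z))"
    using G K L_lin by (auto simp: weakly_cont_def clinear_on_def scaleC_prod_def)
  moreover have "(\<lambda>z. (G z, L z, K z)) ` Z \<subseteq> hcarrier (prod_hs U (prod_hs V U))"
    using weakly_cont_mem[OF G] weakly_cont_mem[OF K] by auto
  ultimately show ?thesis
    unfolding closed_op_def using Z closed by blast
qed

section \<open>Boundary conditions given by contractions\<close>

definition bc :: "('u \<Rightarrow> 'u) \<Rightarrow> 'v set" where
  "bc P = {z \<in> Z. a z + b z = P (a z - b z)}"

lemma polarization:
  assumes "x \<in> hcarrier U" "y \<in> hcarrier U"
  shows "(hnorm U (x + y))\<^sup>2 - (hnorm U (x - y))\<^sup>2 = 4 * Re (hinner U x y)"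
  using assms by (simp add: U.norm_add_sq U.norm_diff_sq)

context
  fixes P
  assumes P: "bounded_op U U P" and P_contr: "\<And>x. x \<in> hcarrier U \<Longrightarrow> hnorm U (P x) \<le> hnorm U x"
begin

lemma P_mem [simp]: "x \<in> hcarrier U \<Longrightarrow> P x \<in> hcarrier U"
  using P by (auto simp: bounded_op_def)

lemma P_lin: "clinear_on (hcarrier U) P"
  using P by (simp add: bounded_op_def)

lemmas P_linear = clinear_on_add[OF U.csubspace_carrier P_lin] clinear_on_diff[OF U.csubspace_carrier P_lin]
  clinear_on_scale[OF U.csubspace_carrier P_lin]

lemma bc_dissipative:
  assumes "z \<in> bc P"
  shows "Re (hinner V (L z) z) \<le> 0"
proof -
  have z: "z \<in> Z" "a z + b z = P (a z - b z)" using assms by (auto simp: bc_def)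
  have "(hnorm U (a z + b z))\<^sup>2 \<le> (hnorm U (a z - b z))\<^sup>2"
    unfolding z(2) using P_contr[of "a z - b z"] z(1) by (intro power_mono) auto
  then have "Re (hinner U (a z) (b z)) \<le> 0"
    using polarization[OF a_mem[OF z(1)] b_mem[OF z(1)]] by linarith
  then show ?thesis using green_le[OF z(1)] by simp
qed

lemma weakly_cont_bc: "weakly_cont (\<lambda>z. a z + b z - P (a z - b z))"
  by (intro weakly_cont_diff[OF weakly_cont_add] weakly_cont_compose[OF weakly_cont_diff _] weakly_cont_trace P)

lemma bc_eq: "bc P = {z \<in> Z. a z + b z - P (a z - b z) = 0}"
  by (simp add: bc_def)

lemma csubspace_bc: "csubspace (bc P)"
  unfolding bc_eq using Z(1) weakly_cont_bc by (intro csubspace_kernel) (auto simp: weakly_cont_def)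

text \<open>A vector orthogonal to the range satisfies the adjoint boundary condition, whose traces have
  the sign opposite to the one required by the adjoint Green inequality.\<close>

lemma range_orthogonal_trivial:
  assumes r: "r > 0" and h: "h \<in> hcarrier V"
    and orth: "\<And>z. z \<in> bc P \<Longrightarrow> hinner V (complex_of_real r *\<^sub>C z - L z) h = 0"
  shows "h = 0"
proof -
  have "P 0 = 0" using clinear_on_zero[OF U.csubspace_carrier P_lin] .
  then have "hinner V (complex_of_real r *\<^sub>C z - L z) h = 0" if "z \<in> Z" "a z = 0" "b z = 0" for z
    using orth that by (simp add: bc_def)
  from adjoint[OF r h this] obtain a' b' where a': "a' \<in> hcarrier U" and b': "b' \<in> hcarrier U"
    and eq: "\<And>z. z \<in> Z \<Longrightarrow> hinner V (complex_of_real r *\<^sub>C z - L z) h = - hinner U (a z) b' - hinner U (b z) a'"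
    and le: "r * (hnorm V h)\<^sup>2 \<le> - Re (hinner U a' b')"
    by blast
  \<comment> \<open>With this \<open>e\<close> the orthogonality relation will become |e|^2 = (P e,
    a' + b'), whence the contraction yields |a' - b'| \<le> |a' + b'|.\<close>
  define e where "e = a' - b'"
  have e: "e \<in> hcarrier U" using a' b' by (simp add: e_def)
  \<comment> \<open>These traces solve a + b = P e and a - b = e, so \<open>z\<close> satisfies the
    boundary condition.\<close>
  obtain z where z: "z \<in> Z" "a z = (1/2) *\<^sub>C (P e + e)" "b z = (1/2) *\<^sub>C (P e - e)"
    using trace_surj[of "(1/2) *\<^sub>C (P e + e)" "(1/2) *\<^sub>C (P e - e)"] e by auto
  have "a z + b z = P e" "a z - b z = e"
    unfolding z(2,3) using half_add[of "P e"] half_add[of e]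
    by (simp_all add: cvec.scale_right_distrib cvec.scale_right_diff_distrib)
  then have "z \<in> bc P" using z(1) by (simp add: bc_def)
  then have "- hinner U (a z) b' - hinner U (b z) a' = 0" using orth eq z(1) by metis
  then have "hinner U (P e + e) b' + hinner U (P e - e) a' = 0"
    using e a' b' by (simp add: z U.inner_scale_left add_eq_0_iff)
  then have "hinner U (P e) (a' + b') = hinner U e e"
    using e a' b' by (simp add: U.inner_simps e_def[symmetric]) (simp add: e_def U.inner_simps algebra_simps)
  then have "(hnorm U e)\<^sup>2 = Re (hinner U (P e) (a' + b'))"
    using U.norm_sq[OF e] by simp
  also have "\<dots> \<le> hnorm U e * hnorm U (a' + b')"
    using e a' b' P_contr[OF e] by (intro order_trans[OF U.Re_inner_le] mult_right_mono) auto
  finally have "hnorm U e \<le> hnorm U (a' + b')"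
    using e a' b' by (cases "hnorm U e = 0") (auto simp: power2_eq_square less_le)
  then have "(hnorm U e)\<^sup>2 \<le> (hnorm U (a' + b'))\<^sup>2"
    using e by (intro power_mono) auto
  \<comment> \<open>By polarization the comparison of a' - b' with a' + b' fixes the sign of the
    boundary term, against the one in \<open>le\<close>.\<close>
  then have "Re (hinner U a' b') \<ge> 0" using polarization[OF a' b'] by (simp add: e_def)
  then have "r * (hnorm V h)\<^sup>2 \<le> 0" using le by simp
  then have "hnorm V h = 0" using r by (simp add: mult_le_0_iff)
  then show ?thesis using V.norm_eq_0[OF h] by simp
qed

text \<open>\<open>L\<close> is closed on \<open>Z\<close>, and the boundary condition survives the
  limit because the weak limit of zeros is zero.\<close>

lemma closed_op_bc: "closed_op V V (bc P) (\<lambda>z. complex_of_real r *\<^sub>C z - L z)"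
proof -
  let ?R = "\<lambda>z. complex_of_real r *\<^sub>C z - L z" and ?f = "\<lambda>z. a z + b z - P (a z - b z)"
  have sub: "bc P \<subseteq> Z" by (auto simp: bc_def)
  have lin: "clinear_on (bc P) ?R"
    using csubspaceD[OF Z(1)] sub
    by (simp add: clinear_on_def L_linear subset_iff cvec.scale_right_distrib cvec.scale_right_diff_distrib mult.commute)
  have "z \<in> bc P \<and> ?R z = l"
    if zs: "\<And>n. zs n \<in> bc P" and z: "hlim V zs sequentially z"
      and l: "hlim V (\<lambda>n. ?R (zs n)) sequentially l" for zs z l
  proof -
    have zsZ: "zs n \<in> Z" for n using zs sub by blast
    have "hlim V (\<lambda>n. complex_of_real r *\<^sub>C zs n - ?R (zs n)) sequentially (complex_of_real r *\<^sub>C z - l)"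
      by (rule V.hlim_diff[OF V.hlim_scale[OF z] l]) (use zsZ in auto)
    then have Lz: "hlim V (\<lambda>n. L (zs n)) sequentially (complex_of_real r *\<^sub>C z - l)" by simp
    have zZ: "z \<in> Z" and eq: "L z = complex_of_real r *\<^sub>C z - l"
      using L_closed[of zs, OF zsZ z Lz] by auto
    have "?f z = 0"
    proof (rule U.eq_if_inner_eq)
      fix u assume u: "u \<in> hcarrier U"
      have "(\<lambda>n. hinner U (?f (zs n)) u) \<longlonglongrightarrow> hinner U (?f z) u"
        using weakly_contD[OF weakly_cont_bc zsZ zZ z _ u] Lz eq by simp
      moreover have "?f (zs n) = 0" for n using zs[of n] by (simp add: bc_def)
      ultimately have "(\<lambda>n. 0) \<longlonglongrightarrow> hinner U (?f z) u" using u by simp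
      then show "hinner U (?f z) u = hinner U 0 u" using u by (simp add: LIMSEQ_const_iff)
    qed (use weakly_cont_mem[OF weakly_cont_bc zZ] in auto)
    then show ?thesis using zZ eq by (simp add: bc_def)
  qed
  moreover have "?R ` bc P \<subseteq> hcarrier V" using sub by auto
  ultimately show ?thesis
    unfolding closed_op_def using csubspace_bc lin sub Z(2) by blast
qed

lemma mdissipative_bc: "mdissipative V (bc P) L"
proof
  have sub: "bc P \<subseteq> Z" by (auto simp: bc_def)
  show "bc P \<subseteq> hcarrier V" "L ` bc P \<subseteq> hcarrier V" using sub Z(2) L_maps by auto
  show "clinear_on (bc P) L" using L_lin sub unfolding clinear_on_def by blast
  fix r :: real and y assume r: "r > 0" and y: "y \<in> hcarrier V"
  let ?R = "\<lambda>z. complex_of_real r *\<^sub>C z - L z"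
  have "?R ` bc P = hcarrier V"
  proof (rule range_eq_carrier[OF V.hilbert_axioms V.hilbert_axioms closed_op_bc r])
    fix z assume z: "z \<in> bc P"
    then have zZ: "z \<in> Z" using sub by blast
    show "r * hnorm V z \<le> hnorm V (?R z)"
    proof (cases "hnorm V z = 0")
      case False
      have "r * (hnorm V z)\<^sup>2 \<le> Re (hinner V (?R z) z)"
        using bc_dissipative[OF z] zZ by (simp add: V.inner_simps V.norm_sq)
      also have "\<dots> \<le> hnorm V (?R z) * hnorm V z" using zZ by (intro V.Re_inner_le) auto
      finally show ?thesis using False zZ by (simp add: power2_eq_square less_le)
    qed (use zZ in simp)
  next
    fix h assume "h \<in> hcarrier V" "\<And>z. z \<in> bc P \<Longrightarrow> hinner V (?R z) h = 0"
    then show "h = 0" by (rule range_orthogonal_trivial[OF r])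
  qed
  with y have "y \<in> ?R ` bc P" by simp
  then show "\<exists>x\<in>bc P. ?R x = y" by blast
qed (use csubspace_bc bc_dissipative in auto)

text \<open>\<open>G\<close> enters only through its range, kernel and weak continuity, so the same
  result serves the node and, with the contraction 0, its Cayley transform.\<close>

lemma internally_well_posed_bc:
  assumes "weakly_cont G" "weakly_cont K" "G ` Z = hcarrier U" "kerG Z G = bc P"
  shows "internally_well_posed U V U Z G L K"
proof -
  interpret md: mdissipative V "bc P" L by (rule mdissipative_bc)
  show ?thesis
    unfolding internally_well_posed_def boundary_node_def assms(4)
    using closed_op_colligation[OF assms(1,2)] assms(3) md.dense_Dm md.in_resolvent_1 md.generates_c0_T
    by blast
qed

end

section \<open>The node of a contraction and its external Cayley transform\<close>

definition G_P :: "('u \<Rightarrow> 'u) \<Rightarrow> 'v \<Rightarrow> 'u" where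
  "G_P P = (\<lambda>z. (1/2) *\<^sub>C ((a z - P (a z)) + (b z + P (b z))))"

definition K_P :: "('u \<Rightarrow> 'u) \<Rightarrow> 'v \<Rightarrow> 'u" where
  "K_P P = (\<lambda>z. (1/2) *\<^sub>C ((a z + P (a z)) + (b z - P (b z))))"

context
  fixes P
  assumes P: "bounded_op U U P" and P_contr: "\<And>x. x \<in> hcarrier U \<Longrightarrow> hnorm U (P x) \<le> hnorm U x"
begin

lemma G_P_add_K_P: "z \<in> Z \<Longrightarrow> G_P P z + K_P P z = a z + b z"
  unfolding G_P_def K_P_def
  using half_add[of "a z"] half_add[of "b z"]
  by (simp add: cvec.scale_right_distrib cvec.scale_right_diff_distrib algebra_simps)

lemma G_P_diff_K_P: "z \<in> Z \<Longrightarrow> G_P P z - K_P P z = P (b z - a z)"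
  unfolding G_P_def K_P_def
  using half_add[of "P (a z)"] half_add[of "P (b z)"] P_linear(2)[OF P P_contr, of "b z" "a z"]
  by (simp add: cvec.scale_right_distrib cvec.scale_right_diff_distrib algebra_simps)

lemma weakly_cont_G_P: "weakly_cont (G_P P)" and weakly_cont_K_P: "weakly_cont (K_P P)"
  unfolding G_P_def K_P_def
  by (intro weakly_cont_scale weakly_cont_add weakly_cont_diff weakly_cont_trace
      weakly_cont_compose[OF weakly_cont_trace(1) P] weakly_cont_compose[OF weakly_cont_trace(2) P])+

lemma kerG_G_P: "kerG Z (G_P P) = bc P"
proof -
  have "G_P P z = 0 \<longleftrightarrow> a z + b z = P (a z - b z)" if z: "z \<in> Z" for z
  proof -
    have "G_P P z = 0 \<longleftrightarrow> (a z - P (a z)) + (b z + P (b z)) = 0"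
      by (simp add: G_P_def)
    also have "\<dots> \<longleftrightarrow> a z + b z = P (a z) - P (b z)"
      by (simp add: algebra_simps)
    finally show ?thesis using z P_linear(2)[OF P P_contr, of "a z" "b z"] by simp
  qed
  then show ?thesis by (auto simp: kerG_def bc_def)
qed

lemma G_P_surj: "G_P P ` Z = hcarrier U"
proof (intro equalityI subsetI)
  fix u assume u: "u \<in> hcarrier U"
  \<comment> \<open>For equal traces the two contributions of \<open>P\<close> cancel.\<close>
  obtain z where z: "z \<in> Z" "a z = u" "b z = u" using trace_surj[OF u u] .
  then have "G_P P z = u"
    using half_add[of u] by (simp add: G_P_def cvec.scale_right_distrib cvec.scale_right_diff_distrib)
  then show "u \<in> G_P P ` Z" using z(1) by blast
qed (use weakly_cont_mem[OF weakly_cont_G_P] in auto)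

theorem internally_well_posed_P: "internally_well_posed U V U Z (G_P P) L (K_P P)"
  by (rule internally_well_posed_bc[OF P P_contr weakly_cont_G_P weakly_cont_K_P G_P_surj kerG_G_P])

text \<open>With parameter \<open>1\<close> the external Cayley transform turns the input into a multiple of \<open>a + b\<close>,
  so its kernel is the boundary condition for the contraction \<open>0\<close>.\<close>

theorem impedance_passive_P: "impedance_passive U V Z (G_P P) L (K_P P)"
  unfolding impedance_passive_def
proof (intro exI[of _ 1] conjI)
  let ?G = "cayley_in 1 (G_P P) (K_P P)" and ?K = "cayley_out 1 (G_P P) (K_P P)"
  let ?s = "complex_of_real (1 / sqrt 2)"
  have G: "?G z = ?s *\<^sub>C (a z + b z)" and K: "?K z = ?s *\<^sub>C P (b z - a z)" if "z \<in> Z" for z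
    using G_P_add_K_P[OF that] G_P_diff_K_P[OF that] by (simp_all add: cayley_in_def cayley_out_def)
  have sq: "(cmod ?s)\<^sup>2 = 1 / 2" by (simp add: norm_divide power_divide)
  have P0: "bounded_op U U (\<lambda>_. 0)" "\<And>x. x \<in> hcarrier U \<Longrightarrow> hnorm U 0 \<le> hnorm U x"
    by (auto simp: bounded_op_def clinear_on_def intro!: exI[of _ 0])
  have "internally_well_posed U V U Z ?G L ?K"
  proof (rule internally_well_posed_bc[OF P0])
    show "weakly_cont ?G" "weakly_cont ?K"
      unfolding cayley_in_def cayley_out_def
      by (intro weakly_cont_scale weakly_cont_add weakly_cont_diff weakly_cont_G_P weakly_cont_K_P)+
    show "kerG Z ?G = bc (\<lambda>_. 0)"
      using G by (auto simp: kerG_def bc_def)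
    show "?G ` Z = hcarrier U"
    proof (intro equalityI subsetI)
      fix u assume u: "u \<in> hcarrier U"
      \<comment> \<open>The factor sqrt 2 undoes the normalization of the Cayley transform.\<close>
      obtain z where z: "z \<in> Z" "a z = complex_of_real (sqrt 2) *\<^sub>C u" "b z = 0"
        using trace_surj[of "complex_of_real (sqrt 2) *\<^sub>C u" 0] u by auto
      then have "?G z = u" using G[OF z(1)] by simp
      then show "u \<in> ?G ` Z" using z(1) by blast
    qed (use G in auto)
  qed
  moreover have "\<exists>d. ((\<lambda>s. (hnorm V (z s))\<^sup>2) has_real_derivative d) (at t within {0..}) \<and>
      d + (hnorm U (y t))\<^sup>2 \<le> (hnorm U (u t))\<^sup>2"
    if sol: "smooth_solution U V U Z ?G L ?K u z y" and t: "t \<ge> 0" for u z y t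
  proof (intro exI conjI)
    have zZ: "z t \<in> Z" and u: "u t = ?G (z t)" and y: "y t = ?K (z t)"
      and d: "hs_has_deriv V z (L (z t)) t" and C0: "hs_C0 V z"
      using sol t by (auto simp: smooth_solution_def hs_C0_def graph_hs_def hs_C1_def)
    show "((\<lambda>s. (hnorm V (z s))\<^sup>2) has_real_derivative 2 * Re (hinner V (L (z t)) (z t))) (at t within {0..})"
      by (rule V.has_derivative_norm_sq[OF C0 d t])
    let ?a = "a (z t)" and ?b = "b (z t)"
    have mem: "?a \<in> hcarrier U" "?b \<in> hcarrier U" using zZ by auto
    have "(hnorm U (y t))\<^sup>2 = (hnorm U (P (?b - ?a)))\<^sup>2 / 2"
      using U.norm_scale[of "P (?b - ?a)" ?s] P_mem[OF P P_contr, of "?b - ?a"] mem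
      by (simp add: y K[OF zZ] power_mult_distrib power_divide sq del: of_real_divide)
    also have "\<dots> \<le> (hnorm U (?b - ?a))\<^sup>2 / 2"
      using P_contr[of "?b - ?a"] P_mem[OF P P_contr, of "?b - ?a"] mem
      by (intro divide_right_mono power_mono) auto
    finally have "(hnorm U (y t))\<^sup>2 \<le> (hnorm U (?a - ?b))\<^sup>2 / 2"
      using U.norm_minus_commute[OF mem] by simp
    moreover have "(hnorm U (u t))\<^sup>2 = (hnorm U (?a + ?b))\<^sup>2 / 2"
      using U.norm_scale[of "?a + ?b" ?s] mem by (simp add: u G[OF zZ] power_mult_distrib power_divide sq del: of_real_divide)
    \<comment> \<open>By polarization |a + b|^2 / 2 - |a - b|^2 / 2 is twice the real part of (a,
      b), which is what \<open>green_le\<close> compares with the derivative of the energy.\<close>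
    ultimately show "2 * Re (hinner V (L (z t)) (z t)) + (hnorm U (y t))\<^sup>2 \<le> (hnorm U (u t))\<^sup>2"
      using polarization[OF mem] green_le[OF zZ] by simp
  qed
  ultimately show "scattering_passive U V U Z ?G L ?K"
    unfolding scattering_passive_def by blast
qed simp

end

end

section \<open>The energy space\<close>

locale uniformly_positive = X: hilbert X for X :: "'x::cvec hspace" +
  fixes M :: "'x \<Rightarrow> 'x"
  assumes M_bdd: "bounded_op X X M"
    and M_sa: "\<forall>x\<in>hcarrier X. \<forall>y\<in>hcarrier X. hinner X (M x) y = hinner X x (M y)"
    and M_pos: "\<exists>m>0. \<forall>x\<in>hcarrier X. Re (hinner X (M x) x) \<ge> m * (hnorm X x)\<^sup>2"
begin

lemma M_mem [simp]: "x \<in> hcarrier X \<Longrightarrow> M x \<in> hcarrier X"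
  using M_bdd by (auto simp: bounded_op_def)

lemma M_lin: "clinear_on (hcarrier X) M"
  using M_bdd by (simp add: bounded_op_def)

lemmas M_linear = clinear_on_add[OF X.csubspace_carrier M_lin] clinear_on_diff[OF X.csubspace_carrier M_lin]
  clinear_on_scale[OF X.csubspace_carrier M_lin]

lemma M_symmetric: "x \<in> hcarrier X \<Longrightarrow> y \<in> hcarrier X \<Longrightarrow> hinner X (M x) y = hinner X x (M y)"
  using M_sa by blast

lemma M_bounds:
  obtains m K where "m > 0" "K > 0" "\<And>x. x \<in> hcarrier X \<Longrightarrow> m * (hnorm X x)\<^sup>2 \<le> Re (hinner X (M x) x)"
    "\<And>x. x \<in> hcarrier X \<Longrightarrow> m * hnorm X x \<le> hnorm X (M x)"
    "\<And>x. x \<in> hcarrier X \<Longrightarrow> hnorm X (M x) \<le> K * hnorm X x"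
proof -
  obtain m where m: "m > 0" "\<And>x. x \<in> hcarrier X \<Longrightarrow> m * (hnorm X x)\<^sup>2 \<le> Re (hinner X (M x) x)"
    using M_pos by blast
  obtain K where K: "\<And>x. x \<in> hcarrier X \<Longrightarrow> hnorm X (M x) \<le> K * hnorm X x"
    using M_bdd by (auto simp: bounded_op_def)
  have 1: "m * hnorm X x \<le> hnorm X (M x)" if x: "x \<in> hcarrier X" for x
  proof (cases "hnorm X x = 0")
    case False
    have "m * (hnorm X x)\<^sup>2 \<le> hnorm X (M x) * hnorm X x"
      using m(2)[OF x] X.Re_inner_le[of "M x" x] x by simp
    then show ?thesis using False x by (simp add: power2_eq_square less_le)
  qed (use x in simp)
  \<comment> \<open>\<open>bounded_op\<close> admits any real bound; this one is positive.\<close>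
  have 2: "hnorm X (M x) \<le> (\<bar>K\<bar> + 1) * hnorm X x" if x: "x \<in> hcarrier X" for x
  proof -
    have "K \<le> \<bar>K\<bar> + 1" by linarith
    from mult_right_mono[OF this X.norm_ge_0[OF x]] show ?thesis using K[OF x] by linarith
  qed
  show ?thesis using that[of m "\<bar>K\<bar> + 1"] m 1 2 by (simp add: add_nonneg_pos)
qed

lemma closed_op_M: "closed_op X X (hcarrier X) M"
proof -
  obtain m K where K: "\<And>x. x \<in> hcarrier X \<Longrightarrow> hnorm X (M x) \<le> K * hnorm X x"
    by (rule M_bounds) blast
  have "M z = y" if xs: "\<And>n. xs n \<in> hcarrier X" "hlim X xs sequentially z"
    and y: "hlim X (\<lambda>n. M (xs n)) sequentially y" for xs z y
  proof (rule X.hlim_unique[OF _ y])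
    show "hlim X (\<lambda>n. M (xs n)) sequentially (M z)"
      using xs K by (intro X.hlim_bounded_image[where K=K, OF _ _ X.hilbert_axioms xs(2)]) (auto simp flip: M_linear(2))
  qed (use xs in auto)
  then show ?thesis
    unfolding closed_op_def using X.csubspace_carrier M_lin X.hlim_mem by auto
qed

text \<open>Testing a vector \<open>h\<close> orthogonal to the range with \<open>M h\<close> and
  using symmetry gives |M h|^2 = 0, and the lower bound makes \<open>h\<close> vanish.\<close>

lemma M_image: "M ` hcarrier X = hcarrier X"
proof -
  obtain m where m: "m > 0" "\<And>x. x \<in> hcarrier X \<Longrightarrow> m * hnorm X x \<le> hnorm X (M x)"
    by (rule M_bounds) blast
  show ?thesis
  proof (rule range_eq_carrier[OF X.hilbert_axioms X.hilbert_axioms closed_op_M m])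
    fix h assume h: "h \<in> hcarrier X" and orth: "\<And>x. x \<in> hcarrier X \<Longrightarrow> hinner X (M x) h = 0"
    have "(hnorm X (M h))\<^sup>2 = 0"
      using orth[of "M h"] M_symmetric[of "M h" h] h by (simp add: X.norm_sq)
    then show "h = 0" using m(2)[OF h] m(1) h X.norm_ge_0[OF h]
      by (simp add: X.norm_eq_0[symmetric] mult_le_0_iff)
  qed
qed

lemma M_inj: "inj_on M (hcarrier X)"
proof (rule inj_onI)
  fix x y assume xy: "x \<in> hcarrier X" "y \<in> hcarrier X" "M x = M y"
  obtain m where m: "m > 0" "\<And>x. x \<in> hcarrier X \<Longrightarrow> m * hnorm X x \<le> hnorm X (M x)"
    by (rule M_bounds) blast
  have "m * hnorm X (x - y) \<le> 0" using m(2)[of "x - y"] xy by (simp add: M_linear)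
  then have "hnorm X (x - y) \<le> 0" using m(1) by (simp add: mult_le_0_iff)
  then have "hnorm X (x - y) = 0" using xy by (intro antisym) auto
  then show "x = y" using xy X.norm_eq_0[of "x - y"] by simp
qed

abbreviation W :: "'x \<Rightarrow> 'x" where "W \<equiv> Minv X M"

lemma W_M [simp]: "x \<in> hcarrier X \<Longrightarrow> W (M x) = x"
  by (simp add: Minv_def the_inv_into_f_f[OF M_inj])

lemma M_W [simp]: "x \<in> hcarrier X \<Longrightarrow> M (W x) = x"
  by (simp add: Minv_def f_the_inv_into_f[OF M_inj] M_image)

lemma W_mem [simp]: "x \<in> hcarrier X \<Longrightarrow> W x \<in> hcarrier X"
  using the_inv_into_into[OF M_inj, of x "hcarrier X"] by (simp add: Minv_def M_image)

lemma W_add: "x \<in> hcarrier X \<Longrightarrow> y \<in> hcarrier X \<Longrightarrow> W (x + y) = W x + W y"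
  and W_scale: "x \<in> hcarrier X \<Longrightarrow> W (c *\<^sub>C x) = c *\<^sub>C W x"
  and W_diff: "x \<in> hcarrier X \<Longrightarrow> y \<in> hcarrier X \<Longrightarrow> W (x - y) = W x - W y"
  using W_M[of "W x + W y"] W_M[of "c *\<^sub>C W x"] W_M[of "W x - W y"] by (simp_all add: M_linear)

lemma W_symmetric: "x \<in> hcarrier X \<Longrightarrow> y \<in> hcarrier X \<Longrightarrow> hinner X (W x) y = hinner X x (W y)"
  using M_symmetric[of "W x" "W y"] by simp

lemma XM_sel [simp]: "hcarrier (XM X M) = hcarrier X" "hinner (XM X M) x y = hinner X (W x) y"
  by (simp_all add: XM_def)

text \<open>For w = M^-1 x the squared energy norm of \<open>x\<close> is (w, M w), at least m
  |w|^2, while |x| \<le> K |w|. Conversely it is at most |w| |x|, where |w| \<le> |x| / m.\<close>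

lemma norm_equivalence:
  obtains k K where "k > 0" "K > 0"
    "\<And>x. x \<in> hcarrier X \<Longrightarrow> hnorm X x \<le> K * hnorm (XM X M) x"
    "\<And>x. x \<in> hcarrier X \<Longrightarrow> hnorm (XM X M) x \<le> k * hnorm X x"
    "\<And>x. x \<in> hcarrier X \<Longrightarrow> hnorm X (W x) \<le> k * hnorm X x"
proof -
  obtain m K where m: "m > 0" and K: "K > 0"
    and pos: "\<And>x. x \<in> hcarrier X \<Longrightarrow> m * (hnorm X x)\<^sup>2 \<le> Re (hinner X (M x) x)"
    and lower: "\<And>x. x \<in> hcarrier X \<Longrightarrow> m * hnorm X x \<le> hnorm X (M x)"
    and upper: "\<And>x. x \<in> hcarrier X \<Longrightarrow> hnorm X (M x) \<le> K * hnorm X x"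
    by (rule M_bounds) blast
  have E: "(hnorm (XM X M) x)\<^sup>2 = Re (hinner X (W x) x)" "0 \<le> hnorm (XM X M) x"
    "m * (hnorm X (W x))\<^sup>2 \<le> Re (hinner X (W x) x)" if x: "x \<in> hcarrier X" for x
  proof -
    show 1: "m * (hnorm X (W x))\<^sup>2 \<le> Re (hinner X (W x) x)"
      using pos[of "W x"] X.Re_inner_commute[of x "W x"] x by simp
    have "0 \<le> m * (hnorm X (W x))\<^sup>2" using m by simp
    then show "(hnorm (XM X M) x)\<^sup>2 = Re (hinner X (W x) x)" "0 \<le> hnorm (XM X M) x"
      using 1 by (simp_all add: hnorm_def)
  qed
  have W_le: "hnorm X (W x) \<le> (1 / m) * hnorm X x" if x: "x \<in> hcarrier X" for x
    using lower[of "W x"] m x by (simp add: field_simps)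
  have 1: "hnorm X x \<le> (K / sqrt m) * hnorm (XM X M) x" if x: "x \<in> hcarrier X" for x
  proof (rule power2_le_imp_le)
    have "m * (hnorm X x)\<^sup>2 \<le> m * (K * hnorm X (W x))\<^sup>2"
      using upper[of "W x"] m x by (intro mult_left_mono power_mono) auto
    also have "\<dots> \<le> K\<^sup>2 * (hnorm (XM X M) x)\<^sup>2"
      using mult_left_mono[OF E(3)[OF x], of "K\<^sup>2"] by (simp add: E(1)[OF x] power_mult_distrib mult.left_commute)
    finally show "(hnorm X x)\<^sup>2 \<le> ((K / sqrt m) * hnorm (XM X M) x)\<^sup>2"
      using m by (simp add: power_mult_distrib power_divide field_simps)
  qed (use m K E(2)[OF x] in simp)
  have 2: "hnorm (XM X M) x \<le> sqrt (1 / m) * hnorm X x" if x: "x \<in> hcarrier X" for x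
  proof (rule power2_le_imp_le)
    have "Re (hinner X (W x) x) \<le> hnorm X (W x) * hnorm X x" using x by (intro X.Re_inner_le) auto
    also have "\<dots> \<le> (1 / m) * hnorm X x * hnorm X x" using W_le[OF x] x by (intro mult_right_mono) auto
    also have "\<dots> = (sqrt (1 / m) * hnorm X x)\<^sup>2"
      using m by (simp add: power_mult_distrib power2_eq_square[of "hnorm X x"])
    finally show "(hnorm (XM X M) x)\<^sup>2 \<le> (sqrt (1 / m) * hnorm X x)\<^sup>2"
      by (simp only: E(1)[OF x])
  qed (use m x in simp)
  \<comment> \<open>The sum of the bounds for the energy norm and for M^-1, so that one constant
    serves both.\<close>
  let ?k = "sqrt (1 / m) + 1 / m"
  show ?thesis
  proof (rule that[of ?k "K / sqrt m"])
    fix x assume x: "x \<in> hcarrier X"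
    show "hnorm (XM X M) x \<le> ?k * hnorm X x" "hnorm X (W x) \<le> ?k * hnorm X x"
      using 2[OF x] W_le[OF x] m x by (simp_all add: distrib_right add_increasing add_increasing2)
  qed (use m K 1 in \<open>auto simp: add_pos_pos\<close>)
qed

lemma hlim_XM_iff:
  assumes f: "\<forall>\<^sub>F t in F. f t \<in> hcarrier X"
  shows "hlim (XM X M) f F l \<longleftrightarrow> hlim X f F l"
proof (cases "l \<in> hcarrier X")
  case True
  obtain k K where K0: "K > 0"
    and K: "\<And>x. x \<in> hcarrier X \<Longrightarrow> hnorm X x \<le> K * hnorm (XM X M) x"
    and k: "\<And>x. x \<in> hcarrier X \<Longrightarrow> hnorm (XM X M) x \<le> k * hnorm X x"
    by (rule norm_equivalence) blast
  have d: "\<forall>\<^sub>F t in F. f t - l \<in> hcarrier X" using f by eventually_elim (use True in simp)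
  have E: "hnorm (XM X M) x \<ge> 0" if "x \<in> hcarrier X" for x
  proof -
    have "0 \<le> K * hnorm (XM X M) x" using order_trans[OF X.norm_ge_0 K] that by blast
    then show ?thesis using K0 by (simp add: zero_le_mult_iff)
  qed
  show ?thesis
  proof
    assume "hlim (XM X M) f F l"
    then have "((\<lambda>t. K * hnorm (XM X M) (f t - l)) \<longlongrightarrow> K * 0) F"
      by (intro tendsto_mult tendsto_const) (simp add: hlim_def)
    then have lim: "((\<lambda>t. K * hnorm (XM X M) (f t - l)) \<longlongrightarrow> 0) F" by simp
    have "\<forall>\<^sub>F t in F. norm (hnorm X (f t - l)) \<le> K * hnorm (XM X M) (f t - l)"
      using d by eventually_elim (simp add: K)
    from Lim_null_comparison[OF this lim] show "hlim X f F l" using True by (simp add: hlim_def)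
  next
    assume "hlim X f F l"
    then have "((\<lambda>t. k * hnorm X (f t - l)) \<longlongrightarrow> k * 0) F"
      by (intro tendsto_mult tendsto_const) (simp add: hlim_def)
    then have lim: "((\<lambda>t. k * hnorm X (f t - l)) \<longlongrightarrow> 0) F" by simp
    have "\<forall>\<^sub>F t in F. norm (hnorm (XM X M) (f t - l)) \<le> k * hnorm X (f t - l)"
      using d by eventually_elim (simp add: k E)
    from Lim_null_comparison[OF this lim] show "hlim (XM X M) f F l" using True by (simp add: hlim_def)
  qed
qed (simp add: hlim_def)

lemma hlim_W:
  assumes "hlim X f F l" "\<forall>\<^sub>F t in F. f t \<in> hcarrier X"
  shows "hlim X (\<lambda>t. W (f t)) F (W l)"
proof -
  obtain k where "\<And>x. x \<in> hcarrier X \<Longrightarrow> hnorm X (W x) \<le> k * hnorm X x"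
    by (rule norm_equivalence) blast
  then show ?thesis
    by (intro X.hlim_bounded_image[where K=k, OF _ _ X.hilbert_axioms assms]) (auto simp flip: W_diff)
qed

lemma hilbert_XM: "hilbert (XM X M)"
proof
  obtain k K where K: "K > 0" "\<And>x. x \<in> hcarrier X \<Longrightarrow> hnorm X x \<le> K * hnorm (XM X M) x"
    by (rule norm_equivalence) blast
  have cpl: "\<exists>l\<in>hcarrier X. (\<lambda>n. hnorm (XM X M) (f n - l)) \<longlonglongrightarrow> 0"
    if f: "\<And>n. f n \<in> hcarrier X" and C: "\<And>e. e > 0 \<Longrightarrow> \<exists>N. \<forall>m\<ge>N. \<forall>n\<ge>N. hnorm (XM X M) (f m - f n) < e" for f
  proof -
    have "\<exists>l. hlim X f sequentially l"
    proof (rule X.complete[OF f])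
      fix e :: real assume "e > 0"
      then obtain N where N: "\<And>m n. m \<ge> N \<Longrightarrow> n \<ge> N \<Longrightarrow> hnorm (XM X M) (f m - f n) < e / K"
        using C[of "e / K"] K(1) by auto
      have "hnorm X (f m - f n) < e" if "m \<ge> N" "n \<ge> N" for m n
        using K(2)[of "f m - f n"] N[OF that] f K(1) by (simp add: pos_less_divide_eq mult.commute)
      then show "\<exists>N. \<forall>m\<ge>N. \<forall>n\<ge>N. hnorm X (f m - f n) < e" by blast
    qed
    then obtain l where "hlim X f sequentially l" by blast
    then have "hlim (XM X M) f sequentially l" using f by (simp add: hlim_XM_iff)
    then show ?thesis by (auto simp: hlim_def)
  qed
  have nonneg: "Re (hinner X (W x) x) \<ge> 0" if x: "x \<in> hcarrier X" for x
  proof -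
    obtain m where "m > 0" and m: "\<And>y. y \<in> hcarrier X \<Longrightarrow> m * (hnorm X y)\<^sup>2 \<le> Re (hinner X (M y) y)"
      by (rule M_bounds) blast
    have "0 \<le> m * (hnorm X (W x))\<^sup>2" using \<open>m > 0\<close> by simp
    also have "\<dots> \<le> Re (hinner X x (W x))" using m[of "W x"] x by simp
    finally show ?thesis using X.Re_inner_commute[of x "W x"] x by simp
  qed
  have definite: "x = 0" if x: "x \<in> hcarrier X" and 0: "hinner X (W x) x = 0" for x
  proof -
    have "hnorm (XM X M) x = 0" using 0 by (simp add: hnorm_def)
    then have "hnorm X x \<le> 0" using K(2)[OF x] by simp
    then have "hnorm X x = 0" using X.norm_ge_0[OF x] by (rule antisym)
    then show ?thesis using X.norm_eq_0[OF x] by simp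
  qed
  have symm: "hinner X (W y) x = cnj (hinner X (W x) y)" if "x \<in> hcarrier X" "y \<in> hcarrier X" for x y
    using that X.inner_commute[of "W x" y] by (simp add: W_symmetric)
  show "is_hilbert (XM X M)"
    unfolding is_hilbert_def XM_sel
    apply (intro conjI)
    subgoal by (rule X.csubspace_carrier)
    subgoal by (simp add: W_add X.inner_simps)
    subgoal by (simp add: W_scale X.inner_simps)
    subgoal by (intro ballI symm)
    subgoal using nonneg by simp
    subgoal using definite by simp
    subgoal by (intro allI impI, elim conjE, rule cpl) auto
    done
qed

end

section \<open>The space \<open>Xh\<close> normed by \<open>A\<close>\<close>

locale bounded_below = X: hilbert X + Y: hilbert Y
  for X :: "'x::cvec hspace" and Y :: "'y::cvec hspace" +
  fixes domA :: "'x set" and A :: "'x \<Rightarrow> 'y" and c :: real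
  assumes A_closed: "closed_op X Y domA A"
    and c_pos: "c > 0" and A_below: "\<forall>x\<in>domA. hnorm Y (A x) \<ge> c * hnorm X x"
begin

lemmas domA_csubspace = closed_op_csubspace[OF A_closed]
lemmas A_lin = closed_op_clinear[OF A_closed]
lemmas A_linear = clinear_on_add[OF domA_csubspace A_lin] clinear_on_diff[OF domA_csubspace A_lin]
  clinear_on_scale[OF domA_csubspace A_lin] clinear_on_zero[OF domA_csubspace A_lin]
lemmas domA_closed [simp] = csubspace_zero[OF domA_csubspace] csubspace_add[OF domA_csubspace]
  csubspace_diff[OF domA_csubspace] csubspace_scale[OF domA_csubspace]

lemma domA_mem [simp]: "x \<in> domA \<Longrightarrow> x \<in> hcarrier X"
  and A_mem [simp]: "x \<in> domA \<Longrightarrow> A x \<in> hcarrier Y"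
  using closed_op_dom(2)[OF A_closed] closed_op_mem[OF A_closed] by auto

lemma Xh_sel [simp]: "hcarrier (Xh Y domA A) = domA" "hinner (Xh Y domA A) x y = hinner Y (A x) (A y)"
  by (simp_all add: Xh_def)

lemma hnorm_Xh: "hnorm (Xh Y domA A) x = hnorm Y (A x)"
  by (simp add: hnorm_def)

lemma norm_le_A: "x \<in> domA \<Longrightarrow> hnorm X x \<le> hnorm Y (A x) / c"
  using A_below c_pos by (simp add: pos_le_divide_eq mult.commute)

lemma hlim_Xh_iff:
  assumes f: "\<forall>\<^sub>F t in F. f t \<in> domA"
  shows "hlim (Xh Y domA A) f F l \<longleftrightarrow> l \<in> domA \<and> hlim Y (\<lambda>t. A (f t)) F (A l)"
proof -
  have "((\<lambda>t. hnorm Y (A (f t - l))) \<longlongrightarrow> 0) F \<longleftrightarrow> ((\<lambda>t. hnorm Y (A (f t) - A l)) \<longlongrightarrow> 0) F" if l: "l \<in> domA"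
    by (rule tendsto_cong) (use f in eventually_elim, use l in \<open>simp add: A_linear\<close>)
  then show ?thesis by (auto simp: hlim_def hnorm_Xh)
qed

lemma hlim_Xh_imp_X:
  assumes f: "\<forall>\<^sub>F t in F. f t \<in> domA" and l: "hlim (Xh Y domA A) f F l"
  shows "hlim X f F l"
proof (rule X.hlimI)
  have lA: "l \<in> domA" using l by (simp add: hlim_def)
  then show "l \<in> hcarrier X" by simp
  have "((\<lambda>t. hnorm Y (A (f t - l)) / c) \<longlongrightarrow> 0 / c) F"
    using l c_pos by (intro tendsto_divide tendsto_const) (auto simp: hlim_def hnorm_Xh)
  then show "((\<lambda>t. hnorm Y (A (f t - l)) / c) \<longlongrightarrow> 0) F" by simp
  show "\<forall>\<^sub>F t in F. f t \<in> hcarrier X \<and> hnorm X (f t - l) \<le> hnorm Y (A (f t - l)) / c"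
    using f by eventually_elim (use lA norm_le_A in simp)
qed

text \<open>A Cauchy sequence of \<open>Xh\<close> is one of images under \<open>A\<close>; its
  limit is again an image because \<open>A\<close> has closed range.\<close>

lemma hilbert_Xh: "hilbert (Xh Y domA A)"
proof
  have cpl: "\<exists>l\<in>domA. (\<lambda>n. hnorm (Xh Y domA A) (f n - l)) \<longlonglongrightarrow> 0"
    if f: "\<And>n. f n \<in> domA" and C: "\<And>e. e > 0 \<Longrightarrow> \<exists>N. \<forall>m\<ge>N. \<forall>n\<ge>N. hnorm (Xh Y domA A) (f m - f n) < e" for f
  proof -
    have "\<exists>y. hlim Y (\<lambda>n. A (f n)) sequentially y"
      using C f by (intro Y.complete) (auto simp: hnorm_Xh A_linear)
    then obtain y where y: "hlim Y (\<lambda>n. A (f n)) sequentially y" by blast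
    have "y \<in> A ` domA"
      using A_below c_pos f by (intro closed_range[OF X.hilbert_axioms Y.hilbert_axioms A_closed c_pos _ _ y]) auto
    then obtain l where "l \<in> domA" "y = A l" by blast
    then have "hlim (Xh Y domA A) f sequentially l" using y f by (simp add: hlim_Xh_iff)
    then show ?thesis by (auto simp: hlim_def)
  qed
  have definite: "x = 0" if x: "x \<in> domA" and 0: "hinner Y (A x) (A x) = 0" for x
  proof -
    have "hnorm X x \<le> 0" using norm_le_A[OF x] Y.inner_self_eq_0[of "A x"] x 0 by simp
    then have "hnorm X x = 0" using x by (intro antisym) auto
    then show ?thesis using X.norm_eq_0[of x] x by simp
  qed
  show "is_hilbert (Xh Y domA A)"
    unfolding is_hilbert_def Xh_sel
    apply (intro conjI)
    subgoal by (rule domA_csubspace)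
    subgoal by (simp add: A_linear Y.inner_simps)
    subgoal by (simp add: A_linear Y.inner_simps)
    subgoal by (auto intro: Y.inner_commute)
    subgoal by (auto intro: Y.inner_self_ge_0)
    subgoal using definite by simp
    subgoal by (intro allI impI, elim conjE, rule cpl) auto
    done
qed

end

section \<open>The boundary triple of the first-order system\<close>

declare prod_hs_sel(2) [simp del]

text \<open>\<open>adj\<close> says that the adjoint of \<open>A\<close> is contained in -B without
  naming it: \<open>w\<close> stands for its value at \<open>y\<close>. In \<open>green\<close> the
  pairing of G2 with its anti-dual is the conjugate of an evaluation.\<close>

locale port_system =
  bounded_below X Y domA A c + uniformly_positive X M + G1: hilbert G1 + G2: hilbert G2
  for X :: "'x::cvec hspace" and Y :: "'y::cvec hspace" and domA A c and M
    and G1 :: "'g1::cvec hspace" and G2 :: "'g2::cvec hspace" +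
  fixes domB :: "'y set" and B :: "'y \<Rightarrow> 'x"
    and Lam1 :: "'x \<Rightarrow> 'g1" and Lam2 :: "'x \<Rightarrow> 'g2 \<Rightarrow> complex"
    and Pi1 :: "'y \<Rightarrow> 'g1 \<Rightarrow> complex" and Pi2 :: "'y \<Rightarrow> 'g2"
    and D :: "'x \<Rightarrow> 'x"
  assumes B_closed: "closed_op Y X domB B"
    and adj: "\<forall>y\<in>hcarrier Y. \<forall>w\<in>hcarrier X.
                 (\<forall>x\<in>domA. hinner Y (A x) y = hinner X x w) \<longrightarrow> y \<in> domB \<and> B y = - w"
    and Lam_lin: "clinear_on domA Lam1" "clinear_on domA Lam2"
    and Lam_surj: "(\<lambda>x. (Lam1 x, Lam2 x)) ` domA = hcarrier G1 \<times> hcarrier (antidual G2)"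
    and Pi_lin: "clinear_on domB Pi1" "clinear_on domB Pi2"
    and Pi_surj: "(\<lambda>y. (Pi1 y, Pi2 y)) ` domB = hcarrier (antidual G1) \<times> hcarrier G2"
    and green: "\<forall>y\<in>domB. \<forall>x\<in>domA.
                 - hinner X (B y) x - hinner Y y (A x) = Pi1 y (Lam1 x) - cnj (Lam2 x (Pi2 y))"
    and D_bdd: "bounded_op X X D"
    and D_diss: "\<forall>x\<in>hcarrier X. Re (hinner X (D x) x) \<ge> 0"
begin

sublocale G1d: hilbert "antidual G1" by (rule G1.hilbert_antidual)
sublocale G2d: hilbert "antidual G2" by (rule G2.hilbert_antidual)

abbreviation U where "U \<equiv> prod_hs (antidual G1) (antidual G2)"
abbreviation V where "V \<equiv> prod_hs (Xh Y domA A) (XM X M)"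
abbreviation Z where "Z \<equiv> dom_AM X domA A domB M"
abbreviation L where "L \<equiv> op_AM X A B M D"

sublocale Xh: hilbert "Xh Y domA A" by (rule hilbert_Xh)
sublocale XM: hilbert "XM X M" by (rule hilbert_XM)
sublocale UU: hilbert_pair "antidual G1" "antidual G2" ..
sublocale VV: hilbert_pair "Xh Y domA A" "XM X M" ..
sublocale U: hilbert U by (rule UU.hilbert_prod)
sublocale V: hilbert V by (rule VV.hilbert_prod)

lemmas domB_csubspace = closed_op_csubspace[OF B_closed]
lemmas B_lin = closed_op_clinear[OF B_closed]
lemmas B_linear = clinear_on_add[OF domB_csubspace B_lin] clinear_on_diff[OF domB_csubspace B_lin]
  clinear_on_scale[OF domB_csubspace B_lin] clinear_on_zero[OF domB_csubspace B_lin]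
lemmas Pi_linear = clinear_onD[OF domB_csubspace Pi_lin(1)] clinear_onD[OF domB_csubspace Pi_lin(2)]
lemmas Lam_linear = clinear_onD[OF domA_csubspace Lam_lin(1)] clinear_onD[OF domA_csubspace Lam_lin(2)]
lemmas domB_closed [simp] = csubspace_zero[OF domB_csubspace] csubspace_add[OF domB_csubspace]
  csubspace_diff[OF domB_csubspace] csubspace_scale[OF domB_csubspace]

lemma domB_mem [simp]: "y \<in> domB \<Longrightarrow> y \<in> hcarrier Y"
  and B_mem [simp]: "y \<in> domB \<Longrightarrow> B y \<in> hcarrier X"
  using closed_op_dom(2)[OF B_closed] closed_op_mem[OF B_closed] by auto

lemma trace_mem [simp]:
  shows "x \<in> domA \<Longrightarrow> Lam1 x \<in> hcarrier G1" "x \<in> domA \<Longrightarrow> Lam2 x \<in> hcarrier (antidual G2)"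
    and "y \<in> domB \<Longrightarrow> Pi1 y \<in> hcarrier (antidual G1)" "y \<in> domB \<Longrightarrow> Pi2 y \<in> hcarrier G2"
  using Lam_surj Pi_surj by auto

lemma D_mem [simp]: "x \<in> hcarrier X \<Longrightarrow> D x \<in> hcarrier X"
  using D_bdd by (auto simp: bounded_op_def)

lemma D_lin: "clinear_on (hcarrier X) D"
  using D_bdd by (simp add: bounded_op_def)

lemma obtain_Lam:
  assumes "g \<in> hcarrier G1" "\<psi> \<in> hcarrier (antidual G2)"
  obtains x where "x \<in> domA" "Lam1 x = g" "Lam2 x = \<psi>"
proof -
  have "(g, \<psi>) \<in> (\<lambda>x. (Lam1 x, Lam2 x)) ` domA" using assms by (simp add: Lam_surj)
  then show ?thesis using that by auto
qed

lemma obtain_Pi: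
  assumes "\<phi> \<in> hcarrier (antidual G1)" "g \<in> hcarrier G2"
  obtains y where "y \<in> domB" "Pi1 y = \<phi>" "Pi2 y = g"
proof -
  have "(\<phi>, g) \<in> (\<lambda>y. (Pi1 y, Pi2 y)) ` domB" using assms by (simp add: Pi_surj)
  then show ?thesis using that by auto
qed

section \<open>Adjoints of \<open>A\<close> and \<open>B\<close> expressed by vanishing
  traces\<close>

lemma Green: "y \<in> domB \<Longrightarrow> x \<in> domA \<Longrightarrow>
    - hinner X (B y) x - hinner Y y (A x) = Pi1 y (Lam1 x) - cnj (Lam2 x (Pi2 y))"
  using green by blast

text \<open>The Green identity leaves a relation between \<open>Pi1 y\<close> and
  \<open>Pi2 y\<close> tested on all Lambda traces, which are arbitrary: \<open>Lam2 x = 0\<close>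
  kills \<open>Pi1 y\<close>, and the Riesz image of \<open>Pi2 y\<close> as \<open>Lam2 x\<close>
  gives |Pi2 y|^2 = 0.\<close>

lemma Pi_zero_if:
  assumes y: "y \<in> domB" and 0: "\<And>x. x \<in> domA \<Longrightarrow> hinner X (B y) x + hinner Y y (A x) = 0"
  shows "Pi1 y = 0" "Pi2 y = 0"
proof -
  have *: "Pi1 y (Lam1 x) = cnj (Lam2 x (Pi2 y))" if x: "x \<in> domA" for x
    using Green[OF y x] 0[OF x] by (simp add: algebra_simps add_eq_0_iff)
  show "Pi1 y = 0"
  proof
    fix g
    show "Pi1 y g = 0 g"
    proof (cases "g \<in> hcarrier G1")
      case True
      then obtain x where x: "x \<in> domA" "Lam1 x = g" "Lam2 x = 0" using obtain_Lam[of g 0] by auto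
      then show ?thesis using *[OF x(1)] by simp
    next
      case False
      then show ?thesis using G1.antidual_outside[OF trace_mem(3)[OF y]] by simp
    qed
  qed
  then obtain x where x: "x \<in> domA" "Lam2 x = riesz G2 (Pi2 y)"
    using obtain_Lam[of 0 "riesz G2 (Pi2 y)"] G2.riesz_mem y by auto
  have "hinner G2 (Pi2 y) (Pi2 y) = 0"
    using *[OF x(1)] y \<open>Pi1 y = 0\<close> by (simp add: x(2) G2.riesz_apply)
  then show "Pi2 y = 0" using G2.inner_self_eq_0 y by simp
qed

text \<open>The mirror image, with the Pi traces as arbitrary test data.\<close>

lemma Lam_zero_if:
  assumes x: "x \<in> domA" and 0: "\<And>y. y \<in> domB \<Longrightarrow> hinner X (B y) x + hinner Y y (A x) = 0"
  shows "Lam1 x = 0" "Lam2 x = 0"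
proof -
  have *: "Pi1 y (Lam1 x) = cnj (Lam2 x (Pi2 y))" if y: "y \<in> domB" for y
    using Green[OF y x] 0[OF y] by (simp add: algebra_simps add_eq_0_iff)
  show "Lam2 x = 0"
  proof
    fix g
    show "Lam2 x g = 0 g"
    proof (cases "g \<in> hcarrier G2")
      case True
      then obtain y where y: "y \<in> domB" "Pi1 y = 0" "Pi2 y = g" using obtain_Pi[of 0 g] by auto
      then show ?thesis using *[OF y(1)] by simp
    next
      case False
      then show ?thesis using G2.antidual_outside[OF trace_mem(2)[OF x]] by simp
    qed
  qed
  then obtain y where y: "y \<in> domB" "Pi1 y = riesz G1 (Lam1 x)"
    using obtain_Pi[of "riesz G1 (Lam1 x)" 0] G1.riesz_mem x by auto
  have "hinner G1 (Lam1 x) (Lam1 x) = 0"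
    using *[OF y(1)] x \<open>Lam2 x = 0\<close> by (simp add: y(2) G1.riesz_apply)
  then show "Lam1 x = 0" using G1.inner_self_eq_0 x by simp
qed

text \<open>\<open>A\<^sup>*\<^sup>* = A\<close>, since \<open>-A\<^sup>*\<close> is the restriction of \<open>B\<close> to \<open>ker \<Pi>\<close>.\<close>

lemma A_biadjoint:
  assumes q: "q \<in> hcarrier X" and p: "p \<in> hcarrier Y"
    and 0: "\<And>y. y \<in> domB \<Longrightarrow> Pi1 y = 0 \<Longrightarrow> Pi2 y = 0 \<Longrightarrow> hinner Y y p + hinner X (B y) q = 0"
  shows "q \<in> domA \<and> A q = p"
proof -
  obtain x where x: "x \<in> domA" "\<And>s. s \<in> domA \<Longrightarrow> hinner X (q - x) s + hinner Y (p - A x) (A s) = 0"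
    using graph_projection[OF X.hilbert_axioms Y.hilbert_axioms A_closed q p] by blast
  define r where "r = q - x"
  define s where "s = p - A x"
  have r: "r \<in> hcarrier X" and s: "s \<in> hcarrier Y" using q p x(1) by (auto simp: r_def s_def)
  have orth: "hinner X r w + hinner Y s (A w) = 0" if "w \<in> domA" for w
    using x(2)[OF that] by (simp add: r_def s_def)
  have "hinner Y (A w) s = hinner X w (- r)" if w: "w \<in> domA" for w
  proof -
    have "cnj (hinner Y s (A w)) = - cnj (hinner X r w)"
      using orth[OF w] by (simp add: add_eq_0_iff2)
    then show ?thesis
      using Y.inner_commute[OF s A_mem[OF w]] X.inner_commute[OF r domA_mem[OF w]] w r
      by (simp add: X.inner_minus_right)
  qed
  \<comment> \<open>Orthogonality to the graph says that \<open>s\<close> is in the domain of the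
    adjoint of \<open>A\<close>, with value \<open>- r\<close>.\<close>
  then have "s \<in> domB \<and> B s = - (- r)" using adj s r by (meson X.minus_mem)
  then have sB: "s \<in> domB" "B s = r" by auto
  have "hinner X (B s) w + hinner Y s (A w) = 0" if "w \<in> domA" for w using orth[OF that] sB by simp
  \<comment> \<open>The residual pair is now orthogonal to the given pair as well as to its
    projection, hence to itself.\<close>
  then have "hinner Y s p + hinner X r q = 0" using 0[OF sB(1) Pi_zero_if[OF sB(1)]] sB(2) by simp
  moreover have "hinner X r x + hinner Y s (A x) = 0" by (rule orth[OF x(1)])
  moreover have "p = s + A x" "q = r + x" by (simp_all add: r_def s_def)
  ultimately have "hinner Y s s + hinner X r r = 0"
    using r s x(1) by (simp add: X.inner_simps Y.inner_simps algebra_simps)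
  then have "(hnorm Y s)\<^sup>2 + (hnorm X r)\<^sup>2 = 0"
    using r s by (simp add: X.norm_sq Y.norm_sq flip: plus_complex.simps)
  then have "hnorm Y s = 0" "hnorm X r = 0" by (simp_all add: sum_power2_eq_zero_iff)
  then have "s = 0" "r = 0" using X.norm_eq_0[OF r] Y.norm_eq_0[OF s] by auto
  then show ?thesis using x(1) by (simp add: r_def s_def)
qed

text \<open>\<open>-B\<close> is the adjoint of the restriction of \<open>A\<close> to \<open>ker \<Lambda>\<close>.\<close>

lemma A_min_adjoint:
  assumes y: "y \<in> hcarrier Y" and v: "v \<in> hcarrier X"
    and 0: "\<And>x. x \<in> domA \<Longrightarrow> Lam1 x = 0 \<Longrightarrow> Lam2 x = 0 \<Longrightarrow> hinner Y (A x) y = hinner X x v"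
  shows "y \<in> domB \<and> B y = - v"
proof -
  obtain y0 where y0: "y0 \<in> domB" "\<And>s. s \<in> domB \<Longrightarrow> hinner Y (y - y0) s + hinner X (- v - B y0) (B s) = 0"
    using graph_projection[OF Y.hilbert_axioms X.hilbert_axioms B_closed y, of "- v"] v by auto
  define p where "p = y - y0"
  define q where "q = - v - B y0"
  have p: "p \<in> hcarrier Y" and q: "q \<in> hcarrier X" using y v y0(1) by (auto simp: p_def q_def)
  have orth: "hinner Y p s + hinner X q (B s) = 0" if "s \<in> domB" for s
    using y0(2)[OF that] by (simp add: p_def q_def)
  have orth': "hinner Y s p + hinner X (B s) q = 0" if s: "s \<in> domB" for s
    using arg_cong[OF orth[OF s], of cnj] Y.inner_commute[OF p domB_mem[OF s]] X.inner_commute[OF q B_mem[OF s]]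
    by simp
  \<comment> \<open>The pair \<open>(p, q)\<close> is orthogonal to the graph of \<open>B\<close>;
    in particular it passes the test of \<open>A_biadjoint\<close>. Once \<open>q\<close> has zero
    Lambda traces, it may be inserted into the hypothesis on \<open>y\<close> and
    \<open>v\<close>.\<close>
  have qA: "q \<in> domA" "A q = p" using A_biadjoint[OF q p] orth' by auto
  have "hinner X (B s) q + hinner Y s (A q) = 0" if "s \<in> domB" for s
    using orth'[OF that] qA by (simp add: add.commute)
  then have "Lam1 q = 0" "Lam2 q = 0" using Lam_zero_if[OF qA(1)] by auto
  then have "hinner Y p y = hinner X q v" using 0[OF qA(1)] qA(2) by simp
  moreover have "y = p + y0" "v = - (q + B y0)" by (simp_all add: p_def q_def)
  ultimately have eq: "hinner Y p (p + y0) = - hinner X q (q + B y0)"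
    using q y0(1) by (simp add: X.inner_simps)
  have "hinner Y p p + hinner X q q + (hinner Y p y0 + hinner X q (B y0)) =
      hinner Y p (p + y0) + hinner X q (q + B y0)"
    using p q y0(1) by (simp add: X.inner_simps Y.inner_simps)
  then have "hinner Y p p + hinner X q q = 0" using orth[OF y0(1)] eq by simp
  then have "(hnorm Y p)\<^sup>2 + (hnorm X q)\<^sup>2 = 0"
    using p q by (simp add: X.norm_sq Y.norm_sq flip: plus_complex.simps)
  then have "hnorm Y p = 0" "hnorm X q = 0" by (simp_all add: sum_power2_eq_zero_iff)
  then have "p = 0" "q = 0" using X.norm_eq_0[OF q] Y.norm_eq_0[OF p] by auto
  then have "y = y0" "B y0 = - v" by (simp_all add: p_def q_def)
  then show ?thesis using y0(1) by simp
qed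

text \<open>The component of \<open>y\<close> orthogonal to \<open>ran A\<close> lies in \<open>ker A\<^sup>*\<close>, on which \<open>B\<close> and \<open>\<Pi>\<close> vanish.\<close>

lemma range_component:
  assumes y: "y \<in> domB"
  obtains x where "x \<in> domA" "A x \<in> domB" "B (A x) = B y" "Pi1 (A x) = Pi1 y" "Pi2 (A x) = Pi2 y"
    "\<And>w. w \<in> domA \<Longrightarrow> hinner Y y (A w) = hinner Y (A x) (A w)"
proof -
  obtain x where x: "x \<in> domA" "\<And>s. s \<in> domA \<Longrightarrow> hinner Y (y - A x) (A s) = 0"
    using range_projection[OF X.hilbert_axioms Y.hilbert_axioms A_closed c_pos _ domB_mem[OF y]] A_below by blast
  define n where "n = y - A x"
  have n: "n \<in> hcarrier Y" using y x(1) by (simp add: n_def)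
  have orth: "hinner Y n (A s) = 0" if "s \<in> domA" for s using x(2)[OF that] by (simp add: n_def)
  have "hinner Y (A s) n = hinner X s 0" if s: "s \<in> domA" for s
    using Y.inner_commute[OF n A_mem[OF s]] orth[OF s] s by simp
  \<comment> \<open>The value 0 of the adjoint means that \<open>n\<close> lies in its
    kernel.\<close>
  then have "n \<in> domB \<and> B n = - 0" using adj n by (meson X.zero_mem)
  then have nB: "n \<in> domB" "B n = 0" by auto
  have Pi0: "Pi1 n = 0" "Pi2 n = 0" using Pi_zero_if[OF nB(1)] nB(2) orth by auto
  have eq: "A x = y - n" by (simp add: n_def)
  show ?thesis
  proof (rule that[OF x(1)])
    show "A x \<in> domB" "B (A x) = B y" "Pi1 (A x) = Pi1 y" "Pi2 (A x) = Pi2 y"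
      unfolding eq using y nB Pi0 by (simp_all add: B_linear Pi_linear)
    show "hinner Y y (A w) = hinner Y (A x) (A w)" if "w \<in> domA" for w
      unfolding eq using orth[OF that] n y that by (simp add: Y.inner_diff_left)
  qed
qed

section \<open>Traces of the first-order system\<close>

definition ta :: "'x \<times> 'x \<Rightarrow> ('g1 \<Rightarrow> complex) \<times> ('g2 \<Rightarrow> complex)" where
  "ta z = riesz_G G1 G2 (Gamma0 A Lam1 Pi2 (diagM X M z))"

definition tb :: "'x \<times> 'x \<Rightarrow> ('g1 \<Rightarrow> complex) \<times> ('g2 \<Rightarrow> complex)" where
  "tb z = Gamma1 A Pi1 Lam2 (diagM X M z)"

lemma ta_eq: "ta (z1, z2) = (riesz G1 (Lam1 (W z2)), riesz G2 (Pi2 (A z1)))"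
  and tb_eq: "tb (z1, z2) = (- Pi1 (A z1), Lam2 (W z2))"
  and L_eq: "L (z1, z2) = (W z2, B (A z1) - D (W z2))"
  by (simp_all add: ta_def tb_def riesz_G_def Gamma0_def Gamma1_def diagM_def op_AM_def)

lemma Z_iff: "(z1, z2) \<in> Z \<longleftrightarrow> z1 \<in> domA \<and> A z1 \<in> domB \<and> z2 \<in> hcarrier X \<and> W z2 \<in> domA"
proof -
  have "z2 \<in> M ` domA \<longleftrightarrow> z2 \<in> hcarrier X \<and> W z2 \<in> domA"
  proof
    assume z2: "z2 \<in> hcarrier X \<and> W z2 \<in> domA"
    then have "z2 = M (W z2)" by simp
    then show "z2 \<in> M ` domA" using z2 by (metis imageI)
  qed auto
  then show ?thesis by (auto simp: dom_AM_def)
qed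

lemma Z_cases:
  assumes "z \<in> Z"
  obtains z1 w where "z = (z1, M w)" "z1 \<in> domA" "A z1 \<in> domB" "w \<in> domA"
  using assms by (auto simp: dom_AM_def)

lemma mem_ZI: "z1 \<in> domA \<Longrightarrow> A z1 \<in> domB \<Longrightarrow> w \<in> domA \<Longrightarrow> (z1, M w) \<in> Z"
  by (simp add: Z_iff)

text \<open>A symmetric form of the Green identity for two states: it is used for
  \<open>(A x, w')\<close> directly and for \<open>(A x', w)\<close> after conjugation.\<close>

lemma Green_trace:
  assumes "x \<in> domA" "A x \<in> domB" "w \<in> domA" "x' \<in> domA" "A x' \<in> domB" "w' \<in> domA"
  shows "hinner U (tb (x, M w)) (ta (x', M w')) + hinner U (ta (x, M w)) (tb (x', M w')) =
    hinner X (B (A x)) w' + hinner Y (A x) (A w') + hinner X w (B (A x')) + hinner Y (A w) (A x')"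
proof -
  \<comment> \<open>Stated for arbitrary states because the second summand is its conjugate with the
    two states exchanged.\<close>
  have 1: "hinner U (tb (x, M w)) (ta (x', M w')) = - Pi1 (A x) (Lam1 w') + Lam2 w (Pi2 (A x'))"
    if "x \<in> domA" "A x \<in> domB" "w \<in> domA" "x' \<in> domA" "A x' \<in> domB" "w' \<in> domA" for x w x' w'
    using that G1d.minus_mem[OF trace_mem(3)[of "A x"]]
    by (simp add: prod_hs_sel(2) ta_eq tb_eq G1.inner_antidual_pairing G2.inner_antidual_pairing)
  have mem: "ta (x, M w) \<in> hcarrier U" "tb (x', M w') \<in> hcarrier U"
    using assms by (simp_all add: ta_eq tb_eq G1.riesz_mem G2.riesz_mem)
  have 2: "hinner U (ta (x, M w)) (tb (x', M w')) = cnj (- Pi1 (A x') (Lam1 w) + Lam2 w' (Pi2 (A x)))"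
    by (simp only: U.inner_commute[OF mem(2,1)] 1[OF assms(4-6,1-3)])
  have 3: "Pi1 (A x) (Lam1 w') - cnj (Lam2 w' (Pi2 (A x))) = - hinner X (B (A x)) w' - hinner Y (A x) (A w')"
    using Green[OF assms(2,6)] by simp
  have "cnj (Pi1 (A x') (Lam1 w) - cnj (Lam2 w (Pi2 (A x')))) = cnj (- hinner X (B (A x')) w - hinner Y (A x') (A w))"
    using Green[OF assms(5,3)] by simp
  then have 4: "cnj (Pi1 (A x') (Lam1 w)) - Lam2 w (Pi2 (A x')) = - hinner X w (B (A x')) - hinner Y (A w) (A x')"
    using assms X.inner_commute[of "B (A x')" w] Y.inner_commute[of "A x'" "A w"] by simp
  have "hinner U (tb (x, M w)) (ta (x', M w')) + hinner U (ta (x, M w)) (tb (x', M w')) =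
      - (Pi1 (A x) (Lam1 w') - cnj (Lam2 w' (Pi2 (A x)))) - (cnj (Pi1 (A x') (Lam1 w)) - Lam2 w (Pi2 (A x')))"
    by (simp only: 1[OF assms] 2) simp
  also have "\<dots> = hinner X (B (A x)) w' + hinner Y (A x) (A w') + hinner X w (B (A x')) + hinner Y (A w) (A x')"
    unfolding 3 4 by simp
  finally show ?thesis .
qed

lemma W_zero [simp]: "W 0 = 0"
  using W_M[of 0] clinear_on_zero[OF X.csubspace_carrier M_lin] by simp

lemmas D_linear = clinear_on_add[OF X.csubspace_carrier D_lin] clinear_on_scale[OF X.csubspace_carrier D_lin]

lemma csubspace_Z: "csubspace Z"
  unfolding csubspace_def
  by (auto simp: zero_prod_def scaleC_prod_def Z_iff A_linear W_add W_scale)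

lemma Z_subset: "Z \<subseteq> hcarrier V"
  by (auto simp: Z_iff)

lemma clinear_on_L: "clinear_on Z L"
  by (auto simp: clinear_on_def scaleC_prod_def Z_iff L_eq A_linear W_add W_scale B_linear D_linear
      cvec.scale_right_diff_distrib)

lemma clinear_on_ta: "clinear_on Z ta" and clinear_on_tb: "clinear_on Z tb"
  by (auto simp: clinear_on_def scaleC_prod_def Z_iff ta_eq tb_eq A_linear W_add W_scale Lam_linear Pi_linear
      G1.riesz_add G2.riesz_add G1.riesz_scale G2.riesz_scale)

lemma L_image: "L ` Z \<subseteq> hcarrier V"
  by (auto simp: Z_iff L_eq)

text \<open>The Lambda data prescribe \<open>w = M^-1 z2\<close> and the Pi data prescribe some
  \<open>y\<close> in \<open>domB\<close>; \<open>range_component\<close> replaces \<open>y\<close>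
  by an element \<open>A x\<close> with the same traces.\<close>

lemma trace_image: "(\<lambda>z. (ta z, tb z)) ` Z = hcarrier U \<times> hcarrier U"
proof (intro equalityI subsetI)
  fix p assume "p \<in> (\<lambda>z. (ta z, tb z)) ` Z"
  then show "p \<in> hcarrier U \<times> hcarrier U"
    by (auto simp: Z_iff ta_eq tb_eq G1.riesz_mem G2.riesz_mem)
next
  fix p assume p: "p \<in> hcarrier U \<times> hcarrier U"
  obtain \<alpha>1 \<alpha>2 \<beta>1 \<beta>2 where p_eq: "p = ((\<alpha>1, \<alpha>2), (\<beta>1, \<beta>2))" by (metis surj_pair)
  have mem: "\<alpha>1 \<in> hcarrier (antidual G1)" "\<alpha>2 \<in> hcarrier (antidual G2)"
    "\<beta>1 \<in> hcarrier (antidual G1)" "\<beta>2 \<in> hcarrier (antidual G2)"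
    using p by (auto simp: p_eq)
  obtain w where w: "w \<in> domA" "Lam1 w = riesz_inv G1 \<alpha>1" "Lam2 w = \<beta>2"
    using obtain_Lam[OF G1.riesz_inv_mem[OF mem(1)] mem(4)] .
  obtain y where y: "y \<in> domB" "Pi1 y = - \<beta>1" "Pi2 y = riesz_inv G2 \<alpha>2"
    using obtain_Pi[OF G1d.minus_mem[OF mem(3)] G2.riesz_inv_mem[OF mem(2)]] .
  obtain x where x: "x \<in> domA" "A x \<in> domB" "Pi1 (A x) = Pi1 y" "Pi2 (A x) = Pi2 y"
    using range_component[OF y(1)] by blast
  have "(ta (x, M w), tb (x, M w)) = p"
    using w y x mem by (simp add: ta_eq tb_eq p_eq G1.riesz_riesz_inv G2.riesz_riesz_inv)
  then show "p \<in> (\<lambda>z. (ta z, tb z)) ` Z"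
    using mem_ZI[OF x(1,2) w(1)] by (intro image_eqI[of _ _ "(x, M w)"]) auto
qed

lemma hlim_V_iff:
  assumes "\<And>n. zs n \<in> hcarrier V"
  shows "hlim V zs sequentially l \<longleftrightarrow> fst l \<in> domA \<and> hlim Y (\<lambda>n. A (fst (zs n))) sequentially (A (fst l)) \<and>
    hlim X (\<lambda>n. snd (zs n)) sequentially (snd l)"
proof -
  have m: "fst (zs n) \<in> domA" "snd (zs n) \<in> hcarrier X" for n using assms[of n] by auto
  show ?thesis
    using m by (subst VV.hlim_prod_iff) (simp_all add: hlim_Xh_iff hlim_XM_iff mem_Times_iff)
qed

text \<open>The first component of \<open>L\<close> converges in \<open>Xh\<close>, which controls
  \<open>A\<close> applied to M^-1 z2. The second, after adding the bounded damping term, controls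
  \<open>B (A z1)\<close>, and closedness of \<open>B\<close> finishes.\<close>

lemma graph_limit:
  assumes zs: "\<And>n. zs n \<in> Z" and z: "hlim V zs sequentially z"
    and l: "hlim V (\<lambda>n. L (zs n)) sequentially l"
  shows "z \<in> Z" "L z = l"
    and "hlim Y (\<lambda>n. A (fst (zs n))) sequentially (A (fst z))"
    and "hlim Y (\<lambda>n. A (W (snd (zs n)))) sequentially (A (W (snd z)))"
    and "hlim X (\<lambda>n. W (snd (zs n))) sequentially (W (snd z))"
    and "hlim X (\<lambda>n. B (A (fst (zs n)))) sequentially (B (A (fst z)))"
proof -
  have m: "fst (zs n) \<in> domA" "A (fst (zs n)) \<in> domB" "snd (zs n) \<in> hcarrier X" "W (snd (zs n)) \<in> domA"
    and Ls: "L (zs n) = (W (snd (zs n)), B (A (fst (zs n))) - D (W (snd (zs n))))" for n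
    using zs[of n] Z_iff[of "fst (zs n)" "snd (zs n)"] L_eq[of "fst (zs n)" "snd (zs n)"] by simp_all
  have z1: "fst z \<in> domA" and Az: "hlim Y (\<lambda>n. A (fst (zs n))) sequentially (A (fst z))"
    and z2: "hlim X (\<lambda>n. snd (zs n)) sequentially (snd z)"
    using z hlim_V_iff[of zs z] m by (simp_all add: mem_Times_iff)
  have l1: "fst l \<in> domA" and Aw: "hlim Y (\<lambda>n. A (W (snd (zs n)))) sequentially (A (fst l))"
    and l2: "hlim X (\<lambda>n. B (A (fst (zs n))) - D (W (snd (zs n)))) sequentially (snd l)"
    using l hlim_V_iff[of "\<lambda>n. L (zs n)" l] m by (simp_all add: Ls)
  have "hlim (Xh Y domA A) (\<lambda>n. W (snd (zs n))) sequentially (fst l)"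
    using l1 Aw m by (simp add: hlim_Xh_iff)
  then have wl: "hlim X (\<lambda>n. W (snd (zs n))) sequentially (fst l)"
    by (rule hlim_Xh_imp_X[rotated]) (use m in simp)
  have w: "hlim X (\<lambda>n. W (snd (zs n))) sequentially (W (snd z))"
    by (rule hlim_W[OF z2]) (use m in simp)
  \<comment> \<open>The same sequence has limits coming from the convergence of the states and from
    that of \<open>L\<close>; in \<open>X\<close> they coincide.\<close>
  have W_eq: "W (snd z) = fst l"
    by (rule X.hlim_unique[OF w wl]) (use m in auto)
  obtain K where K: "\<And>x. x \<in> hcarrier X \<Longrightarrow> hnorm X (D x) \<le> K * hnorm X x"
    using D_bdd by (auto simp: bounded_op_def)
  have Dw: "hlim X (\<lambda>n. D (W (snd (zs n)))) sequentially (D (W (snd z)))"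
    by (rule X.hlim_bounded_image[where K=K, OF _ _ X.hilbert_axioms w])
      (use K m in \<open>auto simp flip: clinear_on_diff[OF X.csubspace_carrier D_lin]\<close>)
  have "hlim X (\<lambda>n. (B (A (fst (zs n))) - D (W (snd (zs n)))) + D (W (snd (zs n)))) sequentially (snd l + D (W (snd z)))"
    by (rule X.hlim_add[OF l2 Dw]) (use m in auto)
  then have Bl: "hlim X (\<lambda>n. B (A (fst (zs n)))) sequentially (snd l + D (W (snd z)))" by simp
  have B_eq: "A (fst z) \<in> domB \<and> B (A (fst z)) = snd l + D (W (snd z))"
    by (rule closed_op_lim[OF B_closed _ Az Bl]) (use m in simp)
  show "z \<in> Z" using Z_iff[of "fst z" "snd z"] z1 B_eq X.hlim_mem[OF z2] W_eq l1 by simp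
  show "L z = l" using L_eq[of "fst z" "snd z"] W_eq B_eq by (simp add: prod_eq_iff)
  show "hlim Y (\<lambda>n. A (fst (zs n))) sequentially (A (fst z))" by (rule Az)
  show "hlim Y (\<lambda>n. A (W (snd (zs n)))) sequentially (A (W (snd z)))" using Aw W_eq by simp
  show "hlim X (\<lambda>n. W (snd (zs n))) sequentially (W (snd z))" by (rule w)
  show "hlim X (\<lambda>n. B (A (fst (zs n)))) sequentially (B (A (fst z)))" using Bl B_eq by simp
qed

text \<open>Weak continuity of the traces: the Green identity against an element with prescribed traces.\<close>

lemma trace_weak:
  assumes zs: "\<And>n. zs n \<in> Z" and z: "hlim V zs sequentially z"
    and l: "hlim V (\<lambda>n. L (zs n)) sequentially (L z)" and u: "u \<in> hcarrier U"
  shows "(\<lambda>n. hinner U (ta (zs n)) u) \<longlonglongrightarrow> hinner U (ta z) u"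
    and "(\<lambda>n. hinner U (tb (zs n)) u) \<longlonglongrightarrow> hinner U (tb z) u"
proof -
  note lim = graph_limit[OF zs z l]
  have *: "(\<lambda>n. hinner U (tb (zs n)) (ta z') + hinner U (ta (zs n)) (tb z')) \<longlonglongrightarrow>
      hinner U (tb z) (ta z') + hinner U (ta z) (tb z')" if z': "z' \<in> Z" for z'
  proof -
    obtain x w where xw: "z' = (x, M w)" "x \<in> domA" "A x \<in> domB" "w \<in> domA"
      using Z_cases[OF z'] .
    have eq: "hinner U (tb v) (ta z') + hinner U (ta v) (tb z') =
        hinner X (B (A (fst v))) w + hinner Y (A (fst v)) (A w) + hinner X (W (snd v)) (B (A x)) +
        hinner Y (A (W (snd v))) (A x)" if v: "v \<in> Z" for v
      by (rule Z_cases[OF v]) (simp add: xw Green_trace)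
    have m: "fst v \<in> domA" "A (fst v) \<in> domB" "W (snd v) \<in> domA" if "v \<in> Z" for v
      using that Z_iff[of "fst v" "snd v"] by simp_all
    show ?thesis
      unfolding eq[OF zs] eq[OF lim(1)]
      using xw m[OF zs] by (intro tendsto_add X.hlim_inner_const Y.hlim_inner_const lim(3-6)) auto
  qed
  have mem: "ta v \<in> hcarrier U" "tb v \<in> hcarrier U" if "v \<in> Z" for v
  proof -
    have "(ta v, tb v) \<in> hcarrier U \<times> hcarrier U"
      unfolding trace_image[symmetric] using that by (rule imageI)
    then show "ta v \<in> hcarrier U" "tb v \<in> hcarrier U" by blast+
  qed
  have obt: "\<exists>z'\<in>Z. ta z' = \<alpha> \<and> tb z' = \<beta>" if "\<alpha> \<in> hcarrier U" "\<beta> \<in> hcarrier U" for \<alpha> \<beta>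
  proof -
    have "(\<alpha>, \<beta>) \<in> (\<lambda>z. (ta z, tb z)) ` Z" unfolding trace_image using that by blast
    then show ?thesis by blast
  qed
  \<comment> \<open>Traces \<open>(0, u)\<close> isolate \<open>ta\<close> in the Green identity,
    and traces \<open>(u, 0)\<close> isolate \<open>tb\<close>.\<close>
  obtain z' where "z' \<in> Z" "ta z' = 0" "tb z' = u" using obt[OF U.zero_mem u] by blast
  with *[of z'] show "(\<lambda>n. hinner U (ta (zs n)) u) \<longlonglongrightarrow> hinner U (ta z) u"
    using mem zs lim(1) by simp
  obtain z' where "z' \<in> Z" "ta z' = u" "tb z' = 0" using obt[OF u U.zero_mem] by blast
  with *[of z'] show "(\<lambda>n. hinner U (tb (zs n)) u) \<longlonglongrightarrow> hinner U (tb z) u"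
    using mem zs lim(1) by simp
qed

section \<open>Dissipativity and the adjoint Green inequality\<close>

lemma inner_V: "z2 \<in> hcarrier X \<Longrightarrow> h2 \<in> hcarrier X \<Longrightarrow>
    hinner V (z1, z2) (h1, h2) = hinner Y (A z1) (A h1) + hinner X z2 (W h2)"
  by (simp add: prod_hs_sel(2) W_symmetric)

text \<open>In \<open>Green_trace\<close> with both states equal to \<open>z\<close> each side is
  twice a real part; the only loss is the damping term.\<close>

lemma trace_dissipative:
  assumes "z \<in> Z"
  shows "Re (hinner V (L z) z) \<le> Re (hinner U (ta z) (tb z))"
proof -
  obtain x w where z: "z = (x, M w)" "x \<in> domA" "A x \<in> domB" "w \<in> domA"
    using Z_cases[OF assms] .
  have mem: "ta z \<in> hcarrier U" "tb z \<in> hcarrier U"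
    using z by (simp_all add: ta_eq tb_eq G1.riesz_mem G2.riesz_mem)
  have G: "hinner U (tb z) (ta z) + hinner U (ta z) (tb z) =
      hinner X (B (A x)) w + hinner Y (A x) (A w) + hinner X w (B (A x)) + hinner Y (A w) (A x)"
    unfolding z(1) using z by (intro Green_trace)
  have "2 * Re (hinner U (ta z) (tb z)) = 2 * (Re (hinner X (B (A x)) w) + Re (hinner Y (A w) (A x)))"
    using arg_cong[OF G, of Re] U.Re_inner_commute[OF mem] X.Re_inner_commute[of w "B (A x)"]
      Y.Re_inner_commute[of "A w" "A x"] z by simp
  moreover have "Re (hinner V (L z) z) = Re (hinner Y (A w) (A x)) + Re (hinner X (B (A x)) w) - Re (hinner X (D w) w)"
    using z by (simp add: L_eq inner_V X.inner_diff_left)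
  moreover have "Re (hinner X (D w) w) \<ge> 0" using D_diss z by simp
  ultimately show ?thesis by (simp only: mult_cancel_left) simp
qed

text \<open>Test states (x, 0) with zero Pi traces yield M^-1 h2 in \<open>domA\<close>, and test
  states (0, M w) with zero Lambda traces yield A h1 in \<open>domB\<close>. After that
  \<open>Green_trace\<close> applies to \<open>h\<close> itself.\<close>

lemma adjoint_traces:
  assumes r: "r > 0" and h: "h \<in> hcarrier V"
    and 0: "\<And>z. z \<in> Z \<Longrightarrow> ta z = 0 \<Longrightarrow> tb z = 0 \<Longrightarrow> hinner V (complex_of_real r *\<^sub>C z - L z) h = 0"
  shows "h \<in> Z"
    and "z \<in> Z \<Longrightarrow> hinner V (complex_of_real r *\<^sub>C z - L z) h = - hinner U (ta z) (tb h) - hinner U (tb z) (ta h)"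
    and "r * (hnorm V h)\<^sup>2 \<le> - Re (hinner U (ta h) (tb h))"
proof -
  let ?r = "complex_of_real r"
  obtain h1 h2 where h_eq: "h = (h1, h2)" by (metis surj_pair)
  define k where "k = W h2"
  have h1: "h1 \<in> domA" and h2: "h2 \<in> hcarrier X" using h by (auto simp: h_eq)
  then have k: "k \<in> hcarrier X" and h2_eq: "h2 = M k" by (simp_all add: k_def)
  have form: "hinner V (?r *\<^sub>C (x, M w) - L (x, M w)) h =
      ?r * hinner Y (A x) (A h1) - hinner Y (A w) (A h1) + ?r * hinner X w (M k) - hinner X (B (A x)) k + hinner X (D w) k"
    if "x \<in> domA" "A x \<in> domB" "w \<in> domA" for x w
  proof -
    have "?r *\<^sub>C (x, M w) - L (x, M w) = (?r *\<^sub>C x - w, ?r *\<^sub>C M w - (B (A x) - D w))"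
      using that by (simp add: L_eq scaleC_prod_def)
    then show ?thesis
      using that h1 k by (simp add: h_eq h2_eq inner_V A_linear X.inner_simps Y.inner_simps M_symmetric)
  qed
  have kA: "k \<in> domA \<and> A k = - (?r *\<^sub>C A h1)"
  proof (rule A_biadjoint[OF k])
    fix y assume y: "y \<in> domB" "Pi1 y = 0" "Pi2 y = 0"
    \<comment> \<open>A general \<open>y\<close> is exchanged for an element of ran A, since only
      such elements occur in \<open>Z\<close>.\<close>
    obtain x where x: "x \<in> domA" "A x \<in> domB" "B (A x) = B y" "Pi1 (A x) = Pi1 y" "Pi2 (A x) = Pi2 y"
      "\<And>w. w \<in> domA \<Longrightarrow> hinner Y y (A w) = hinner Y (A x) (A w)"
      using range_component[OF y(1)] by blast
    have "(x, M 0) \<in> Z" using x by (intro mem_ZI) auto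
    moreover have "ta (x, M 0) = 0" "tb (x, M 0) = 0"
      using x y Lam_linear(3,8) by (simp_all add: ta_eq tb_eq zero_prod_def) (auto simp: riesz_def fun_eq_iff)
    ultimately have "hinner V (?r *\<^sub>C (x, M 0) - L (x, M 0)) h = 0" by (rule 0)
    then have "?r * hinner Y (A x) (A h1) - hinner X (B y) k = 0"
      using form[OF x(1,2), of 0] x(3) h1 k clinear_on_zero[OF X.csubspace_carrier D_lin] by (simp add: A_linear)
    then show "hinner Y y (- (?r *\<^sub>C A h1)) + hinner X (B y) k = 0"
      using x(6)[OF h1] y(1) h1 by (simp add: Y.inner_simps)
  qed (use h1 in simp)
  \<comment> \<open>\<open>d\<close> is the adjoint of \<open>D\<close> applied to
    \<open>k\<close>.\<close>
  obtain d where d: "d \<in> hcarrier X" "\<And>x. x \<in> hcarrier X \<Longrightarrow> hinner X (D x) k = hinner X x d"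
    using adjoint_exists[OF X.hilbert_axioms X.hilbert_axioms D_bdd k] by blast
  have hB: "A h1 \<in> domB \<and> B (A h1) = - (?r *\<^sub>C M k + d)"
  proof (rule A_min_adjoint)
    fix w assume w: "w \<in> domA" "Lam1 w = 0" "Lam2 w = 0"
    have "(0, M w) \<in> Z" using w by (intro mem_ZI) (auto simp: A_linear)
    moreover have "ta (0, M w) = 0" "tb (0, M w) = 0"
      using w Pi_linear(3,8) by (simp_all add: ta_eq tb_eq zero_prod_def A_linear) (auto simp: riesz_def fun_eq_iff)
    ultimately have "hinner V (?r *\<^sub>C (0, M w) - L (0, M w)) h = 0" by (rule 0)
    then have "?r * hinner X w (M k) - hinner Y (A w) (A h1) + hinner X w d = 0"
      using form[of 0 w] w h1 k d by (simp add: A_linear B_linear)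
    then have "hinner Y (A w) (A h1) = ?r * hinner X w (M k) + hinner X w d" by algebra
    then show "hinner Y (A w) (A h1) = hinner X w (?r *\<^sub>C M k + d)"
      using w k d by (simp add: X.inner_simps)
  qed (use h1 k d in auto)
  show "h \<in> Z" unfolding h_eq h2_eq using h1 hB kA by (intro mem_ZI) auto
  have Green_h: "hinner U (tb (x, M w)) (ta h) + hinner U (ta (x, M w)) (tb h) =
      hinner X (B (A x)) k - ?r * hinner Y (A x) (A h1) - ?r * hinner X w (M k) - hinner X (D w) k + hinner Y (A w) (A h1)"
    if xw: "x \<in> domA" "A x \<in> domB" "w \<in> domA" for x w
  proof -
    have "hinner U (tb (x, M w)) (ta h) + hinner U (ta (x, M w)) (tb h) =
        hinner X (B (A x)) k + hinner Y (A x) (A k) + hinner X w (B (A h1)) + hinner Y (A w) (A h1)"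
      unfolding h_eq h2_eq using xw h1 hB kA by (intro Green_trace) auto
    then show ?thesis
      using xw h1 k d kA hB by (simp add: X.inner_simps Y.inner_simps)
  qed
  show "hinner V (?r *\<^sub>C z - L z) h = - hinner U (ta z) (tb h) - hinner U (tb z) (ta h)" if z: "z \<in> Z" for z
  proof -
    obtain x w where xw: "z = (x, M w)" "x \<in> domA" "A x \<in> domB" "w \<in> domA" using Z_cases[OF z] .
    have "hinner V (?r *\<^sub>C z - L z) h = - (hinner U (tb z) (ta h) + hinner U (ta z) (tb h))"
      unfolding xw(1) form[OF xw(2-4)] Green_h[OF xw(2-4)] by simp
    then show ?thesis by simp
  qed
  have mem: "ta h \<in> hcarrier U" "tb h \<in> hcarrier U"
    using h1 hB kA by (simp_all add: h_eq h2_eq ta_eq tb_eq G1.riesz_mem G2.riesz_mem)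
  have "hinner U (tb h) (ta h) + hinner U (ta h) (tb h) =
      hinner X (B (A h1)) k - ?r * hinner Y (A h1) (A h1) - ?r * hinner X k (M k) - hinner X (D k) k + hinner Y (A k) (A h1)"
    using Green_h[of h1 k] h1 hB kA by (simp add: h_eq h2_eq)
  from arg_cong[OF this, of Re]
  have 1: "2 * Re (hinner U (ta h) (tb h)) = Re (hinner X (B (A h1)) k) - r * Re (hinner Y (A h1) (A h1))
      - r * Re (hinner X k (M k)) - Re (hinner X (D k) k) + Re (hinner Y (A k) (A h1))"
    using U.Re_inner_commute[OF mem] by simp
  have "hinner X (B (A h1)) k = - ?r * hinner X k (M k) - hinner X d k"
    using hB k d(1) M_symmetric[of k k] by (simp add: X.inner_simps)
  then have 2: "Re (hinner X (B (A h1)) k) = - r * Re (hinner X k (M k)) - Re (hinner X (D k) k)"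
    using d(2)[OF k] X.Re_inner_commute[OF k d(1)] by simp
  have "hinner Y (A k) (A h1) = - ?r * hinner Y (A h1) (A h1)"
    using kA h1 by (simp add: Y.inner_simps)
  then have 3: "Re (hinner Y (A k) (A h1)) = - r * Re (hinner Y (A h1) (A h1))" by simp
  have 4: "(hnorm V h)\<^sup>2 = Re (hinner Y (A h1) (A h1)) + Re (hinner X k (M k))"
    unfolding V.norm_sq[OF h] unfolding h_eq h2_eq using k M_symmetric[of k k] by (simp add: inner_V)
  have 5: "Re (hinner X (D k) k) \<ge> 0" using D_diss k by simp
  \<comment> \<open>Here \<alpha> and \<kappa> are the energies of the two components, \<delta> the
    damping term and \<rho> the boundary term. The premise amounts to \<rho> = - r (\<alpha> +
    \<kappa>) - \<delta>.\<close>
  have "r * (\<alpha> + \<kappa>) \<le> - \<rho>"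
    if "2 * \<rho> = (- r * \<kappa> - \<delta>) - r * \<alpha> - r * \<kappa> - \<delta> + - r * \<alpha>" "\<delta> \<ge> 0" for \<alpha> \<kappa> \<rho> \<delta> :: real
    using that by (simp add: algebra_simps)
  from this[OF 1[unfolded 2 3] 5] show "r * (hnorm V h)\<^sup>2 \<le> - Re (hinner U (ta h) (tb h))"
    unfolding 4 .
qed

lemma boundary_triple: "boundary_triple U V Z L ta tb"
proof
  show "\<exists>a'\<in>hcarrier U. \<exists>b'\<in>hcarrier U.
      (\<forall>z\<in>Z. hinner V (complex_of_real r *\<^sub>C z - L z) h = - hinner U (ta z) b' - hinner U (tb z) a') \<and>
      r * (hnorm V h)\<^sup>2 \<le> - Re (hinner U a' b')"
    if "r > 0" "h \<in> hcarrier V"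
      "\<And>z. z \<in> Z \<Longrightarrow> ta z = 0 \<Longrightarrow> tb z = 0 \<Longrightarrow> hinner V (complex_of_real r *\<^sub>C z - L z) h = 0" for r h
  proof -
    have "(ta h, tb h) \<in> hcarrier U \<times> hcarrier U"
      unfolding trace_image[symmetric] using adjoint_traces(1)[OF that] by (rule imageI)
    then have mem: "ta h \<in> hcarrier U" "tb h \<in> hcarrier U" by blast+
    show ?thesis
      by (intro bexI[of _ "ta h"] bexI[of _ "tb h"] conjI ballI adjoint_traces(2)[OF that] adjoint_traces(3)[OF that] mem)
  qed
  show "csubspace Z" "Z \<subseteq> hcarrier V" "clinear_on Z L" "clinear_on Z ta" "clinear_on Z tb" "L ` Z \<subseteq> hcarrier V"
    "(\<lambda>z. (ta z, tb z)) ` Z = hcarrier U \<times> hcarrier U"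
    by (fact csubspace_Z Z_subset clinear_on_L clinear_on_ta clinear_on_tb L_image trace_image)+
  show "z \<in> Z \<and> L z = l"
    if "\<And>n. zs n \<in> Z" "hlim V zs sequentially z" "hlim V (\<lambda>n. L (zs n)) sequentially l" for zs z l
    using graph_limit(1,2)[OF that] ..
  show "(\<lambda>n. hinner U (ta (zs n)) u) \<longlonglongrightarrow> hinner U (ta z) u \<and> (\<lambda>n. hinner U (tb (zs n)) u) \<longlonglongrightarrow> hinner U (tb z) u"
    if "\<And>n. zs n \<in> Z" "z \<in> Z" "hlim V zs sequentially z" "hlim V (\<lambda>n. L (zs n)) sequentially (L z)" "u \<in> hcarrier U"
    for zs z u
    using trace_weak[OF that(1,3-5)] ..
  show "Re (hinner V (L z) z) \<le> Re (hinner U (ta z) (tb z))" if "z \<in> Z" for z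
    using that by (rule trace_dissipative)
qed

end

theorem theorem3p9:
  fixes X :: "'x::cvec hspace" and Y :: "'y::cvec hspace"
    and G1 :: "'g1::cvec hspace" and G2 :: "'g2::cvec hspace"
    and domA :: "'x set" and A :: "'x \<Rightarrow> 'y" and c :: real
    and domB :: "'y set" and B :: "'y \<Rightarrow> 'x"
    and Lam1 :: "'x \<Rightarrow> 'g1" and Lam2 :: "'x \<Rightarrow> 'g2 \<Rightarrow> complex"
    and Pi1 :: "'y \<Rightarrow> 'g1 \<Rightarrow> complex" and Pi2 :: "'y \<Rightarrow> 'g2"
    and M D :: "'x \<Rightarrow> 'x"
    and P :: "('g1 \<Rightarrow> complex) \<times> ('g2 \<Rightarrow> complex) \<Rightarrow> ('g1 \<Rightarrow> complex) \<times> ('g2 \<Rightarrow> complex)"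
  assumes hX: "is_hilbert X" and hY: "is_hilbert Y"
    and hG1: "is_hilbert G1" and hG2: "is_hilbert G2"
    and A_closed: "closed_op X Y domA A" and A_dense: "dense_in X domA"
    and c_pos: "c > 0" and A_below: "\<forall>x\<in>domA. hnorm Y (A x) \<ge> c * hnorm X x"
    and B_closed: "closed_op Y X domB B" and B_dense: "dense_in Y domB"
    and adj: "\<forall>y\<in>hcarrier Y. \<forall>w\<in>hcarrier X.
                 (\<forall>x\<in>domA. hinner Y (A x) y = hinner X x w) \<longrightarrow> y \<in> domB \<and> B y = - w"
    and Lam_lin: "clinear_on domA Lam1" "clinear_on domA Lam2"
    and Lam_surj: "(\<lambda>x. (Lam1 x, Lam2 x)) ` domA = hcarrier G1 \<times> hcarrier (antidual G2)"
    and Pi_lin: "clinear_on domB Pi1" "clinear_on domB Pi2"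
    and Pi_surj: "(\<lambda>y. (Pi1 y, Pi2 y)) ` domB = hcarrier (antidual G1) \<times> hcarrier G2"
    and green: "\<forall>y\<in>domB. \<forall>x\<in>domA.
                 - hinner X (B y) x - hinner Y y (A x) = Pi1 y (Lam1 x) - cnj (Lam2 x (Pi2 y))"
    and M_bdd: "bounded_op X X M"
    and M_sa: "\<forall>x\<in>hcarrier X. \<forall>y\<in>hcarrier X. hinner X (M x) y = hinner X x (M y)"
    and M_pos: "\<exists>m>0. \<forall>x\<in>hcarrier X. Re (hinner X (M x) x) \<ge> m * (hnorm X x)\<^sup>2"
    and D_bdd: "bounded_op X X D"
    and D_diss: "\<forall>x\<in>hcarrier X. Re (hinner X (D x) x) \<ge> 0"
    and P_bdd: "bounded_op (prod_hs (antidual G1) (antidual G2)) (prod_hs (antidual G1) (antidual G2)) P"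
    and P_contr: "\<forall>\<phi>\<in>hcarrier (prod_hs (antidual G1) (antidual G2)).
                    hnorm (prod_hs (antidual G1) (antidual G2)) (P \<phi>)
                      \<le> hnorm (prod_hs (antidual G1) (antidual G2)) \<phi>"
  shows "impedance_passive (prod_hs (antidual G1) (antidual G2)) (prod_hs (Xh Y domA A) (XM X M))
           (dom_AM X domA A domB M) (N_in G1 G2 X M A Lam1 Lam2 Pi1 Pi2 P) (op_AM X A B M D)
           (N_out G1 G2 X M A Lam1 Lam2 Pi1 Pi2 P)
       \<and> internally_well_posed (prod_hs (antidual G1) (antidual G2)) (prod_hs (Xh Y domA A) (XM X M))
           (prod_hs (antidual G1) (antidual G2))
           (dom_AM X domA A domB M) (N_in G1 G2 X M A Lam1 Lam2 Pi1 Pi2 P) (op_AM X A B M D)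
           (N_out G1 G2 X M A Lam1 Lam2 Pi1 Pi2 P)"
proof -
  interpret X: hilbert X by standard (rule hX)
  interpret Y: hilbert Y by standard (rule hY)
  interpret G1: hilbert G1 by standard (rule hG1)
  interpret G2: hilbert G2 by standard (rule hG2)
  interpret port_system X Y domA A c M G1 G2 domB B Lam1 Lam2 Pi1 Pi2 D
    by unfold_locales (fact assms)+
  interpret T: boundary_triple U V Z L ta tb by (rule boundary_triple)
  have P_le: "hnorm U (P \<phi>) \<le> hnorm U \<phi>" if "\<phi> \<in> hcarrier U" for \<phi>
    using P_contr that by blast
  have "N_in G1 G2 X M A Lam1 Lam2 Pi1 Pi2 P = T.G_P P" "N_out G1 G2 X M A Lam1 Lam2 Pi1 Pi2 P = T.K_P P"
    unfolding T.G_P_def T.K_P_def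
    by (simp_all add: N_in_def N_out_def ta_def tb_def Let_def)
  then show ?thesis
    using T.impedance_passive_P[OF P_bdd P_le] T.internally_well_posed_P[OF P_bdd P_le] by simp
qed

end
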